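(* Let $G$ be a finite group, $H$ a subgroup of $G$ and $\alpha\in Z^2(H,\mathbb{C}^* )$ a 2-cocycle. Then the $\mathbb{Z}_+$-module $r(H,\alpha)$ over the complex representation ring $r(G)$ is a based module.
   Context: $r(G)$ is the Grothendieck ring of finite-dimensional complex representations of $G$, with $\mathbb{Z}$-basis $\{\psi_i\}_{i\in I}$ the classes of irreducible representations, and involution $i\mapsto i^*$ of $I$ given by taking dual representations. For $\alpha\in Z^2(H,\mathbb{C}^* )$ (trivial action), $\mathrm{Rep}(H,\alpha)$ is the category of finite-dimensional projective representations of $H$ with multiplier $\alpha$, i.e. of finite-dimensional modules over the twisted group algebra $\mathbb{C}H_\alpha$, which has $\mathbb{C}$-basis $H$ and multiplication $g\cdot_\alpha h=\alpha(g,h)\,gh$. It is a semisimple module category over $\mathrm{Rep}(G)$ via $V\otimes N:=\mathrm{Res}^G_H(V)\otimes N$. Its Grothendieck group $r(H,\alpha)$, with fixed $\mathbb{Z}$-basis $\{\chi_k\}_{k}$ the isomorphism classes of simple objects, is thereby an $r(G)$-module with non-negative integer structure constants (a $\mathbb{Z}_+$-module): $\psi_i\cdot\chi_k=\sum_l a_{ik}^l\chi_l$ with $a_{ik}^l\in\mathbb{Z}_{\ge0}$. Such a $\mathbb{Z}_+$-module is called a based module over $r(G)$ if $a_{ik}^l=a_{i^*l}^k$ for all $i,k,l$. *)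

theory Defs
  imports
    "HOL-Algebra.Free_Abelian_Groups"
    "Jordan_Normal_Form.Matrix_Kernel"
begin

section \<open>Based modules\<close>

text \<open>Both for a ring and for a module, only the underlying additive group matters
  here.\<close>

definition int_lincomb :: "('a, 'x) ring_scheme \<Rightarrow> ('i \<Rightarrow> 'a) \<Rightarrow> ('i \<Rightarrow> int) \<Rightarrow> 'a" where
  "int_lincomb M b c = (\<Oplus>\<^bsub>M\<^esub>i\<in>{i. c i \<noteq> 0}. [c i] \<cdot>\<^bsub>M\<^esub> b i)"

definition int_coeffs :: "'i set \<Rightarrow> ('i \<Rightarrow> int) set" where
  "int_coeffs I = {c. finite {i. c i \<noteq> 0} \<and> {i. c i \<noteq> 0} \<subseteq> I}"

definition int_basis :: "('a, 'x) ring_scheme \<Rightarrow> 'i set \<Rightarrow> ('i \<Rightarrow> 'a) \<Rightarrow> bool" where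
  "int_basis M I b \<longleftrightarrow>
     b \<in> I \<rightarrow> carrier M \<and>
     (\<forall>x\<in>carrier M. \<exists>!c. c \<in> int_coeffs I \<and> x = int_lincomb M b c)"

definition coord :: "('a, 'x) ring_scheme \<Rightarrow> 'i set \<Rightarrow> ('i \<Rightarrow> 'a) \<Rightarrow> 'a \<Rightarrow> 'i \<Rightarrow> int" where
  "coord M I b x = (THE c. c \<in> int_coeffs I \<and> x = int_lincomb M b c)"

text \<open>The structure constant \<open>a\<^sub>i\<^sub>k\<^sup>l\<close> is \<open>struct_const \<psi> M K \<chi> i k l\<close>.\<close>

definition struct_const ::
  "('i \<Rightarrow> 'r) \<Rightarrow> ('r, 'm, 'x) module_scheme \<Rightarrow> 'k set \<Rightarrow> ('k \<Rightarrow> 'm) \<Rightarrow> 'i \<Rightarrow> 'k \<Rightarrow> 'k \<Rightarrow> int" where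
  "struct_const \<psi> M K \<chi> i k l = coord M K \<chi> (\<psi> i \<odot>\<^bsub>M\<^esub> \<chi> k) l"

definition Zplus_module ::
  "('r, 'y) ring_scheme \<Rightarrow> 'i set \<Rightarrow> ('i \<Rightarrow> 'r) \<Rightarrow>
   ('r, 'm, 'x) module_scheme \<Rightarrow> 'k set \<Rightarrow> ('k \<Rightarrow> 'm) \<Rightarrow> bool" where
  "Zplus_module R I \<psi> M K \<chi> \<longleftrightarrow>
     module R M \<and> int_basis R I \<psi> \<and> int_basis M K \<chi> \<and>
     (\<forall>i\<in>I. \<forall>k\<in>K. \<forall>l\<in>K. struct_const \<psi> M K \<chi> i k l \<ge> 0)"

definition based_module ::
  "('r, 'y) ring_scheme \<Rightarrow> 'i set \<Rightarrow> ('i \<Rightarrow> 'r) \<Rightarrow> ('i \<Rightarrow> 'i) \<Rightarrow>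
   ('r, 'm, 'x) module_scheme \<Rightarrow> 'k set \<Rightarrow> ('k \<Rightarrow> 'm) \<Rightarrow> bool" where
  "based_module R I \<psi> star M K \<chi> \<longleftrightarrow>
     Zplus_module R I \<psi> M K \<chi> \<and>
     star \<in> I \<rightarrow> I \<and> (\<forall>i\<in>I. star (star i) = i) \<and>
     (\<forall>i\<in>I. \<forall>k\<in>K. \<forall>l\<in>K.
        struct_const \<psi> M K \<chi> i k l = struct_const \<psi> M K \<chi> (star i) l k)"


section \<open>Projective representations\<close>

definition cocycle2 :: "('g, 'b) monoid_scheme \<Rightarrow> ('g \<Rightarrow> 'g \<Rightarrow> complex) \<Rightarrow> bool" where
  "cocycle2 H \<alpha> \<longleftrightarrow>
     (\<forall>g\<in>carrier H. \<forall>h\<in>carrier H. \<alpha> g h \<noteq> 0) \<and>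
     (\<forall>g\<in>carrier H. \<forall>h\<in>carrier H. \<forall>k\<in>carrier H.
        \<alpha> g h * \<alpha> (g \<otimes>\<^bsub>H\<^esub> h) k = \<alpha> h k * \<alpha> g (h \<otimes>\<^bsub>H\<^esub> k))"

abbreviation trivial_cocycle :: "'g \<Rightarrow> 'g \<Rightarrow> complex" where
  "trivial_cocycle \<equiv> \<lambda>_ _. 1"

text \<open>A representation on \<open>\<complex>\<^sup>n\<close> is given by \<open>n\<close> and the matrices of the group elements.
  Values outside the group are irrelevant.\<close>

type_synonym 'g mrep = "nat \<times> ('g \<Rightarrow> complex mat)"

text \<open>The cocycle need not be normalised: invertibility of the matrices forces
  \<open>\<rho> \<one> = \<alpha> \<one> \<one> \<cdot> id\<close>, which is what unitality of a module over the twisted group algebra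
  amounts to.  Ordinary representations are the case of the trivial cocycle.\<close>

definition proj_reps :: "('g, 'b) monoid_scheme \<Rightarrow> ('g \<Rightarrow> 'g \<Rightarrow> complex) \<Rightarrow> 'g mrep set" where
  "proj_reps H \<alpha> = {(n, \<rho>).
     (\<forall>g\<in>carrier H. \<rho> g \<in> carrier_mat n n \<and> invertible_mat (\<rho> g)) \<and>
     (\<forall>g\<in>carrier H. \<forall>h\<in>carrier H. \<rho> g * \<rho> h = \<alpha> g h \<cdot>\<^sub>m \<rho> (g \<otimes>\<^bsub>H\<^esub> h))}"

definition intertwiners :: "('g, 'b) monoid_scheme \<Rightarrow> 'g mrep \<Rightarrow> 'g mrep \<Rightarrow> complex mat set" where
  "intertwiners H X Y =
     {A \<in> carrier_mat (fst Y) (fst X). \<forall>g\<in>carrier H. A * snd X g = snd Y g * A}"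

definition short_exact ::
  "('g, 'b) monoid_scheme \<Rightarrow> 'g mrep \<Rightarrow> 'g mrep \<Rightarrow> 'g mrep \<Rightarrow> bool" where
  "short_exact H X Y Z \<longleftrightarrow>
     (\<exists>A\<in>intertwiners H X Y. \<exists>B\<in>intertwiners H Y Z.
        inj_on ((*\<^sub>v) A) (carrier_vec (fst X)) \<and>
        (*\<^sub>v) A ` carrier_vec (fst X) = mat_kernel B \<and>
        (*\<^sub>v) B ` carrier_vec (fst Y) = carrier_vec (fst Z))"

definition iso_class ::
  "('g, 'b) monoid_scheme \<Rightarrow> ('g \<Rightarrow> 'g \<Rightarrow> complex) \<Rightarrow> 'g mrep \<Rightarrow> 'g mrep set" where
  "iso_class H \<alpha> X = {Y \<in> proj_reps H \<alpha>. \<exists>A\<in>intertwiners H X Y. invertible_mat A}"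

definition simple_rep ::
  "('g, 'b) monoid_scheme \<Rightarrow> ('g \<Rightarrow> 'g \<Rightarrow> complex) \<Rightarrow> 'g mrep \<Rightarrow> bool" where
  "simple_rep H \<alpha> X \<longleftrightarrow> X \<in> proj_reps H \<alpha> \<and> fst X > 0 \<and>
     (\<forall>W. VectorSpace.subspace class_ring W (module_vec TYPE(complex) (fst X)) \<and>
          (\<forall>g\<in>carrier H. \<forall>w\<in>W. snd X g *\<^sub>v w \<in> W)
        \<longrightarrow> W = {0\<^sub>v (fst X)} \<or> W = carrier_vec (fst X))"

definition simple_classes ::
  "('g, 'b) monoid_scheme \<Rightarrow> ('g \<Rightarrow> 'g \<Rightarrow> complex) \<Rightarrow> 'g mrep set set" where
  "simple_classes H \<alpha> = {iso_class H \<alpha> X | X. simple_rep H \<alpha> X}"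

definition kronecker :: "complex mat \<Rightarrow> complex mat \<Rightarrow> complex mat" where
  "kronecker A B = mat (dim_row A * dim_row B) (dim_col A * dim_col B)
     (\<lambda>(i, j). A $$ (i div dim_row B, j div dim_col B) * B $$ (i mod dim_row B, j mod dim_col B))"

definition tensor_rep :: "'g mrep \<Rightarrow> 'g mrep \<Rightarrow> 'g mrep" where
  "tensor_rep X Y = (fst X * fst Y, \<lambda>g. kronecker (snd X g) (snd Y g))"

definition res_rep :: "'g set \<Rightarrow> 'g mrep \<Rightarrow> 'g mrep" where
  "res_rep H X = (fst X, restrict (snd X) H)"

definition unit_rep :: "'g mrep" where
  "unit_rep = (1, \<lambda>_. 1\<^sub>m 1)"

definition dual_rep :: "('g, 'b) monoid_scheme \<Rightarrow> 'g mrep \<Rightarrow> 'g mrep" where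
  "dual_rep G X = (fst X, \<lambda>g. (snd X (inv\<^bsub>G\<^esub> g))\<^sup>T)"

definition dual_class :: "('g, 'b) monoid_scheme \<Rightarrow> 'g mrep set \<Rightarrow> 'g mrep set" where
  "dual_class G i = (\<Union>X\<in>i. iso_class G trivial_cocycle (dual_rep G X))"


section \<open>Grothendieck groups\<close>

definition groth_relations ::
  "('g, 'b) monoid_scheme \<Rightarrow> ('g \<Rightarrow> 'g \<Rightarrow> complex) \<Rightarrow> ('g mrep \<Rightarrow>\<^sub>0 int) set" where
  "groth_relations H \<alpha> = generate (free_Abelian_group (proj_reps H \<alpha>))
     {frag_of Y - frag_of X - frag_of Z | X Y Z.
        X \<in> proj_reps H \<alpha> \<and> Y \<in> proj_reps H \<alpha> \<and> Z \<in> proj_reps H \<alpha> \<and> short_exact H X Y Z}"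

text \<open>Written multiplicatively, as are all groups in \<^theory>\<open>HOL-Algebra.Group\<close>.\<close>

definition groth_group ::
  "('g, 'b) monoid_scheme \<Rightarrow> ('g \<Rightarrow> 'g \<Rightarrow> complex) \<Rightarrow> ('g mrep \<Rightarrow>\<^sub>0 int) set monoid" where
  "groth_group H \<alpha> = free_Abelian_group (proj_reps H \<alpha>) Mod groth_relations H \<alpha>"

definition groth_coset ::
  "('g, 'b) monoid_scheme \<Rightarrow> ('g \<Rightarrow> 'g \<Rightarrow> complex) \<Rightarrow> ('g mrep \<Rightarrow>\<^sub>0 int) \<Rightarrow> ('g mrep \<Rightarrow>\<^sub>0 int) set" where
  "groth_coset H \<alpha> x = groth_relations H \<alpha> #>\<^bsub>free_Abelian_group (proj_reps H \<alpha>)\<^esub> x"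

text \<open>The element of the Grothendieck group defined by an isomorphism class; all
  representatives have the same coset.\<close>

definition groth_class ::
  "('g, 'b) monoid_scheme \<Rightarrow> ('g \<Rightarrow> 'g \<Rightarrow> complex) \<Rightarrow> 'g mrep set \<Rightarrow> ('g mrep \<Rightarrow>\<^sub>0 int) set" where
  "groth_class H \<alpha> k = the_elem ((\<lambda>X. groth_coset H \<alpha> (frag_of X)) ` k)"

definition bilinear_ext ::
  "('a \<Rightarrow> 'b \<Rightarrow> 'c) \<Rightarrow> ('a \<Rightarrow>\<^sub>0 int) \<Rightarrow> ('b \<Rightarrow>\<^sub>0 int) \<Rightarrow> ('c \<Rightarrow>\<^sub>0 int)" where
  "bilinear_ext t x y = frag_extend (\<lambda>a. frag_extend (\<lambda>b. frag_of (t a b)) y) x"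

text \<open>Products of cosets are formed as in the factor rings of HOL-Algebra: a union over
  representatives, all of which contribute the same coset.\<close>

definition rep_ring :: "('g, 'b) monoid_scheme \<Rightarrow> ('g mrep \<Rightarrow>\<^sub>0 int) set ring" where
  "rep_ring G =
    \<lparr>carrier = carrier (groth_group G trivial_cocycle),
     mult = (\<lambda>A B. \<Union>a\<in>A. \<Union>b\<in>B. groth_coset G trivial_cocycle (bilinear_ext tensor_rep a b)),
     one = groth_coset G trivial_cocycle (frag_of unit_rep),
     zero = monoid.one (groth_group G trivial_cocycle),
     add = monoid.mult (groth_group G trivial_cocycle)\<rparr>"

text \<open>The fields \<open>mult\<close> and \<open>one\<close> of a module record play no role.\<close>

definition twisted_rep_module ::
  "('g, 'b) monoid_scheme \<Rightarrow> 'g set \<Rightarrow> ('g \<Rightarrow> 'g \<Rightarrow> complex) \<Rightarrow>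
   (('g mrep \<Rightarrow>\<^sub>0 int) set, ('g mrep \<Rightarrow>\<^sub>0 int) set) module" where
  "twisted_rep_module G H \<alpha> =
    (let K = G\<lparr>carrier := H\<rparr> in
    \<lparr>carrier = carrier (groth_group K \<alpha>),
     mult = undefined,
     one = undefined,
     zero = monoid.one (groth_group K \<alpha>),
     add = monoid.mult (groth_group K \<alpha>),
     smult = (\<lambda>A B. \<Union>a\<in>A. \<Union>b\<in>B.
       groth_coset K \<alpha> (bilinear_ext (\<lambda>V N. tensor_rep (res_rep H V) N) a b))\<rparr>)"

end

theory Submission
  imports Defs "Jordan_Normal_Form.Spectral_Radius"
begin

text \<open>Everything is read off from characters.  For representations \<open>X\<close>, \<open>Y\<close> with the same
  multiplier put \<open>\<langle>X, Y\<rangle> = 1/|H| \<Sum>\<^sub>g tr X(g) tr (Y(g)\<inverse>)\<close>.  The multiplier cancels, so Schur's lemma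
  makes this pairing orthonormal on simple representations.  Characters are additive on short
  exact sequences and every representation is, modulo the relations of the Grothendieck group, a
  nonnegative combination of simple ones; hence two elements of the Grothendieck group agree iff
  their characters do, the simple classes form a basis, and coordinates are computed by the pairing.
  Ring and module axioms become identities between functions on the group.  Since
  \<open>Y(g)\<inverse> = Y(g\<inverse>)/\<beta>(g)\<close> with \<open>\<beta>(g\<inverse>) = \<beta>(g)\<close>, substituting \<open>g\<inverse>\<close> for \<open>g\<close> in
  \<open>a\<^sub>i\<^sub>k\<^sup>l = 1/|H| \<Sum>\<^sub>g \<psi>\<^sub>i(g) \<chi>\<^sub>k(g) \<chi>\<^sub>l(g\<inverse>)/\<beta>(g)\<close> turns \<open>\<psi>\<^sub>i\<close> into its dual and exchanges \<open>k\<close> and \<open>l\<close>.\<close>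

section \<open>Traces and Kronecker products\<close>

text \<open>The values of the multiplier are arbitrary nonzero complex numbers, so the matrices of a
  projective representation need not be unitary in any basis. Hence the pairing carries the trace of
  an inverse matrix where a Hermitian product would carry a complex conjugate. The multiplier is not
  normalised either, which is the origin of the factor \<open>\<alpha> \<one> \<one>\<close> in
  \<open>\<beta>\<close>.

  The reduction to simple classes rests on short exact sequences, the very relations divided out: a
  proper nonzero invariant subspace gives a sequence whose outer terms have smaller dimension, so
  induction applies. It also supplies integrality and nonnegativity of coordinates, which the
  pairing, a complex number, does not show.

  The main obstacle lies between two languages. Simplicity quantifies over subspaces and exactness
  speaks of images and kernels, whereas representations are families of matrices. Each subspace is
  therefore turned into a matrix with a left inverse and a complementary pair; invariance, quotients
  and additivity of the trace then become matrix identities.\<close>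

definition mtrace :: "complex mat \<Rightarrow> complex" where
  "mtrace A = (\<Sum>i<dim_row A. A $$ (i, i))"

lemma mtrace_mult_comm:
  assumes "A \<in> carrier_mat n m" "B \<in> carrier_mat m n"
  shows "mtrace (A * B) = mtrace (B * A)"
proof -
  have "mtrace (A * B) = (\<Sum>i<n. \<Sum>j<m. A $$ (i, j) * B $$ (j, i))"
    using assms by (auto simp: mtrace_def scalar_prod_def lessThan_atLeast0 intro!: sum.cong)
  also have "\<dots> = (\<Sum>j<m. \<Sum>i<n. B $$ (j, i) * A $$ (i, j))"
    by (subst sum.swap) (simp add: mult.commute)
  also have "\<dots> = mtrace (B * A)"
    using assms by (auto simp: mtrace_def scalar_prod_def lessThan_atLeast0 intro!: sum.cong)
  finally show ?thesis .
qed

lemma mtrace_add: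
  assumes "A \<in> carrier_mat n n" "B \<in> carrier_mat n n"
  shows "mtrace (A + B) = mtrace A + mtrace B"
  using assms by (auto simp: mtrace_def sum.distrib)

lemma mtrace_smult: "A \<in> carrier_mat n n \<Longrightarrow> mtrace (c \<cdot>\<^sub>m A) = c * mtrace A"
  by (auto simp: mtrace_def sum_distrib_left)

lemma mtrace_one [simp]: "mtrace (1\<^sub>m n) = of_nat n"
  by (simp add: mtrace_def)

lemma mtrace_transpose: "A \<in> carrier_mat n n \<Longrightarrow> mtrace (A\<^sup>T) = mtrace A"
  by (auto simp: mtrace_def)

text \<open>The range is cut into \<open>n\<close> blocks of length \<open>m\<close>. Kronecker
  products are indexed by quotient and remainder, so every sum over their indices is brought to a
  double sum in this way.\<close>

lemma sum_lessThan_mult_nat: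
  fixes f :: "nat \<Rightarrow> 'a::comm_monoid_add"
  shows "(\<Sum>h<n * m. f h) = (\<Sum>i<n. \<Sum>j<m. f (i * m + j))"
proof -
  have "sum f {i * m..<i * m + m} = (\<Sum>j<m. f (i * m + j))" for i
    using sum.shift_bounds_nat_ivl[of f 0 "i * m" m] by (simp add: add.commute lessThan_atLeast0)
  then show ?thesis
    by (simp flip: sum.nat_group)
qed

lemma sum_lessThan_mult_div_mod:
  fixes f :: "nat \<Rightarrow> nat \<Rightarrow> 'a::comm_monoid_add"
  shows "(\<Sum>h<n * m. f (h div m) (h mod m)) = (\<Sum>i<n. \<Sum>j<m. f i j)"
  unfolding sum_lessThan_mult_nat by (auto intro!: sum.cong)

lemma kronecker_carrier:
  "A \<in> carrier_mat n m \<Longrightarrow> B \<in> carrier_mat p q \<Longrightarrow> kronecker A B \<in> carrier_mat (n * p) (m * q)"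
  by (auto simp: kronecker_def)

text \<open>The inner summation index of the product splits into quotient and remainder modulo
  \<open>q\<close>, and the resulting double sum factors into the two separate matrix
  products.\<close>

lemma kronecker_mult:
  assumes "A \<in> carrier_mat n m" "B \<in> carrier_mat p q" "C \<in> carrier_mat m k" "D \<in> carrier_mat q l"
  shows "kronecker A B * kronecker C D = kronecker (A * C) (B * D)"
proof (rule eq_matI)
  fix i j assume "i < dim_row (kronecker (A * C) (B * D))" "j < dim_col (kronecker (A * C) (B * D))"
  then have i: "i < n * p" and j: "j < k * l" using assms by (auto simp: kronecker_def)
  have i': "i div p < n" "i mod p < p" and j': "j div l < k" "j mod l < l"
    using i j by (auto simp: less_mult_imp_div_less intro!: mod_less_divisor gr0I)
  have "(kronecker A B * kronecker C D) $$ (i, j) =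
      (\<Sum>h<m * q. (A $$ (i div p, h div q) * C $$ (h div q, j div l)) *
                   (B $$ (i mod p, h mod q) * D $$ (h mod q, j mod l)))"
    using assms i j by (auto simp: kronecker_def scalar_prod_def lessThan_atLeast0 intro!: sum.cong)
  also have "\<dots> = (\<Sum>a<m. \<Sum>b<q. (A $$ (i div p, a) * C $$ (a, j div l)) *
                   (B $$ (i mod p, b) * D $$ (b, j mod l)))"
    by (rule sum_lessThan_mult_div_mod)
  also have "\<dots> = (A * C) $$ (i div p, j div l) * (B * D) $$ (i mod p, j mod l)"
    using assms i' j' by (simp add: scalar_prod_def sum_product lessThan_atLeast0)
  also have "\<dots> = kronecker (A * C) (B * D) $$ (i, j)"
    using assms i j by (simp add: kronecker_def)
  finally show "(kronecker A B * kronecker C D) $$ (i, j) = kronecker (A * C) (B * D) $$ (i, j)" .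
qed (use assms in \<open>auto simp: kronecker_def\<close>)

lemma kronecker_smult:
  "kronecker (a \<cdot>\<^sub>m A) (b \<cdot>\<^sub>m B) = (a * b) \<cdot>\<^sub>m kronecker A B"
proof (rule eq_matI)
  fix i j assume "i < dim_row ((a * b) \<cdot>\<^sub>m kronecker A B)" "j < dim_col ((a * b) \<cdot>\<^sub>m kronecker A B)"
  then have i: "i < dim_row A * dim_row B" and j: "j < dim_col A * dim_col B"
    by (auto simp: kronecker_def)
  then have "0 < dim_row B" "0 < dim_col B" by (auto intro!: gr0I)
  with i j show "kronecker (a \<cdot>\<^sub>m A) (b \<cdot>\<^sub>m B) $$ (i, j) = ((a * b) \<cdot>\<^sub>m kronecker A B) $$ (i, j)"
    by (simp add: kronecker_def less_mult_imp_div_less)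
qed (auto simp: kronecker_def)

lemma kronecker_one: "kronecker (1\<^sub>m n) (1\<^sub>m m) = 1\<^sub>m (n * m)"
proof (rule eq_matI)
  fix i j assume "i < dim_row (1\<^sub>m (n * m) :: complex mat)" "j < dim_col (1\<^sub>m (n * m) :: complex mat)"
  then have ij: "i < n * m" "j < n * m" by auto
  then have "0 < m" by (auto intro!: gr0I)
  moreover have "i = j \<longleftrightarrow> i div m = j div m \<and> i mod m = j mod m"
    by (metis mult_div_mod_eq)
  ultimately show "kronecker (1\<^sub>m n) (1\<^sub>m m) $$ (i, j) = 1\<^sub>m (n * m) $$ (i, j)"
    using ij by (auto simp: kronecker_def less_mult_imp_div_less)
qed (auto simp: kronecker_def)

lemma mtrace_kronecker:
  assumes "A \<in> carrier_mat n n" "B \<in> carrier_mat m m"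
  shows "mtrace (kronecker A B) = mtrace A * mtrace B"
proof -
  have "mtrace (kronecker A B) = (\<Sum>h<n * m. A $$ (h div m, h div m) * B $$ (h mod m, h mod m))"
    using assms by (auto simp: kronecker_def mtrace_def)
  also have "\<dots> = (\<Sum>i<n. \<Sum>j<m. A $$ (i, i) * B $$ (j, j))"
    by (rule sum_lessThan_mult_div_mod)
  also have "\<dots> = mtrace A * mtrace B"
    using assms by (simp add: sum_product mtrace_def)
  finally show ?thesis .
qed

section \<open>Inverses and factorisations of matrices\<close>

lemma invertible_matI:
  assumes "A \<in> carrier_mat n n" "B \<in> carrier_mat n n" "A * B = (1\<^sub>m n :: complex mat)"
  shows "invertible_mat A"
  using assms mat_mult_left_right_inverse[OF assms]
  by (auto simp: invertible_mat_def inverts_mat_def)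

text \<open>The inverse provided by \<open>invertible_mat\<close> comes without stated dimensions;
  they are read off by comparing both products with identity matrices.\<close>

lemma invertible_matE:
  assumes "invertible_mat (A :: complex mat)" "A \<in> carrier_mat n m"
  obtains B where "m = n" "B \<in> carrier_mat n n" "A * B = 1\<^sub>m n" "B * A = 1\<^sub>m n"
proof -
  from assms(1) have sq: "dim_row A = dim_col A" unfolding invertible_mat_def by simp
  from assms(1) obtain B where "inverts_mat A B" "inverts_mat B A" unfolding invertible_mat_def by blast
  then have B: "A * B = 1\<^sub>m (dim_row A)" "B * A = 1\<^sub>m (dim_row B)"
    unfolding inverts_mat_def by simp_all
  have n: "dim_row A = n" "dim_col A = m" using assms(2) by simp_all
  have m: "m = n" using sq unfolding n by (rule sym)
  have "dim_col B = n" "dim_row B = m"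
    using arg_cong[OF B(1), where f = dim_col] arg_cong[OF B(2), where f = dim_col] n
    unfolding index_mult_mat index_one_mat by simp_all
  then have Bc: "B \<in> carrier_mat n n" unfolding m by (intro carrier_matI)
  have 1: "A * B = 1\<^sub>m n" using B(1) unfolding n .
  have 2: "B * A = 1\<^sub>m n" using B(2) carrier_matD(1)[OF Bc] by simp
  from that[OF m Bc 1 2] show ?thesis .
qed

lemma mat_mult_unit_vec:
  assumes "A \<in> carrier_mat n m" "j < m"
  shows "A *\<^sub>v unit_vec m j = col (A :: complex mat) j"
  using assms by (intro eq_vecI) auto

lemma mat_eq_if_mult_vec_eq:
  assumes "A \<in> carrier_mat n m" "B \<in> carrier_mat n m"
    and "\<And>v. v \<in> carrier_vec m \<Longrightarrow> A *\<^sub>v v = B *\<^sub>v v"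
  shows "A = (B :: complex mat)"
proof (rule mat_col_eqI)
  fix i assume "i < dim_col B"
  then have "i < m" using assms by auto
  with assms(3)[of "unit_vec m i"] assms(1,2) show "col A i = col B i"
    by (metis mat_mult_unit_vec unit_vec_carrier)
qed (use assms in auto)

text \<open>A preimage of each column of \<open>B\<close> becomes a column of \<open>S\<close>. With
  an identity matrix for \<open>B\<close> this yields a right inverse of a surjective map.\<close>

lemma factor_through_if_image_subset:
  assumes A: "A \<in> carrier_mat n m" and B: "B \<in> carrier_mat n k"
    and sub: "\<And>v. v \<in> carrier_vec k \<Longrightarrow> B *\<^sub>v v \<in> (*\<^sub>v) A ` carrier_vec m"
  obtains S where "S \<in> carrier_mat m k" "A * S = (B :: complex mat)"
proof -
  have "\<exists>s\<in>carrier_vec m. A *\<^sub>v s = B *\<^sub>v unit_vec k j" for j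
    using sub[of "unit_vec k j"] by force
  then obtain s where s: "\<And>j. s j \<in> carrier_vec m" "\<And>j. A *\<^sub>v s j = B *\<^sub>v unit_vec k j" by metis
  let ?S = "mat_of_cols m (map s [0..<k])"
  have S: "?S \<in> carrier_mat m k" by auto
  have "A * ?S = B"
  proof (rule mat_col_eqI)
    fix j assume "j < dim_col B"
    then have j: "j < k" using B by auto
    have "col (A * ?S) j = A *\<^sub>v col ?S j" using A S j by (metis col_mult2)
    also have "col ?S j = s j" using j s by (subst col_mat_of_cols) auto
    also have "A *\<^sub>v s j = col B j" using s B j by (simp add: mat_mult_unit_vec)
    finally show "col (A * ?S) j = col B j" .
  qed (use A B in auto)
  with S that show ?thesis by blast
qed

text \<open>Otherwise zero padding to square matrices would give an invertible matrix with a zero row.\<close>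

lemma left_invertible_imp_le:
  assumes A: "A \<in> carrier_mat n d" and P: "P \<in> carrier_mat d n" and PA: "P * A = (1\<^sub>m d :: complex mat)"
  shows "d \<le> n"
proof (rule ccontr)
  assume "\<not> d \<le> n"
  then have nd: "n < d" by simp
  define A' where "A' = mat d d (\<lambda>(i, j). if i < n then A $$ (i, j) else 0)"
  define P' where "P' = mat d d (\<lambda>(i, j). if j < n then P $$ (i, j) else 0)"
  have A': "A' \<in> carrier_mat d d" and P': "P' \<in> carrier_mat d d" by (auto simp: A'_def P'_def)
  have "P' * A' = 1\<^sub>m d"
  proof (rule eq_matI)
    fix i j assume "i < dim_row (1\<^sub>m d :: complex mat)" "j < dim_col (1\<^sub>m d :: complex mat)"
    then have ij: "i < d" "j < d" by auto
    have "(P' * A') $$ (i, j) = (\<Sum>h<d. if h < n then P $$ (i, h) * A $$ (h, j) else 0)"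
      using ij by (auto simp: A'_def P'_def scalar_prod_def lessThan_atLeast0 intro!: sum.cong)
    also have "\<dots> = (\<Sum>h<n. P $$ (i, h) * A $$ (h, j))"
      using nd by (intro sum.mono_neutral_cong_right) auto
    also have "\<dots> = (P * A) $$ (i, j)"
      using ij A P by (auto simp: scalar_prod_def lessThan_atLeast0 intro!: sum.cong)
    finally show "(P' * A') $$ (i, j) = 1\<^sub>m d $$ (i, j)" using PA by simp
  qed (use A' P' in auto)
  then have "A' * P' = 1\<^sub>m d" using mat_mult_left_right_inverse A' P' by blast
  then have "(A' * P') $$ (n, n) = 1" using nd by simp
  moreover have "(A' * P') $$ (n, n) = 0"
    using nd by (auto simp: A'_def P'_def scalar_prod_def)
  ultimately show False by simp
qed

section \<open>Splitting a subspace by matrices\<close>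

lemma subspace_iff_closed:
  "VectorSpace.subspace class_ring W (module_vec TYPE(complex) n) \<longleftrightarrow>
     W \<subseteq> carrier_vec n \<and> 0\<^sub>v n \<in> W \<and> (\<forall>v\<in>W. \<forall>w\<in>W. v + w \<in> W) \<and> (\<forall>c. \<forall>v\<in>W. c \<cdot>\<^sub>v v \<in> W)"
  by (auto simp: VectorSpace.subspace_def submodule_def vec_vs vec_module module_vec_simps class_ring_simps)

lemma zero_mat_mult_vec [simp]: "v \<in> carrier_vec d \<Longrightarrow> 0\<^sub>m e d *\<^sub>v v = (0\<^sub>v e :: complex vec)"
  by (intro eq_vecI) auto

lemma minus_zero_mat [simp]: "A \<in> carrier_mat n m \<Longrightarrow> A - 0\<^sub>m n m = (A :: complex mat)"
  by (intro eq_matI) auto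

lemma add_diff_mat:
  assumes "M \<in> carrier_mat n n"
  shows "M + (1\<^sub>m n - M) = (1\<^sub>m n :: complex mat)" "1\<^sub>m n - M + M = 1\<^sub>m n"
  using assms by (auto intro!: eq_matI)

text \<open>Take the largest \<open>d\<close> for which \<open>W\<close> contains the columns of an
  \<open>n\<close> by \<open>d\<close> matrix with a left inverse;
  \<open>left_invertible_imp_le\<close> bounds \<open>d\<close> by \<open>n\<close>. If the columns
  failed to span \<open>W\<close>, a further vector of \<open>W\<close> could be appended as a
  column and the left inverse extended by a row, contradicting maximality.\<close>

lemma subspace_parametrization:
  assumes W: "VectorSpace.subspace class_ring W (module_vec TYPE(complex) n)"
  obtains d A P where "A \<in> carrier_mat n d" "P \<in> carrier_mat d n" "P * A = 1\<^sub>m d"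
    "(*\<^sub>v) A ` carrier_vec d = W"
proof -
  from W have Wc: "W \<subseteq> carrier_vec n" and W0: "0\<^sub>v n \<in> W"
    and Wadd: "\<And>v w. v \<in> W \<Longrightarrow> w \<in> W \<Longrightarrow> v + w \<in> W" and Wsm: "\<And>c v. v \<in> W \<Longrightarrow> c \<cdot>\<^sub>v v \<in> W"
    by (auto simp: subspace_iff_closed)
  define Q where "Q d \<longleftrightarrow> (\<exists>A P. A \<in> carrier_mat n d \<and> P \<in> carrier_mat d n \<and> P * A = 1\<^sub>m d \<and>
      (\<forall>v\<in>carrier_vec d. A *\<^sub>v v \<in> W))" for d
  have "Q 0" unfolding Q_def
  proof (intro exI conjI ballI)
    fix v :: "complex vec" assume "v \<in> carrier_vec 0"
    then have "0\<^sub>m n 0 *\<^sub>v v = 0\<^sub>v n" by (intro eq_vecI) (auto simp: scalar_prod_def)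
    with W0 show "0\<^sub>m n 0 *\<^sub>v v \<in> W" by simp
  qed (auto intro!: eq_matI)
  moreover have bound: "d \<le> n" if "Q d" for d using that left_invertible_imp_le by (auto simp: Q_def)
  ultimately obtain d where d: "Q d" and max: "\<And>d'. Q d' \<Longrightarrow> d' \<le> d"
    using GreatestI_nat[of Q 0 n] Greatest_le_nat[of Q _ n] by metis
  from d obtain A P where A: "A \<in> carrier_mat n d" and P: "P \<in> carrier_mat d n" and PA: "P * A = 1\<^sub>m d"
    and AW: "\<And>v. v \<in> carrier_vec d \<Longrightarrow> A *\<^sub>v v \<in> W" by (auto simp: Q_def)
  have "w \<in> (*\<^sub>v) A ` carrier_vec d" if w: "w \<in> W" for w
  proof (rule ccontr)
    assume nw: "w \<notin> (*\<^sub>v) A ` carrier_vec d"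
    from w Wc have wc: "w \<in> carrier_vec n" by auto
    \<comment> \<open>The projection with kernel the image of \<open>A\<close> and image the kernel
      of \<open>P\<close>. Applied to \<open>w\<close> it removes the component along
      \<open>A\<close>, which keeps the result in \<open>W\<close> and makes \<open>P\<close> vanish
      on it.\<close>
    define R where "R = 1\<^sub>m n - A * P"
    have AP: "A * P \<in> carrier_mat n n" using A P by auto
    have R: "R \<in> carrier_mat n n" unfolding R_def using AP by (rule minus_carrier_mat)
    have APA: "A * P * A = A" using A P PA by (simp add: assoc_mult_mat[of A n d P n A d])
    have RA: "R * A = 0\<^sub>m n d" using A AP APA
      by (simp add: R_def minus_mult_distrib_mat[of "1\<^sub>m n" n n "A * P" A d])
    have PAP: "P * (A * P) = P" using A P PA by (simp add: assoc_mult_mat[of P d n A d P n, symmetric])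
    have PR: "P * R = 0\<^sub>m d n" using P AP PAP
      by (simp add: R_def mult_minus_distrib_mat[of P d n "1\<^sub>m n" n "A * P"])
    have APAP: "A * P * (A * P) = A * P" using A P AP PAP
      by (simp add: assoc_mult_mat[of A n d P n "A * P" n])
    have RR: "R * R = R"
    proof -
      have "R * R = R * (1\<^sub>m n - A * P)" by (simp add: R_def)
      also have "\<dots> = R - R * (A * P)"
        using R AP by (simp add: mult_minus_distrib_mat[of _ n n "1\<^sub>m n" n "A * P"])
      also have "R * (A * P) = R * A * P" using R A P by (simp add: assoc_mult_mat[of R n n A d P n])
      also have "\<dots> = 0\<^sub>m n n" using RA P by simp
      finally show ?thesis using R by simp
    qed
    define w' where "w' = R *\<^sub>v w"
    have w'c: "w' \<in> carrier_vec n" using R wc by (simp add: w'_def)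
    have w'_eq: "w' = w + (-1) \<cdot>\<^sub>v (A *\<^sub>v (P *\<^sub>v w))"
      using A P wc AP by (simp add: w'_def R_def minus_mult_distrib_mat_vec[of "1\<^sub>m n" n n "A * P"])
         (auto intro!: eq_vecI)
    have "P *\<^sub>v w \<in> carrier_vec d" using P wc by auto
    then have w'W: "w' \<in> W" unfolding w'_eq using w AW Wadd Wsm by blast
    have "w' \<noteq> 0\<^sub>v n"
    proof
      assume 0: "w' = 0\<^sub>v n"
      have "w = A *\<^sub>v (P *\<^sub>v w)"
      proof (rule eq_vecI)
        fix i assume "i < dim_vec (A *\<^sub>v (P *\<^sub>v w))"
        then have i: "i < n" using A by auto
        with arg_cong[OF 0, of "\<lambda>v. v $ i"] A wc show "w $ i = (A *\<^sub>v (P *\<^sub>v w)) $ i"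
          unfolding w'_eq by simp
      qed (use A wc in auto)
      with nw \<open>P *\<^sub>v w \<in> carrier_vec d\<close> show False by blast
    qed
    then obtain i where i: "i < n" "w' $ i \<noteq> 0" using w'c by (auto simp: vec_eq_iff)
    define A' where "A' = mat n (Suc d) (\<lambda>(a, b). if b < d then A $$ (a, b) else w' $ a)"
    \<comment> \<open>The new row is row \<open>i\<close> of \<open>R\<close> divided by the nonzero
      entry \<open>w' $ i\<close>: it vanishes on the old columns because \<open>R * A = 0\<close>,
      and it takes the value 1 on the new column because \<open>R\<close> fixes
      \<open>w'\<close>.\<close>
    define P' where "P' = mat (Suc d) n (\<lambda>(a, b). if a < d then P $$ (a, b) else R $$ (i, b) / w' $ i)"
    have A': "A' \<in> carrier_mat n (Suc d)" and P': "P' \<in> carrier_mat (Suc d) n"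
      by (auto simp: A'_def P'_def)
    have "P' * A' = 1\<^sub>m (Suc d)"
    proof (rule eq_matI)
      fix a b assume "a < dim_row (1\<^sub>m (Suc d) :: complex mat)" "b < dim_col (1\<^sub>m (Suc d) :: complex mat)"
      then have ab: "a < Suc d" "b < Suc d" by auto
      have pw: "P *\<^sub>v w' = 0\<^sub>v d" using P R wc PR
        by (simp add: w'_def assoc_mult_mat_vec[of P d n R n, symmetric])
      have rw: "R *\<^sub>v w' = w'" using R wc RR
        by (simp add: w'_def assoc_mult_mat_vec[of R n n R n, symmetric])
      have entry: "(P' * A') $$ (a, b) = (\<Sum>h<n. P' $$ (a, h) * A' $$ (h, b))"
        using ab A' P' by (simp add: scalar_prod_def lessThan_atLeast0)
      consider "a < d" "b < d" | "a < d" "b = d" | "a = d" "b < d" | "a = d" "b = d" using ab by linarith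
      then show "(P' * A') $$ (a, b) = 1\<^sub>m (Suc d) $$ (a, b)"
      proof cases
        case 1
        have "(P' * A') $$ (a, b) = (P * A) $$ (a, b)"
          unfolding entry using 1 A P by (simp add: A'_def P'_def scalar_prod_def lessThan_atLeast0)
        with 1 PA show ?thesis by simp
      next
        case 2
        have "(P' * A') $$ (a, b) = (P *\<^sub>v w') $ a"
          unfolding entry using 2 w'c P by (simp add: A'_def P'_def scalar_prod_def lessThan_atLeast0)
        with 2 pw show ?thesis by simp
      next
        case 3
        have "(P' * A') $$ (a, b) = (R * A) $$ (i, b) / w' $ i"
          unfolding entry using 3 A R i by (simp add: A'_def P'_def scalar_prod_def lessThan_atLeast0 sum_divide_distrib)
        with 3 RA i show ?thesis by simp
      next
        case 4
        have "(P' * A') $$ (a, b) = (R *\<^sub>v w') $ i / w' $ i"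
          unfolding entry using 4 w'c R i by (simp add: A'_def P'_def scalar_prod_def lessThan_atLeast0 sum_divide_distrib)
        with 4 rw i show ?thesis by simp
      qed
    qed (use A' P' in auto)
    moreover have "A' *\<^sub>v v \<in> W" if v: "v \<in> carrier_vec (Suc d)" for v
    proof -
      have "A' *\<^sub>v v = A *\<^sub>v vec d (($) v) + v $ d \<cdot>\<^sub>v w'"
        using v A w'c by (intro eq_vecI) (auto simp: A'_def scalar_prod_def)
      then show ?thesis using AW[of "vec d (($) v)"] w'W Wadd Wsm by auto
    qed
    ultimately have "Q (Suc d)" using A' P' unfolding Q_def by blast
    with max[of "Suc d"] show False by simp
  qed
  with AW have "(*\<^sub>v) A ` carrier_vec d = W" by blast
  with that A P PA show ?thesis by blast
qed

text \<open>Short exact sequences of vector spaces in equational form: \<open>A\<close> and \<open>B\<close> are the maps, \<open>P\<close> and \<open>C\<close>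
  a retraction and a section.\<close>

definition mat_split ::
  "nat \<Rightarrow> nat \<Rightarrow> nat \<Rightarrow> complex mat \<Rightarrow> complex mat \<Rightarrow> complex mat \<Rightarrow> complex mat \<Rightarrow> bool" where
  "mat_split n d e A P B C \<longleftrightarrow>
     A \<in> carrier_mat n d \<and> P \<in> carrier_mat d n \<and> B \<in> carrier_mat e n \<and> C \<in> carrier_mat n e \<and>
     P * A = 1\<^sub>m d \<and> B * C = 1\<^sub>m e \<and> B * A = 0\<^sub>m e d \<and> A * P + C * B = 1\<^sub>m n"

text \<open>The idempotents \<open>A * P\<close> and \<open>C * B\<close> have traces
  \<open>d\<close> and \<open>e\<close> by cyclicity, and they add up to the identity.
  Characteristic zero turns the equation of traces into one of dimensions.\<close>

lemma mat_split_dim: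
  assumes "mat_split n d e A P B C"
  shows "d + e = n"
proof -
  from assms have c: "A \<in> carrier_mat n d" "P \<in> carrier_mat d n" "B \<in> carrier_mat e n" "C \<in> carrier_mat n e"
    and e: "P * A = 1\<^sub>m d" "B * C = 1\<^sub>m e" "A * P + C * B = 1\<^sub>m n" by (auto simp: mat_split_def)
  have "of_nat n = mtrace (A * P + C * B)" using e by simp
  also have "\<dots> = mtrace (A * P) + mtrace (C * B)" using c by (intro mtrace_add) auto
  also have "\<dots> = mtrace (P * A) + mtrace (B * C)"
    using mtrace_mult_comm[OF c(1,2)] mtrace_mult_comm[OF c(4,3)] by simp
  also have "\<dots> = of_nat (d + e)" using e by simp
  finally show ?thesis by (metis of_nat_eq_iff)
qed

lemma mat_split_image:
  assumes "mat_split n d e A P B C" "v \<in> carrier_vec n" "B *\<^sub>v v = 0\<^sub>v e"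
  shows "A *\<^sub>v (P *\<^sub>v v) = v"
proof -
  from assms(1) have c: "A \<in> carrier_mat n d" "P \<in> carrier_mat d n" "B \<in> carrier_mat e n" "C \<in> carrier_mat n e"
    and e: "A * P + C * B = 1\<^sub>m n" by (auto simp: mat_split_def)
  have "v = (A * P + C * B) *\<^sub>v v" using e assms(2) by simp
  also have "\<dots> = A * P *\<^sub>v v + C * B *\<^sub>v v"
    using c assms(2) by (intro add_mult_distrib_mat_vec) auto
  also have "C * B *\<^sub>v v = C *\<^sub>v 0\<^sub>v e" using c assms(2,3) by (simp add: assoc_mult_mat_vec[of C n e B n])
  also have "C *\<^sub>v 0\<^sub>v e = 0\<^sub>v n" using c by (intro eq_vecI) auto
  finally show ?thesis using c assms(2) by (simp add: assoc_mult_mat_vec[of A n d P n])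
qed

text \<open>The kernel of the retraction \<open>P\<close> is a complement of \<open>W\<close>, so
  parametrising it by the previous construction supplies the second half of the splitting.\<close>

lemma subspace_split:
  assumes W: "VectorSpace.subspace class_ring W (module_vec TYPE(complex) n)"
  obtains d e A P B C where "mat_split n d e A P B C" "(*\<^sub>v) A ` carrier_vec d = W"
proof -
  obtain d A P where A: "A \<in> carrier_mat n d" and P: "P \<in> carrier_mat d n" and PA: "P * A = 1\<^sub>m d"
    and im: "(*\<^sub>v) A ` carrier_vec d = W" using subspace_parametrization[OF W] .
  let ?K = "{v \<in> carrier_vec n. P *\<^sub>v v = 0\<^sub>v d}"
  have "VectorSpace.subspace class_ring ?K (module_vec TYPE(complex) n)"
    using P by (auto simp: subspace_iff_closed mult_add_distrib_mat_vec[of P d n] mult_mat_vec[of P d n])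
  then obtain e C B0 where C: "C \<in> carrier_mat n e" and B0: "B0 \<in> carrier_mat e n" and BC0: "B0 * C = 1\<^sub>m e"
    and imC: "(*\<^sub>v) C ` carrier_vec e = ?K" by (rule subspace_parametrization)
  define R where "R = 1\<^sub>m n - A * P"
  \<comment> \<open>\<open>B0\<close> is only known to be a left inverse of \<open>C\<close> and may
    be nonzero on \<open>W\<close>; composing it with the projection \<open>R\<close> forces
    \<open>B * A = 0\<close> and keeps \<open>B * C = 1\<close>.\<close>
  define B where "B = B0 * R"
  have AP: "A * P \<in> carrier_mat n n" using A P by auto
  have R: "R \<in> carrier_mat n n" unfolding R_def using AP by (rule minus_carrier_mat)
  have B: "B \<in> carrier_mat e n" using B0 R by (simp add: B_def)
  have APA: "A * P * A = A" using A P PA by (simp add: assoc_mult_mat[of A n d P n A d])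
  have RA: "R * A = 0\<^sub>m n d" using A AP APA
    by (simp add: R_def minus_mult_distrib_mat[of "1\<^sub>m n" n n "A * P" A d])
  have PAP: "P * (A * P) = P" using A P PA by (simp add: assoc_mult_mat[of P d n A d P n, symmetric])
  have PR: "P * R = 0\<^sub>m d n" using P AP PAP
    by (simp add: R_def mult_minus_distrib_mat[of P d n "1\<^sub>m n" n "A * P"])
  have PC: "P * C = 0\<^sub>m d e"
  proof (rule mat_eq_if_mult_vec_eq)
    fix v :: "complex vec" assume v: "v \<in> carrier_vec e"
    then have "C *\<^sub>v v \<in> ?K" using imC by blast
    with v P C show "P * C *\<^sub>v v = 0\<^sub>m d e *\<^sub>v v" by (simp add: assoc_mult_mat_vec[of P d n C e])
  qed (use P C in auto)
  have RC: "R * C = C" using A P C AP PC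
    by (simp add: R_def minus_mult_distrib_mat[of "1\<^sub>m n" n n "A * P" C e] assoc_mult_mat[of A n d P n C e])
  \<comment> \<open>All values of \<open>R\<close> lie in the kernel of \<open>P\<close>, that is in
    the image of \<open>C\<close>, on which \<open>C * B0\<close> acts as the identity.\<close>
  have CBR: "C * B = R"
  proof (rule mat_eq_if_mult_vec_eq)
    fix v :: "complex vec" assume v: "v \<in> carrier_vec n"
    have "R *\<^sub>v v \<in> ?K" using v R P PR by (simp add: assoc_mult_mat_vec[of P d n R n, symmetric])
    then obtain u where u: "u \<in> carrier_vec e" "R *\<^sub>v v = C *\<^sub>v u" using imC by blast
    have "C * B *\<^sub>v v = C *\<^sub>v (B0 *\<^sub>v (R *\<^sub>v v))"
      using C B B0 R v by (simp add: B_def assoc_mult_mat_vec[of C n e _ n] assoc_mult_mat_vec[of B0 e n R n])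
    also have "\<dots> = C *\<^sub>v (B0 * C *\<^sub>v u)" using u C B0 by (simp add: assoc_mult_mat_vec[of B0 e n C e])
    also have "\<dots> = R *\<^sub>v v" using u BC0 by simp
    finally show "C * B *\<^sub>v v = R *\<^sub>v v" .
  qed (use C B R in auto)
  have "mat_split n d e A P B C" unfolding mat_split_def
  proof (intro conjI)
    show "B * C = 1\<^sub>m e" using RC B0 R C BC0 by (simp add: B_def assoc_mult_mat[of B0 e n R n C e])
    show "B * A = 0\<^sub>m e d" using RA B0 R A by (simp add: B_def assoc_mult_mat[of B0 e n R n A d])
    show "A * P + C * B = 1\<^sub>m n" unfolding CBR R_def using AP by (rule add_diff_mat)
  qed (use A P B C PA in auto)
  with im that show ?thesis by blast
qed

text \<open>Surjectivity of \<open>B\<close> gives a section \<open>C\<close>. The matrix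
  \<open>1 - C * B\<close> maps into the kernel of \<open>B\<close>, which is the image of
  \<open>A\<close>, so it factors as \<open>A * P\<close>; injectivity of \<open>A\<close> then
  forces \<open>P\<close> to be a retraction.\<close>

lemma mat_split_if_exact:
  assumes A: "A \<in> carrier_mat n d" and B: "B \<in> carrier_mat e n"
    and inj: "inj_on ((*\<^sub>v) A) (carrier_vec d)"
    and ker: "(*\<^sub>v) A ` carrier_vec d = mat_kernel B"
    and surj: "(*\<^sub>v) B ` carrier_vec n = carrier_vec e"
  obtains P C where "mat_split n d e A P B C"
proof -
  obtain C where C: "C \<in> carrier_mat n e" and BC: "B * C = 1\<^sub>m e"
    using factor_through_if_image_subset[OF B, of "1\<^sub>m e" e] surj by auto
  define R where "R = 1\<^sub>m n - C * B"
  have CB: "C * B \<in> carrier_mat n n" using C B by auto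
  have R: "R \<in> carrier_mat n n" unfolding R_def using CB by (rule minus_carrier_mat)
  have BCB: "B * (C * B) = B" using C B BC by (simp add: assoc_mult_mat[of B e n C e B n, symmetric])
  have BR: "B * R = 0\<^sub>m e n" using B CB BCB
    by (simp add: R_def mult_minus_distrib_mat[of B e n "1\<^sub>m n" n "C * B"])
  have BA: "B * A = 0\<^sub>m e d"
  proof (rule mat_eq_if_mult_vec_eq)
    fix v :: "complex vec" assume v: "v \<in> carrier_vec d"
    then have "A *\<^sub>v v \<in> mat_kernel B" using ker by blast
    with v A B show "B * A *\<^sub>v v = 0\<^sub>m e d *\<^sub>v v"
      by (simp add: assoc_mult_mat_vec[of B e n A d] mat_kernelD[OF B])
  qed (use A B in auto)
  have "R *\<^sub>v v \<in> (*\<^sub>v) A ` carrier_vec d" if "v \<in> carrier_vec n" for v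
    unfolding ker using that R B BR
    by (intro mat_kernelI[OF B]) (simp_all add: assoc_mult_mat_vec[of B e n R n, symmetric])
  then obtain P where P: "P \<in> carrier_mat d n" and AP: "A * P = R"
    using factor_through_if_image_subset[OF A R] by blast
  have RA: "R * A = A" using A B C CB BA
    by (simp add: R_def minus_mult_distrib_mat[of "1\<^sub>m n" n n "C * B" A d] assoc_mult_mat[of C n e B n A d])
  have "P * A = 1\<^sub>m d"
  proof (rule mat_eq_if_mult_vec_eq)
    fix v :: "complex vec" assume v: "v \<in> carrier_vec d"
    have "A *\<^sub>v (P * A *\<^sub>v v) = A * P * A *\<^sub>v v"
      using v A P by (simp add: assoc_mult_mat_vec[of A n d _ d] assoc_mult_mat[of A n d P n A d])
    also have "\<dots> = A *\<^sub>v v" using AP RA by simp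
    finally have "P * A *\<^sub>v v = v" using inj_onD[OF inj, of "P * A *\<^sub>v v" v] v A P by auto
    with v show "P * A *\<^sub>v v = 1\<^sub>m d *\<^sub>v v" by simp
  qed (use A P in auto)
  moreover have "A * P + C * B = 1\<^sub>m n" unfolding AP R_def using CB by (rule add_diff_mat)
  ultimately have "mat_split n d e A P B C" using A B C P BC BA by (simp add: mat_split_def)
  with that show ?thesis by blast
qed

lemma exact_if_mat_split:
  assumes "mat_split n d e A P B C"
  shows "inj_on ((*\<^sub>v) A) (carrier_vec d)" "(*\<^sub>v) A ` carrier_vec d = mat_kernel B"
    "(*\<^sub>v) B ` carrier_vec n = carrier_vec e"
proof -
  from assms have c: "A \<in> carrier_mat n d" "P \<in> carrier_mat d n" "B \<in> carrier_mat e n" "C \<in> carrier_mat n e"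
    and e: "P * A = 1\<^sub>m d" "B * C = 1\<^sub>m e" "B * A = 0\<^sub>m e d" by (auto simp: mat_split_def)
  have "P *\<^sub>v (A *\<^sub>v v) = v" if "v \<in> carrier_vec d" for v
    using that c e by (simp add: assoc_mult_mat_vec[of P d n A d, symmetric])
  then show "inj_on ((*\<^sub>v) A) (carrier_vec d)" by (metis inj_onI)
  have "A *\<^sub>v v \<in> mat_kernel B" if "v \<in> carrier_vec d" for v
    using that c e by (intro mat_kernelI[OF c(3)]) (simp_all add: assoc_mult_mat_vec[of B e n A d, symmetric])
  moreover have "v \<in> (*\<^sub>v) A ` carrier_vec d" if "v \<in> mat_kernel B" for v
  proof -
    have "A *\<^sub>v (P *\<^sub>v v) = v" using mat_split_image[OF assms] mat_kernelD[OF c(3) that] by blast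
    moreover have "P *\<^sub>v v \<in> carrier_vec d" using c mat_kernelD[OF c(3) that] by simp
    ultimately show ?thesis by (metis imageI)
  qed
  ultimately show "(*\<^sub>v) A ` carrier_vec d = mat_kernel B" by blast
  have "B *\<^sub>v (C *\<^sub>v v) = v" if "v \<in> carrier_vec e" for v
    using that c e by (simp add: assoc_mult_mat_vec[of B e n C e, symmetric])
  then have "v \<in> (*\<^sub>v) B ` carrier_vec n" if "v \<in> carrier_vec e" for v
    using that c by (metis imageI mult_mat_vec_carrier)
  then show "(*\<^sub>v) B ` carrier_vec n = carrier_vec e" using c by auto
qed

text \<open>Basis-free form of the fact that the trace of a block triangular matrix is the sum of
  the traces of its diagonal blocks. Inserting \<open>A * P + C * B\<close> after \<open>Y\<close>
  gives two terms, and cyclicity reduces them to \<open>X\<close> and \<open>Z\<close>. Only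
  \<open>A\<close> and \<open>B\<close> are compatible with the actions; \<open>P\<close> and
  \<open>C\<close> are merely linear.\<close>

lemma mat_split_mtrace:
  assumes s: "mat_split n d e A P B C"
    and Y: "Y \<in> carrier_mat n n" and X: "X \<in> carrier_mat d d" and Z: "Z \<in> carrier_mat e e"
    and AX: "A * X = Y * A" and BY: "B * Y = Z * B"
  shows "mtrace Y = mtrace X + mtrace Z"
proof -
  from s have c: "A \<in> carrier_mat n d" "P \<in> carrier_mat d n" "B \<in> carrier_mat e n" "C \<in> carrier_mat n e"
    and e: "P * A = 1\<^sub>m d" "B * C = 1\<^sub>m e" "A * P + C * B = 1\<^sub>m n" by (auto simp: mat_split_def)
  have "Y = Y * (A * P + C * B)" using Y e by simp
  also have "\<dots> = Y * (A * P) + Y * (C * B)" using c Y by (intro mult_add_distrib_mat) auto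
  also have "Y * (A * P) = A * X * P" by (simp only: assoc_mult_mat[OF Y c(1,2), symmetric] AX)
  also have "A * X * P = A * (X * P)" by (rule assoc_mult_mat[OF c(1) X c(2)])
  also have "Y * (C * B) = (Y * C) * B" by (rule assoc_mult_mat[OF Y c(4,3), symmetric])
  finally have "mtrace Y = mtrace (A * (X * P) + (Y * C) * B)" by (rule arg_cong)
  also have "\<dots> = mtrace (A * (X * P)) + mtrace ((Y * C) * B)" using c X Y by (intro mtrace_add[of _ n]) auto
  also have "mtrace (A * (X * P)) = mtrace ((X * P) * A)" using c X by (intro mtrace_mult_comm[of _ n d]) auto
  also have "(X * P) * A = X" using X by (simp add: assoc_mult_mat[OF X c(2,1)] e)
  also have "mtrace ((Y * C) * B) = mtrace (B * (Y * C))" using c Y by (intro mtrace_mult_comm[of _ n e]) auto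
  also have "B * (Y * C) = Z * B * C" by (simp only: assoc_mult_mat[OF c(3) Y c(4), symmetric] BY)
  also have "\<dots> = Z" using Z by (simp add: assoc_mult_mat[OF Z c(3,4)] e)
  finally show ?thesis .
qed

section \<open>Schur orthogonality for projective representations\<close>

definition rchar :: "'g mrep \<Rightarrow> 'g \<Rightarrow> complex" where
  "rchar X g = mtrace (snd X g)"

lemma intertwinersI:
  "A \<in> carrier_mat (fst Y) (fst X) \<Longrightarrow> (\<And>g. g \<in> carrier H \<Longrightarrow> A * snd X g = snd Y g * A)
    \<Longrightarrow> A \<in> intertwiners H X Y"
  by (simp add: intertwiners_def)

lemma intertwinersD:
  assumes "A \<in> intertwiners H X Y"
  shows "A \<in> carrier_mat (fst Y) (fst X)" "g \<in> carrier H \<Longrightarrow> A * snd X g = snd Y g * A"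
  using assms by (simp_all add: intertwiners_def)

text \<open>Instantiated twice in the end: for \<open>G\<close> with the trivial cocycle, which
  yields the ring, and for the subgroup with the given cocycle, which yields the module.\<close>

locale finite_group_cocycle = group H for H :: "('g, 'b) monoid_scheme" (structure) +
  fixes \<alpha> :: "'g \<Rightarrow> 'g \<Rightarrow> complex"
  assumes finite_carrier: "finite (carrier H)" and cocycle: "cocycle2 H \<alpha>"
begin

section \<open>Cocycle values at the unit and at inverses\<close>

lemma cocycle_nonzero: "g \<in> carrier H \<Longrightarrow> h \<in> carrier H \<Longrightarrow> \<alpha> g h \<noteq> 0"
  using cocycle by (auto simp: cocycle2_def)

lemma cocycle_eq:
  "g \<in> carrier H \<Longrightarrow> h \<in> carrier H \<Longrightarrow> k \<in> carrier H \<Longrightarrow>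
    \<alpha> g h * \<alpha> (g \<otimes> h) k = \<alpha> h k * \<alpha> g (h \<otimes> k)"
  using cocycle by (auto simp: cocycle2_def)

lemma cocycle_one_left: "g \<in> carrier H \<Longrightarrow> \<alpha> \<one> g = \<alpha> \<one> \<one>"
  using cocycle_eq[of \<one> \<one> g] cocycle_nonzero[of \<one> g] by simp

lemma cocycle_one_right: "g \<in> carrier H \<Longrightarrow> \<alpha> g \<one> = \<alpha> \<one> \<one>"
  using cocycle_eq[of g \<one> \<one>] cocycle_nonzero[of g \<one>] by simp

text \<open>The cocycle identity at \<open>g\<close>, \<open>inv g\<close>, \<open>g\<close>: the
  factors that remain on the two sides are \<open>\<alpha> \<one> g\<close> and
  \<open>\<alpha> g \<one>\<close>, both equal to \<open>\<alpha> \<one> \<one>\<close>. The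
  invariance of \<open>\<beta>\<close> under inversion, and with it the symmetry of the structure
  constants, comes from here.\<close>

lemma cocycle_inv_commute: "g \<in> carrier H \<Longrightarrow> \<alpha> (inv g) g = \<alpha> g (inv g)"
  using cocycle_eq[of g "inv g" g] cocycle_nonzero[of \<one> \<one>]
    cocycle_one_left[of g] cocycle_one_right[of g]
  by simp

text \<open>\<open>\<rho> g * \<rho> (inv g) = \<beta> g \<cdot> id\<close> for every representation \<open>\<rho>\<close> with multiplier \<open>\<alpha>\<close>.\<close>

definition \<beta> :: "'g \<Rightarrow> complex" where
  "\<beta> g = \<alpha> \<one> \<one> * \<alpha> g (inv g)"

lemma beta_nonzero: "g \<in> carrier H \<Longrightarrow> \<beta> g \<noteq> 0"
  by (simp add: \<beta>_def cocycle_nonzero)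

lemma beta_inv: "g \<in> carrier H \<Longrightarrow> \<beta> (inv g) = \<beta> g"
  by (simp add: \<beta>_def cocycle_inv_commute)

section \<open>Projective representations and their inverse matrices\<close>

lemma rep_carrier: "X \<in> proj_reps H \<alpha> \<Longrightarrow> g \<in> carrier H \<Longrightarrow> snd X g \<in> carrier_mat (fst X) (fst X)"
  by (auto simp: proj_reps_def split: prod.splits)

lemma rep_mult:
  "X \<in> proj_reps H \<alpha> \<Longrightarrow> g \<in> carrier H \<Longrightarrow> h \<in> carrier H \<Longrightarrow>
    snd X g * snd X h = \<alpha> g h \<cdot>\<^sub>m snd X (g \<otimes> h)"
  by (auto simp: proj_reps_def split: prod.splits)

text \<open>An invertible matrix whose square is \<open>c\<close> times itself is \<open>c\<close>
  times the identity.\<close>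

lemma rep_one:
  assumes X: "X \<in> proj_reps H \<alpha>"
  shows "snd X \<one> = \<alpha> \<one> \<one> \<cdot>\<^sub>m 1\<^sub>m (fst X)"
proof -
  let ?n = "fst X"
  have c: "snd X \<one> \<in> carrier_mat ?n ?n" using X by (rule rep_carrier) simp
  have "invertible_mat (snd X \<one>)" using X by (auto simp: proj_reps_def)
  then obtain B where B: "B \<in> carrier_mat ?n ?n" "snd X \<one> * B = 1\<^sub>m ?n"
    using c by (rule invertible_matE)
  have "snd X \<one> = snd X \<one> * (snd X \<one> * B)" using B c by simp
  also have "\<dots> = snd X \<one> * snd X \<one> * B" by (rule assoc_mult_mat[OF c c B(1), symmetric])
  also have "\<dots> = (\<alpha> \<one> \<one> \<cdot>\<^sub>m snd X \<one>) * B" using rep_mult[OF X, of \<one> \<one>] by simp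
  also have "\<dots> = \<alpha> \<one> \<one> \<cdot>\<^sub>m 1\<^sub>m ?n" using B c by (simp add: mult_smult_assoc_mat[of _ ?n ?n])
  finally show ?thesis .
qed

text \<open>Multiplicativity together with the value at the unit produces the inverse
  \<open>snd X (inv g)\<close> divided by \<open>\<beta> g\<close>, so invertibility comes for free
  when representations are constructed.\<close>

lemma proj_repsI:
  assumes c: "\<And>g. g \<in> carrier H \<Longrightarrow> snd X g \<in> carrier_mat (fst X) (fst X)"
    and m: "\<And>g h. g \<in> carrier H \<Longrightarrow> h \<in> carrier H \<Longrightarrow> snd X g * snd X h = \<alpha> g h \<cdot>\<^sub>m snd X (g \<otimes> h)"
    and one: "snd X \<one> = \<alpha> \<one> \<one> \<cdot>\<^sub>m 1\<^sub>m (fst X)"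
  shows "X \<in> proj_reps H \<alpha>"
proof -
  have "invertible_mat (snd X g)" if g: "g \<in> carrier H" for g
  proof (rule invertible_matI)
    show "snd X g \<in> carrier_mat (fst X) (fst X)" using c g by blast
    show "(1 / \<beta> g) \<cdot>\<^sub>m snd X (inv g) \<in> carrier_mat (fst X) (fst X)" using c[of "inv g"] g by simp
    have "snd X g * ((1 / \<beta> g) \<cdot>\<^sub>m snd X (inv g)) = (1 / \<beta> g) \<cdot>\<^sub>m (snd X g * snd X (inv g))"
      using c[OF g] c[of "inv g"] g by (simp add: mult_smult_distrib)
    also have "\<dots> = 1\<^sub>m (fst X)"
      using g m[of g "inv g"] one beta_nonzero[OF g] by (auto simp: \<beta>_def intro!: eq_matI)
    finally show "snd X g * ((1 / \<beta> g) \<cdot>\<^sub>m snd X (inv g)) = 1\<^sub>m (fst X)" .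
  qed
  with c m show ?thesis by (cases X) (auto simp: proj_reps_def)
qed

text \<open>The inverse of \<open>snd X g\<close>, written through \<open>inv g\<close> so that its
  trace is, up to \<open>\<beta> g\<close>, a value of the character.\<close>

definition rinv :: "'g mrep \<Rightarrow> 'g \<Rightarrow> complex mat" where
  "rinv X g = (1 / \<beta> g) \<cdot>\<^sub>m snd X (inv g)"

lemma rinv_carrier: "X \<in> proj_reps H \<alpha> \<Longrightarrow> g \<in> carrier H \<Longrightarrow> rinv X g \<in> carrier_mat (fst X) (fst X)"
  by (simp add: rinv_def rep_carrier)

lemma rep_mult_rinv:
  assumes X: "X \<in> proj_reps H \<alpha>" and g: "g \<in> carrier H"
  shows "snd X g * rinv X g = 1\<^sub>m (fst X)"
proof -
  have "snd X g * rinv X g = (1 / \<beta> g) \<cdot>\<^sub>m (snd X g * snd X (inv g))"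
    using rep_carrier[OF X g] rep_carrier[OF X, of "inv g"] g by (simp add: rinv_def mult_smult_distrib)
  also have "\<dots> = 1\<^sub>m (fst X)"
    using g rep_mult[OF X, of g "inv g"] rep_one[OF X] beta_nonzero[OF g] by (auto simp: \<beta>_def intro!: eq_matI)
  finally show ?thesis .
qed

lemma rinv_mult_rep: "X \<in> proj_reps H \<alpha> \<Longrightarrow> g \<in> carrier H \<Longrightarrow> rinv X g * snd X g = 1\<^sub>m (fst X)"
  by (rule mat_mult_left_right_inverse[OF rep_carrier rinv_carrier rep_mult_rinv])

text \<open>Inverting \<open>snd X h * snd X g = \<alpha> h g \<cdot>\<^sub>m snd X (h \<otimes>
  g)\<close> produces the same scalar \<open>\<alpha> h g\<close> that the product itself carries.
  This coincidence lets the multiplier drop out of averages.\<close>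

lemma rinv_mult_shift:
  assumes X: "X \<in> proj_reps H \<alpha>" and g: "g \<in> carrier H" and h: "h \<in> carrier H"
  shows "rinv X (h \<otimes> g) * snd X h = \<alpha> h g \<cdot>\<^sub>m rinv X g"
proof -
  let ?n = "fst X" and ?R = "rinv X (h \<otimes> g)"
  have c: "?R \<in> carrier_mat ?n ?n" "snd X h \<in> carrier_mat ?n ?n" "snd X g \<in> carrier_mat ?n ?n"
    "rinv X g \<in> carrier_mat ?n ?n" "snd X (h \<otimes> g) \<in> carrier_mat ?n ?n"
    using X g h by (simp_all add: rep_carrier rinv_carrier)
  have "?R * snd X h = ?R * snd X h * (snd X g * rinv X g)"
    using c(1,2) by (simp add: rep_mult_rinv[OF X g])
  also have "\<dots> = ?R * (snd X h * (snd X g * rinv X g))"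
    by (rule assoc_mult_mat[OF c(1,2)]) (use c in auto)
  also have "snd X h * (snd X g * rinv X g) = snd X h * snd X g * rinv X g"
    by (rule assoc_mult_mat[OF c(2,3,4), symmetric])
  also have "\<dots> = \<alpha> h g \<cdot>\<^sub>m (snd X (h \<otimes> g) * rinv X g)"
    unfolding rep_mult[OF X h g] using c by (simp add: mult_smult_assoc_mat[of _ ?n ?n])
  also have "?R * \<dots> = \<alpha> h g \<cdot>\<^sub>m (?R * (snd X (h \<otimes> g) * rinv X g))"
    by (rule mult_smult_distrib[OF c(1)]) (use c in auto)
  also have "?R * (snd X (h \<otimes> g) * rinv X g) = ?R * snd X (h \<otimes> g) * rinv X g"
    by (rule assoc_mult_mat[OF c(1,5,4), symmetric])
  also have "\<dots> = rinv X g" using c(4) g h by (simp add: rinv_mult_rep[OF X])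
  finally show ?thesis .
qed

section \<open>Schur's lemma\<close>

lemma simple_imp_rep: "simple_rep H \<alpha> X \<Longrightarrow> X \<in> proj_reps H \<alpha>"
  by (simp add: simple_rep_def)

text \<open>The kernel of an intertwiner is an invariant subspace of its source. Simplicity is
  assumed of the source alone; the target is an arbitrary representation when this is applied to
  duals.\<close>

lemma intertwiner_kernel_simple:
  assumes X: "X \<in> proj_reps H \<alpha>" and Y: "Y \<in> proj_reps H \<alpha>" and M: "M \<in> intertwiners H X Y"
    and simple: "simple_rep H \<alpha> X"
  shows "(\<forall>v\<in>carrier_vec (fst X). M *\<^sub>v v = 0\<^sub>v (fst Y) \<longrightarrow> v = 0\<^sub>v (fst X)) \<or> M = 0\<^sub>m (fst Y) (fst X)"
proof -
  let ?n = "fst X" and ?m = "fst Y"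
  let ?W = "{v \<in> carrier_vec ?n. M *\<^sub>v v = 0\<^sub>v ?m}"
  note Mc = intertwinersD(1)[OF M]
  have "VectorSpace.subspace class_ring ?W (module_vec TYPE(complex) ?n)"
    using Mc by (auto simp: subspace_iff_closed mult_add_distrib_mat_vec[of M ?m ?n] mult_mat_vec[of M ?m ?n])
  moreover have "snd X g *\<^sub>v w \<in> ?W" if g: "g \<in> carrier H" and w: "w \<in> ?W" for g w
  proof -
    note xc = rep_carrier[OF X g] and yc = rep_carrier[OF Y g]
    have "M *\<^sub>v (snd X g *\<^sub>v w) = M * snd X g *\<^sub>v w"
      using w by (intro assoc_mult_mat_vec[OF Mc xc, symmetric]) simp
    also have "\<dots> = snd Y g *\<^sub>v (M *\<^sub>v w)"
      unfolding intertwinersD(2)[OF M g] using w by (intro assoc_mult_mat_vec[OF yc Mc]) simp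
    also have "\<dots> = 0\<^sub>v ?m" using w yc by (auto intro!: eq_vecI)
    finally show ?thesis using w xc by simp
  qed
  ultimately have "?W = {0\<^sub>v ?n} \<or> ?W = carrier_vec ?n"
    using simple unfolding simple_rep_def by blast
  moreover have "M = 0\<^sub>m ?m ?n" if "?W = carrier_vec ?n"
    using that Mc by (intro mat_eq_if_mult_vec_eq[OF Mc]) auto
  ultimately show ?thesis by blast
qed

text \<open>Counterpart for the target: the image of an intertwiner is an invariant subspace
  there.\<close>

lemma intertwiner_image_simple:
  assumes X: "X \<in> proj_reps H \<alpha>" and Y: "Y \<in> proj_reps H \<alpha>" and M: "M \<in> intertwiners H X Y"
    and simple: "simple_rep H \<alpha> Y"
  shows "(*\<^sub>v) M ` carrier_vec (fst X) = carrier_vec (fst Y) \<or> M = 0\<^sub>m (fst Y) (fst X)"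
proof -
  let ?n = "fst X" and ?m = "fst Y"
  let ?W = "(*\<^sub>v) M ` carrier_vec ?n"
  note Mc = intertwinersD(1)[OF M]
  have "VectorSpace.subspace class_ring ?W (module_vec TYPE(complex) ?m)"
    unfolding subspace_iff_closed
  proof (intro conjI ballI allI)
    show "?W \<subseteq> carrier_vec ?m" using Mc by auto
    show "0\<^sub>v ?m \<in> ?W" using Mc by (intro image_eqI[of _ _ "0\<^sub>v ?n"]) (auto intro!: eq_vecI)
    fix v w c assume "v \<in> ?W"
    then obtain v' where v': "v' \<in> carrier_vec ?n" "v = M *\<^sub>v v'" by blast
    then show "c \<cdot>\<^sub>v v \<in> ?W"
      using Mc by (intro image_eqI[of _ _ "c \<cdot>\<^sub>v v'"]) (auto simp: mult_mat_vec)
    assume "w \<in> ?W"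
    then obtain w' where "w' \<in> carrier_vec ?n" "w = M *\<^sub>v w'" by blast
    with v' show "v + w \<in> ?W"
      using Mc by (intro image_eqI[of _ _ "v' + w'"]) (auto simp: mult_add_distrib_mat_vec)
  qed
  moreover have "snd Y g *\<^sub>v w \<in> ?W" if g: "g \<in> carrier H" and w: "w \<in> ?W" for g w
  proof -
    note xc = rep_carrier[OF X g] and yc = rep_carrier[OF Y g]
    from w obtain u where u: "u \<in> carrier_vec ?n" "w = M *\<^sub>v u" by blast
    have "snd Y g *\<^sub>v w = M * snd X g *\<^sub>v u"
      unfolding intertwinersD(2)[OF M g] u(2) by (rule assoc_mult_mat_vec[OF yc Mc u(1), symmetric])
    also have "\<dots> = M *\<^sub>v (snd X g *\<^sub>v u)" by (rule assoc_mult_mat_vec[OF Mc xc u(1)])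
    finally show ?thesis using xc u(1) by simp
  qed
  ultimately have "?W = {0\<^sub>v ?m} \<or> ?W = carrier_vec ?m"
    using simple unfolding simple_rep_def by blast
  moreover have "M = 0\<^sub>m ?m ?n" if "?W = {0\<^sub>v ?m}"
    using that Mc by (intro mat_eq_if_mult_vec_eq[OF Mc]) auto
  ultimately show ?thesis by blast
qed

text \<open>Surjectivity gives a right inverse \<open>S\<close>, and injectivity cancels the left
  factor in \<open>M * S * M = M\<close>.\<close>

lemma schur_invertible:
  assumes X: "simple_rep H \<alpha> X" and Y: "simple_rep H \<alpha> Y" and M: "M \<in> intertwiners H X Y"
    and nz: "M \<noteq> 0\<^sub>m (fst Y) (fst X)"
  shows "invertible_mat M"
proof -
  let ?n = "fst X" and ?m = "fst Y"
  note Xr = simple_imp_rep[OF X] and Yr = simple_imp_rep[OF Y] and Mc = intertwinersD(1)[OF M]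
  have ker: "v = 0\<^sub>v ?n" if "v \<in> carrier_vec ?n" "M *\<^sub>v v = 0\<^sub>v ?m" for v
    using intertwiner_kernel_simple[OF Xr Yr M X] nz that by blast
  have im: "(*\<^sub>v) M ` carrier_vec ?n = carrier_vec ?m"
    using intertwiner_image_simple[OF Xr Yr M Y] nz by blast
  obtain S where S: "S \<in> carrier_mat ?n ?m" and MS: "M * S = 1\<^sub>m ?m"
    using factor_through_if_image_subset[OF Mc, of "1\<^sub>m ?m" ?m] im by auto
  have SM: "S * M = 1\<^sub>m ?n"
  proof (rule mat_eq_if_mult_vec_eq)
    fix v :: "complex vec" assume v: "v \<in> carrier_vec ?n"
    have SMv: "S * M *\<^sub>v v \<in> carrier_vec ?n" using S Mc v by simp
    have "M *\<^sub>v (S * M *\<^sub>v v) = M *\<^sub>v (S *\<^sub>v (M *\<^sub>v v))"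
      by (simp add: assoc_mult_mat_vec[OF S Mc v])
    also have "\<dots> = M * S *\<^sub>v (M *\<^sub>v v)"
      using Mc v by (intro assoc_mult_mat_vec[OF Mc S, symmetric]) simp
    also have "\<dots> = M *\<^sub>v v" using MS Mc v by simp
    finally have "M *\<^sub>v (S * M *\<^sub>v v - v) = 0\<^sub>v ?m"
      using mult_minus_distrib_mat_vec[OF Mc SMv v] minus_cancel_vec[of "M *\<^sub>v v" ?m] Mc v by simp
    then have 0: "S * M *\<^sub>v v - v = 0\<^sub>v ?n" using SMv v by (intro ker) auto
    have "S * M *\<^sub>v v = v"
    proof (rule eq_vecI)
      fix i assume "i < dim_vec v"
      then have "(S * M *\<^sub>v v - v) $ i = (S * M *\<^sub>v v) $ i - v $ i" "i < ?n" using v by simp_all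
      with 0 show "(S * M *\<^sub>v v) $ i = v $ i" by simp
    qed (use S v in auto)
    with v show "S * M *\<^sub>v v = 1\<^sub>m ?n *\<^sub>v v" by simp
  qed (use S Mc in auto)
  \<comment> \<open>\<open>M * S\<close> and \<open>S * M\<close> are identities of sizes
    \<open>?m\<close> and \<open>?n\<close> with the same trace, so the sizes agree.\<close>
  have "of_nat ?m = (of_nat ?n :: complex)"
    using mtrace_mult_comm[OF Mc S] MS SM by simp
  then have "?m = ?n" by simp
  with Mc S MS show ?thesis by (intro invertible_matI[of M ?m S]) auto
qed

text \<open>A complex matrix of positive size has an eigenvalue \<open>c\<close>. The intertwiner
  \<open>M - c\<close> then has a nonzero kernel vector, so by simplicity it is zero.\<close>

lemma schur_scalar:
  assumes X: "simple_rep H \<alpha> X" and M: "M \<in> intertwiners H X X"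
  obtains c where "M = c \<cdot>\<^sub>m 1\<^sub>m (fst X)"
proof -
  let ?n = "fst X"
  note Xr = simple_imp_rep[OF X] and Mc = intertwinersD(1)[OF M]
  have "?n > 0" using X by (simp add: simple_rep_def)
  then obtain c where "c \<in> spectrum M" using spectrum_non_empty[OF Mc] by blast
  then obtain v where v: "v \<in> carrier_vec ?n" "v \<noteq> 0\<^sub>v ?n" "M *\<^sub>v v = c \<cdot>\<^sub>v v"
    using Mc by (auto simp: spectrum_def eigenvalue_def eigenvector_def)
  let ?N = "M - c \<cdot>\<^sub>m 1\<^sub>m ?n"
  have cc: "c \<cdot>\<^sub>m 1\<^sub>m ?n \<in> carrier_mat ?n ?n" by simp
  have N: "?N \<in> intertwiners H X X"
  proof (rule intertwinersI)
    show "?N \<in> carrier_mat ?n ?n" using cc by (rule minus_carrier_mat)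
    fix g assume g: "g \<in> carrier H"
    note xc = rep_carrier[OF Xr g]
    show "?N * snd X g = snd X g * ?N"
      unfolding minus_mult_distrib_mat[OF Mc cc xc] mult_minus_distrib_mat[OF xc Mc cc] intertwinersD(2)[OF M g]
      using xc by (simp add: mult_smult_assoc_mat[of _ ?n ?n] mult_smult_distrib[OF xc, of "1\<^sub>m ?n" ?n c])
  qed
  have "?N *\<^sub>v v = M *\<^sub>v v - (c \<cdot>\<^sub>m 1\<^sub>m ?n) *\<^sub>v v" by (rule minus_mult_distrib_mat_vec[OF Mc cc v(1)])
  also have "\<dots> = 0\<^sub>v ?n" unfolding v(3) using v(1) by (auto intro!: eq_vecI)
  finally have "?N = 0\<^sub>m ?n ?n" using intertwiner_kernel_simple[OF Xr Xr N X] v by blast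
  have "M = c \<cdot>\<^sub>m 1\<^sub>m ?n"
  proof (rule eq_matI)
    fix a b assume "a < dim_row (c \<cdot>\<^sub>m 1\<^sub>m ?n)" "b < dim_col (c \<cdot>\<^sub>m 1\<^sub>m ?n)"
    then have ab: "a < ?n" "b < ?n" by simp_all
    then have "?N $$ (a, b) = M $$ (a, b) - (c \<cdot>\<^sub>m 1\<^sub>m ?n) $$ (a, b)" by simp
    with ab show "M $$ (a, b) = (c \<cdot>\<^sub>m 1\<^sub>m ?n) $$ (a, b)" unfolding \<open>?N = 0\<^sub>m ?n ?n\<close> by simp
  qed (use Mc in auto)
  with that show ?thesis by blast
qed

text \<open>The average of \<open>X(g) E Y(g)\<inverse>\<close> over the group (without the factor \<open>1/|H|\<close>), \<open>E\<close> being the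
  \<open>(i, j)\<close> matrix unit.\<close>

definition average :: "'g mrep \<Rightarrow> 'g mrep \<Rightarrow> nat \<Rightarrow> nat \<Rightarrow> complex mat" where
  "average X Y i j =
     mat (fst X) (fst Y) (\<lambda>(a, b). \<Sum>g\<in>carrier H. snd X g $$ (a, i) * rinv Y g $$ (j, b))"

text \<open>Replace the summation variable \<open>g\<close> by \<open>h \<otimes> g\<close>. The
  scalar produced by \<open>snd X h * snd X g\<close> is the one absorbed on the other side by
  \<open>rinv_mult_shift\<close>, so the average commutes with the two actions exactly.\<close>

lemma average_intertwines:
  assumes X: "X \<in> proj_reps H \<alpha>" and Y: "Y \<in> proj_reps H \<alpha>" and i: "i < fst X" and j: "j < fst Y"
  shows "average X Y i j \<in> intertwiners H Y X"
proof (rule intertwinersI)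
  let ?n = "fst X" and ?m = "fst Y" and ?M = "average X Y i j"
  show Mc: "?M \<in> carrier_mat ?n ?m" by (simp add: average_def)
  fix h assume h: "h \<in> carrier H"
  note xc = rep_carrier[OF X h] and yc = rep_carrier[OF Y h]
  show "?M * snd Y h = snd X h * ?M"
  proof (rule eq_matI)
    fix a b assume "a < dim_row (snd X h * ?M)" "b < dim_col (snd X h * ?M)"
    then have ab: "a < ?n" "b < ?m" using xc Mc by auto
    have "(snd X h * ?M) $$ (a, b) = (\<Sum>k<?n. snd X h $$ (a, k) * (\<Sum>g\<in>carrier H. snd X g $$ (k, i) * rinv Y g $$ (j, b)))"
      using ab xc Mc by (simp add: scalar_prod_def lessThan_atLeast0 average_def)
    also have "\<dots> = (\<Sum>k<?n. \<Sum>g\<in>carrier H. snd X h $$ (a, k) * snd X g $$ (k, i) * rinv Y g $$ (j, b))"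
      by (simp add: sum_distrib_left mult.assoc)
    also have "\<dots> = (\<Sum>g\<in>carrier H. (\<Sum>k<?n. snd X h $$ (a, k) * snd X g $$ (k, i)) * rinv Y g $$ (j, b))"
      by (subst sum.swap) (simp add: sum_distrib_right)
    also have "\<dots> = (\<Sum>g\<in>carrier H. (snd X h * snd X g) $$ (a, i) * rinv Y g $$ (j, b))"
    proof (intro sum.cong refl arg_cong2[where f = "(*)"])
      fix g assume "g \<in> carrier H"
      from rep_carrier[OF X this] show "(\<Sum>k<?n. snd X h $$ (a, k) * snd X g $$ (k, i)) = (snd X h * snd X g) $$ (a, i)"
        using ab i xc by (simp add: scalar_prod_def lessThan_atLeast0)
    qed
    also have "\<dots> = (\<Sum>g\<in>carrier H. snd X (h \<otimes> g) $$ (a, i) * (rinv Y (h \<otimes> g) * snd Y h) $$ (j, b))"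
    proof (rule sum.cong[OF refl])
      fix g assume g: "g \<in> carrier H"
      then have "h \<otimes> g \<in> carrier H" using h by simp
      from rep_carrier[OF X this] rinv_carrier[OF Y g]
      show "(snd X h * snd X g) $$ (a, i) * rinv Y g $$ (j, b) =
          snd X (h \<otimes> g) $$ (a, i) * (rinv Y (h \<otimes> g) * snd Y h) $$ (j, b)"
        unfolding rep_mult[OF X h g] rinv_mult_shift[OF Y g h] using ab i j by simp
    qed
    also have "\<dots> = (\<Sum>g\<in>carrier H. snd X g $$ (a, i) * (rinv Y g * snd Y h) $$ (j, b))"
    proof (rule sum.reindex_bij_betw[of "\<lambda>g. h \<otimes> g"])
      show "bij_betw (\<lambda>g. h \<otimes> g) (carrier H) (carrier H)"
        unfolding bij_betw_def using inj_on_cmult[OF h] surj_const_mult[OF h] by blast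
    qed
    also have "\<dots> = (\<Sum>g\<in>carrier H. \<Sum>k<?m. snd X g $$ (a, i) * rinv Y g $$ (j, k) * snd Y h $$ (k, b))"
    proof (rule sum.cong[OF refl])
      fix g assume g: "g \<in> carrier H"
      from rinv_carrier[OF Y g]
      show "snd X g $$ (a, i) * (rinv Y g * snd Y h) $$ (j, b) =
          (\<Sum>k<?m. snd X g $$ (a, i) * rinv Y g $$ (j, k) * snd Y h $$ (k, b))"
        using ab j yc by (simp add: scalar_prod_def lessThan_atLeast0 sum_distrib_left mult.assoc)
    qed
    also have "\<dots> = (\<Sum>k<?m. (\<Sum>g\<in>carrier H. snd X g $$ (a, i) * rinv Y g $$ (j, k)) * snd Y h $$ (k, b))"
      by (subst sum.swap) (simp add: sum_distrib_right)
    also have "\<dots> = (?M * snd Y h) $$ (a, b)"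
      using ab yc Mc by (simp add: scalar_prod_def lessThan_atLeast0 average_def)
    finally show "(?M * snd Y h) $$ (a, b) = (snd X h * ?M) $$ (a, b)" by simp
  qed (use xc yc Mc in auto)
qed

section \<open>Orthogonality of simple characters\<close>

definition cpair :: "('g \<Rightarrow> complex) \<Rightarrow> ('g \<Rightarrow> complex) \<Rightarrow> complex" where
  "cpair \<phi> \<psi> = (\<Sum>g\<in>carrier H. \<phi> g * \<psi> (inv g) / \<beta> g) / of_nat (card (carrier H))"

lemma card_carrier_nonzero: "(of_nat (card (carrier H)) :: complex) \<noteq> 0"
  using finite_carrier one_closed by (auto simp: card_eq_0_iff)

lemma sum_carrier_inv: "(\<Sum>g\<in>carrier H. f (inv g)) = (\<Sum>g\<in>carrier H. f g)"
  by (rule sum.reindex_bij_witness[of _ "\<lambda>g. inv g" "\<lambda>g. inv g"]) auto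

text \<open>The product of the traces of X(g) and Y(g)^-1 is the sum over \<open>i\<close> and
  \<open>j\<close> of the \<open>(i, j)\<close> entry of X(g) E Y(g)^-1, with E the
  \<open>(i, j)\<close> matrix unit. This expresses the pairing by the averages to which Schur's
  lemma applies.\<close>

lemma cpair_rchar:
  assumes X: "X \<in> proj_reps H \<alpha>" and Y: "Y \<in> proj_reps H \<alpha>"
  shows "cpair (rchar X) (rchar Y) =
    (\<Sum>i<fst X. \<Sum>j<fst Y. average X Y i j $$ (i, j)) / of_nat (card (carrier H))"
proof -
  have "(\<Sum>g\<in>carrier H. rchar X g * rchar Y (inv g) / \<beta> g) =
      (\<Sum>g\<in>carrier H. \<Sum>i<fst X. \<Sum>j<fst Y. snd X g $$ (i, i) * rinv Y g $$ (j, j))"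
  proof (rule sum.cong[OF refl])
    fix g assume g: "g \<in> carrier H"
    have "rchar Y (inv g) / \<beta> g = mtrace (rinv Y g)"
      using rep_carrier[OF Y, of "inv g"] g by (simp add: rinv_def rchar_def mtrace_smult)
    then have "rchar X g * rchar Y (inv g) / \<beta> g = mtrace (snd X g) * mtrace (rinv Y g)"
      by (simp add: rchar_def[of X] flip: times_divide_eq_right)
    also have "\<dots> = (\<Sum>i<fst X. \<Sum>j<fst Y. snd X g $$ (i, i) * rinv Y g $$ (j, j))"
      using rep_carrier[OF X g] rinv_carrier[OF Y g] by (simp add: mtrace_def sum_product)
    finally show "rchar X g * rchar Y (inv g) / \<beta> g =
        (\<Sum>i<fst X. \<Sum>j<fst Y. snd X g $$ (i, i) * rinv Y g $$ (j, j))" .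
  qed
  also have "\<dots> = (\<Sum>i<fst X. \<Sum>g\<in>carrier H. \<Sum>j<fst Y. snd X g $$ (i, i) * rinv Y g $$ (j, j))"
    by (rule sum.swap)
  also have "\<dots> = (\<Sum>i<fst X. \<Sum>j<fst Y. \<Sum>g\<in>carrier H. snd X g $$ (i, i) * rinv Y g $$ (j, j))"
    by (intro sum.cong refl sum.swap)
  also have "\<dots> = (\<Sum>i<fst X. \<Sum>j<fst Y. average X Y i j $$ (i, j))"
    by (intro sum.cong refl) (simp add: average_def)
  finally show ?thesis by (simp add: cpair_def)
qed

definition isomorphic :: "'g mrep \<Rightarrow> 'g mrep \<Rightarrow> bool" where
  "isomorphic X Y \<longleftrightarrow> (\<exists>A\<in>intertwiners H X Y. invertible_mat A)"

lemma cpair_nonisomorphic: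
  assumes X: "simple_rep H \<alpha> X" and Y: "simple_rep H \<alpha> Y" and ni: "\<not> isomorphic Y X"
  shows "cpair (rchar X) (rchar Y) = 0"
proof -
  note Xr = simple_imp_rep[OF X] and Yr = simple_imp_rep[OF Y]
  have "average X Y i j $$ (i, j) = 0" if ij: "i < fst X" "j < fst Y" for i j
  proof -
    note av = average_intertwines[OF Xr Yr ij]
    have "average X Y i j = 0\<^sub>m (fst X) (fst Y)"
      using schur_invertible[OF Y X av] ni av by (auto simp: isomorphic_def)
    with ij show ?thesis by simp
  qed
  then show ?thesis by (simp add: cpair_rchar[OF Xr Yr])
qed

text \<open>Each average is a scalar matrix with scalar \<open>c\<close>. Its trace is
  \<open>n * c\<close> on one side and, by cyclicity, the group order times the
  \<open>(j, i)\<close> entry of the identity on the other. The \<open>n\<close> diagonal terms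
  therefore add up to the group order.\<close>

lemma cpair_self:
  assumes X: "simple_rep H \<alpha> X"
  shows "cpair (rchar X) (rchar X) = 1"
proof -
  let ?n = "fst X" and ?N = "of_nat (card (carrier H)) :: complex"
  note Xr = simple_imp_rep[OF X]
  have n: "?n > 0" using X by (simp add: simple_rep_def)
  have av: "average X X i j $$ (i, j) = (if i = j then ?N / of_nat ?n else 0)" if ij: "i < ?n" "j < ?n" for i j
  proof -
    obtain c where c: "average X X i j = c \<cdot>\<^sub>m 1\<^sub>m ?n"
      using schur_scalar[OF X average_intertwines[OF Xr Xr ij]] .
    have "of_nat ?n * c = mtrace (average X X i j)"
      unfolding c by (simp add: mtrace_smult[of _ ?n])
    also have "\<dots> = (\<Sum>a<?n. \<Sum>g\<in>carrier H. rinv X g $$ (j, a) * snd X g $$ (a, i))"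
      by (simp add: mtrace_def average_def mult.commute)
    also have "\<dots> = (\<Sum>g\<in>carrier H. \<Sum>a<?n. rinv X g $$ (j, a) * snd X g $$ (a, i))"
      by (rule sum.swap)
    also have "\<dots> = (\<Sum>g\<in>carrier H. (rinv X g * snd X g) $$ (j, i))"
    proof (rule sum.cong[OF refl])
      fix g assume g: "g \<in> carrier H"
      from rinv_carrier[OF Xr g] rep_carrier[OF Xr g]
      show "(\<Sum>a<?n. rinv X g $$ (j, a) * snd X g $$ (a, i)) = (rinv X g * snd X g) $$ (j, i)"
        using ij by (simp add: scalar_prod_def lessThan_atLeast0)
    qed
    also have "\<dots> = ?N * (if i = j then 1 else 0)"
      using ij by (simp add: rinv_mult_rep[OF Xr])
    finally have "c = (if i = j then ?N / of_nat ?n else 0)"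
      using n by (auto simp: field_simps)
    with ij c show ?thesis by simp
  qed
  have "cpair (rchar X) (rchar X) = (\<Sum>i<?n. \<Sum>j<?n. if i = j then ?N / of_nat ?n else 0) / ?N"
    unfolding cpair_rchar[OF Xr Xr] using av by simp
  also have "\<dots> = 1" using n card_carrier_nonzero by simp
  finally show ?thesis .
qed

section \<open>Isomorphism as an equivalence relation\<close>

lemma isomorphic_refl: "X \<in> proj_reps H \<alpha> \<Longrightarrow> isomorphic X X"
  unfolding isomorphic_def
  by (intro bexI[of _ "1\<^sub>m (fst X)"] intertwinersI invertible_matI[of _ "fst X" "1\<^sub>m (fst X)"])
     (auto dest: rep_carrier)

lemma isomorphicE:
  assumes "isomorphic X Y"
  obtains A B where "fst X = fst Y" "A \<in> intertwiners H X Y" "B \<in> carrier_mat (fst X) (fst X)"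
    "A * B = 1\<^sub>m (fst X)" "B * A = 1\<^sub>m (fst X)"
proof -
  obtain A where A: "A \<in> intertwiners H X Y" "invertible_mat A"
    using assms by (auto simp: isomorphic_def)
  from invertible_matE[OF A(2) intertwinersD(1)[OF A(1)]] A(1) that show ?thesis by metis
qed

lemma isomorphic_sym:
  assumes X: "X \<in> proj_reps H \<alpha>" and Y: "Y \<in> proj_reps H \<alpha>" and iso: "isomorphic X Y"
  shows "isomorphic Y X"
proof -
  let ?n = "fst X"
  obtain A B where n: "fst X = fst Y" and A: "A \<in> intertwiners H X Y" and B: "B \<in> carrier_mat ?n ?n"
    and AB: "A * B = 1\<^sub>m ?n" "B * A = 1\<^sub>m ?n" using isomorphicE[OF iso] .
  have Ac: "A \<in> carrier_mat ?n ?n" using intertwinersD(1)[OF A] n by simp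
  have "B \<in> intertwiners H Y X"
  proof (rule intertwinersI)
    show "B \<in> carrier_mat (fst X) (fst Y)" using B n by simp
    fix g assume g: "g \<in> carrier H"
    have xc: "snd X g \<in> carrier_mat ?n ?n" and yc: "snd Y g \<in> carrier_mat ?n ?n"
      using rep_carrier[OF X g] rep_carrier[OF Y g] n by simp_all
    have "B * snd Y g = B * snd Y g * (A * B)" using B yc AB by simp
    also have "\<dots> = B * (snd Y g * (A * B))" by (rule assoc_mult_mat[OF B yc]) (use Ac B in auto)
    also have "snd Y g * (A * B) = A * snd X g * B"
      unfolding intertwinersD(2)[OF A g] by (rule assoc_mult_mat[OF yc Ac B, symmetric])
    also have "\<dots> = A * (snd X g * B)" by (rule assoc_mult_mat[OF Ac xc B])
    also have "B * (A * (snd X g * B)) = B * A * (snd X g * B)"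
      by (rule assoc_mult_mat[OF B Ac, symmetric]) (use xc B in auto)
    finally show "B * snd Y g = snd X g * B" using AB xc B by simp
  qed
  then show ?thesis using invertible_matI[OF B Ac AB(2)] by (auto simp: isomorphic_def)
qed

lemma isomorphic_trans:
  assumes X: "X \<in> proj_reps H \<alpha>" and Y: "Y \<in> proj_reps H \<alpha>" and Z: "Z \<in> proj_reps H \<alpha>"
    and iso: "isomorphic X Y" "isomorphic Y Z"
  shows "isomorphic X Z"
proof -
  let ?n = "fst X"
  obtain A B where n: "fst X = fst Y" and A: "A \<in> intertwiners H X Y" and B: "B \<in> carrier_mat ?n ?n"
    and AB: "A * B = 1\<^sub>m ?n" "B * A = 1\<^sub>m ?n" using isomorphicE[OF iso(1)] .
  obtain C D where n': "fst Y = fst Z" and C: "C \<in> intertwiners H Y Z" and D: "D \<in> carrier_mat ?n ?n"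
    and CD: "C * D = 1\<^sub>m ?n" "D * C = 1\<^sub>m ?n" using isomorphicE[OF iso(2)] n by metis
  have Ac: "A \<in> carrier_mat ?n ?n" using intertwinersD(1)[OF A] n by simp
  have Cc: "C \<in> carrier_mat ?n ?n" using intertwinersD(1)[OF C] n n' by simp
  have CA: "C * A \<in> intertwiners H X Z"
  proof (rule intertwinersI)
    show "C * A \<in> carrier_mat (fst Z) (fst X)" using Ac Cc n n' by simp
    fix g assume g: "g \<in> carrier H"
    have xc: "snd X g \<in> carrier_mat ?n ?n" and yc: "snd Y g \<in> carrier_mat ?n ?n" and zc: "snd Z g \<in> carrier_mat ?n ?n"
      using rep_carrier[OF X g] rep_carrier[OF Y g] rep_carrier[OF Z g] n n' by simp_all
    show "C * A * snd X g = snd Z g * (C * A)"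
      by (simp only: assoc_mult_mat[OF Cc Ac xc] intertwinersD(2)[OF A g]
          assoc_mult_mat[OF Cc yc Ac, symmetric] intertwinersD(2)[OF C g] assoc_mult_mat[OF zc Cc Ac])
  qed
  have "C * A * (B * D) = C * (A * (B * D))" by (rule assoc_mult_mat[OF Cc Ac]) (use B D in auto)
  also have "A * (B * D) = A * B * D" by (rule assoc_mult_mat[OF Ac B D, symmetric])
  also have "\<dots> = D" using AB D by simp
  finally have "C * A * (B * D) = 1\<^sub>m ?n" using CD by simp
  then have "invertible_mat (C * A)" using Ac B Cc D by (intro invertible_matI[of _ ?n "B * D"]) auto
  with CA show ?thesis by (auto simp: isomorphic_def)
qed

lemma isomorphic_rchar:
  assumes X: "X \<in> proj_reps H \<alpha>" and Y: "Y \<in> proj_reps H \<alpha>" and iso: "isomorphic X Y" and g: "g \<in> carrier H"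
  shows "rchar X g = rchar Y g"
proof -
  let ?n = "fst X"
  obtain A B where n: "fst X = fst Y" and A: "A \<in> intertwiners H X Y" and B: "B \<in> carrier_mat ?n ?n"
    and AB: "A * B = 1\<^sub>m ?n" "B * A = 1\<^sub>m ?n" using isomorphicE[OF iso] .
  have Ac: "A \<in> carrier_mat ?n ?n" using intertwinersD(1)[OF A] n by simp
  have xc: "snd X g \<in> carrier_mat ?n ?n" and yc: "snd Y g \<in> carrier_mat ?n ?n"
    using rep_carrier[OF X g] rep_carrier[OF Y g] n by simp_all
  have "mtrace (snd X g) = mtrace (B * A * snd X g)" using AB xc by simp
  also have "B * A * snd X g = B * (A * snd X g)" by (rule assoc_mult_mat[OF B Ac xc])
  also have "mtrace \<dots> = mtrace (A * snd X g * B)" using Ac B xc by (intro mtrace_mult_comm[of _ ?n ?n]) auto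
  also have "A * snd X g * B = snd Y g * (A * B)"
    unfolding intertwinersD(2)[OF A g] by (rule assoc_mult_mat[OF yc Ac B])
  also have "\<dots> = snd Y g" using AB yc by simp
  finally show ?thesis by (simp add: rchar_def)
qed

end

section \<open>The Grothendieck group in terms of characters\<close>

text \<open>The virtual character of a formal integer combination of representations.\<close>

definition vchar :: "('g mrep \<Rightarrow>\<^sub>0 int) \<Rightarrow> 'g \<Rightarrow> complex" where
  "vchar x g = (\<Sum>X\<in>Poly_Mapping.keys x. of_int (Poly_Mapping.lookup x X) * rchar X g)"

lemma vchar_superset:
  "finite S \<Longrightarrow> Poly_Mapping.keys x \<subseteq> S \<Longrightarrow>
    vchar x g = (\<Sum>X\<in>S. of_int (Poly_Mapping.lookup x X) * rchar X g)"
  unfolding vchar_def by (intro sum.mono_neutral_left) (auto simp: in_keys_iff)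

lemma vchar_0 [simp]: "vchar 0 g = 0"
  by (simp add: vchar_def)

lemma vchar_of [simp]: "vchar (frag_of X) g = rchar X g"
  by (simp add: vchar_def)

lemma vchar_add [simp]: "vchar (x + y) g = vchar x g + vchar y g"
proof -
  let ?S = "Poly_Mapping.keys x \<union> Poly_Mapping.keys y"
  have "vchar z g = (\<Sum>X\<in>?S. of_int (Poly_Mapping.lookup z X) * rchar X g)" if "z \<in> {x, y, x + y}" for z
    using that Poly_Mapping.keys_add[of x y] by (intro vchar_superset) auto
  then show ?thesis by (simp add: lookup_add algebra_simps sum.distrib)
qed

lemma vchar_cmul [simp]: "vchar (frag_cmul c x) g = of_int c * vchar x g"
  using vchar_superset[of "Poly_Mapping.keys x" "frag_cmul c x" g] keys_cmul[of c x]
  by (simp add: vchar_def sum_distrib_left mult.assoc)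

lemma vchar_minus [simp]: "vchar (- x) g = - vchar x g"
  using vchar_cmul[of "- 1" x g] by simp

lemma vchar_diff [simp]: "vchar (x - y) g = vchar x g - vchar y g"
  using vchar_add[of x "- y" g] by simp

lemma vchar_sum: "vchar (\<Sum>i\<in>I. f i) g = (\<Sum>i\<in>I. vchar (f i) g)"
  by (induction I rule: infinite_finite_induct) auto

lemma vchar_frag_extend:
  "vchar (frag_extend f y) g = (\<Sum>i\<in>Poly_Mapping.keys y. of_int (Poly_Mapping.lookup y i) * vchar (f i) g)"
  by (simp add: frag_extend_def vchar_sum)

lemma keys_frag_extend_subset:
  assumes "\<And>i. i \<in> Poly_Mapping.keys y \<Longrightarrow> Poly_Mapping.keys (f i) \<subseteq> S"
  shows "Poly_Mapping.keys (frag_extend f y) \<subseteq> S"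
  using keys_frag_extend[of f y] assms by blast

lemma keys_bilinear_ext_subset:
  assumes "\<And>a b. a \<in> Poly_Mapping.keys x \<Longrightarrow> b \<in> Poly_Mapping.keys y \<Longrightarrow> t a b \<in> S"
  shows "Poly_Mapping.keys (bilinear_ext t x y) \<subseteq> S"
  unfolding bilinear_ext_def using assms by (intro keys_frag_extend_subset) auto

text \<open>Both sides are bilinear, so multiplicativity on generators suffices. Products of formal
  combinations thereby become pointwise products of functions.\<close>

lemma vchar_bilinear_ext:
  assumes "\<And>a b. a \<in> Poly_Mapping.keys x \<Longrightarrow> b \<in> Poly_Mapping.keys y \<Longrightarrow> rchar (t a b) g = rchar a g * rchar b g"
  shows "vchar (bilinear_ext t x y) g = vchar x g * vchar y g"
proof -
  let ?lx = "\<lambda>a. of_int (Poly_Mapping.lookup x a) :: complex" and ?ly = "\<lambda>b. of_int (Poly_Mapping.lookup y b) :: complex"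
  have "vchar (bilinear_ext t x y) g =
      (\<Sum>a\<in>Poly_Mapping.keys x. \<Sum>b\<in>Poly_Mapping.keys y. (?lx a * rchar a g) * (?ly b * rchar b g))"
    unfolding bilinear_ext_def vchar_frag_extend sum_distrib_left
    by (intro sum.cong refl) (simp add: assms)
  then show ?thesis by (simp add: vchar_def sum_product)
qed

text \<open>\<open>add_monoid\<close> leaves an undefined \<open>more\<close> field, so the additive group of a ring or module can
  only be compared with a plain group after truncation.\<close>

lemma finprod_truncate: "finprod (monoid.truncate G) f A = finprod G f A"
  by (simp add: finprod_def monoid.truncate_def)

lemma int_pow_truncate: "x [^]\<^bsub>monoid.truncate G\<^esub> (n::int) = x [^]\<^bsub>G\<^esub> n"
  by (simp add: int_pow_def nat_pow_def m_inv_def monoid.truncate_def Let_def)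

context finite_group_cocycle
begin

lemma short_exact_if_mat_split:
  assumes "mat_split (fst Y) (fst X) (fst Z) A P B C" "A \<in> intertwiners H X Y" "B \<in> intertwiners H Y Z"
  shows "short_exact H X Y Z"
  using exact_if_mat_split[OF assms(1)] assms(2,3) unfolding short_exact_def by blast

text \<open>Exactness is converted into a splitting of vector spaces, for which additivity of the
  trace is pure linear algebra.\<close>

lemma short_exact_rchar:
  assumes X: "X \<in> proj_reps H \<alpha>" and Y: "Y \<in> proj_reps H \<alpha>" and Z: "Z \<in> proj_reps H \<alpha>"
    and ex: "short_exact H X Y Z" and g: "g \<in> carrier H"
  shows "rchar Y g = rchar X g + rchar Z g"
proof -
  obtain A B where A: "A \<in> intertwiners H X Y" and B: "B \<in> intertwiners H Y Z"
    and "inj_on ((*\<^sub>v) A) (carrier_vec (fst X))" "(*\<^sub>v) A ` carrier_vec (fst X) = mat_kernel B"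
      "(*\<^sub>v) B ` carrier_vec (fst Y) = carrier_vec (fst Z)"
    using ex unfolding short_exact_def by blast
  then obtain P C where "mat_split (fst Y) (fst X) (fst Z) A P B C"
    using mat_split_if_exact intertwinersD(1) by metis
  then show ?thesis
    unfolding rchar_def
    using rep_carrier[OF Y g] rep_carrier[OF X g] rep_carrier[OF Z g] intertwinersD(2)[OF A g] intertwinersD(2)[OF B g]
    by (rule mat_split_mtrace)
qed

section \<open>The subgroup of relations\<close>

abbreviation R where "R \<equiv> groth_relations H \<alpha>"

abbreviation F where "F \<equiv> free_Abelian_group (proj_reps H \<alpha>)"

lemma generators_subset:
  "{frag_of Y - frag_of X - frag_of Z | X Y Z.
      X \<in> proj_reps H \<alpha> \<and> Y \<in> proj_reps H \<alpha> \<and> Z \<in> proj_reps H \<alpha> \<and> short_exact H X Y Z} \<subseteq> carrier F"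
proof safe
  fix X Y Z :: "'g mrep" assume "X \<in> proj_reps H \<alpha>" "Y \<in> proj_reps H \<alpha>" "Z \<in> proj_reps H \<alpha>"
  moreover have "Poly_Mapping.keys (frag_of Y - frag_of X - frag_of Z) \<subseteq> {X, Y, Z}"
    using keys_diff[of "frag_of Y - frag_of X" "frag_of Z"] keys_diff[of "frag_of Y" "frag_of X"] by auto
  ultimately show "frag_of Y - frag_of X - frag_of Z \<in> carrier F" by auto
qed

lemma subgroup_R: "subgroup R F"
  unfolding groth_relations_def by (rule group.generate_is_subgroup[OF group_free_Abelian_group generators_subset])

lemma R_keys: "x \<in> R \<Longrightarrow> Poly_Mapping.keys x \<subseteq> proj_reps H \<alpha>"
  using subsetD[OF subgroup.subset[OF subgroup_R], of x] by (simp only: carrier_free_Abelian_group_iff)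

lemma R_zero: "0 \<in> R"
  using subgroup.one_closed[OF subgroup_R] by simp

lemma R_add: "x \<in> R \<Longrightarrow> y \<in> R \<Longrightarrow> x + y \<in> R"
  using subgroup.m_closed[OF subgroup_R] by simp

lemma R_minus: "x \<in> R \<Longrightarrow> - x \<in> R"
  using subgroup.m_inv_closed[OF subgroup_R, of x] R_keys[of x] by simp

lemma R_diff: "x \<in> R \<Longrightarrow> y \<in> R \<Longrightarrow> x - y \<in> R"
  using R_add[of x "- y"] R_minus by simp

lemma R_short_exact:
  "X \<in> proj_reps H \<alpha> \<Longrightarrow> Y \<in> proj_reps H \<alpha> \<Longrightarrow> Z \<in> proj_reps H \<alpha> \<Longrightarrow> short_exact H X Y Z \<Longrightarrow>
    frag_of Y - frag_of X - frag_of Z \<in> R"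
  unfolding groth_relations_def by (rule generate.incl) blast

text \<open>Additivity on short exact sequences makes the generators vanish, and the vanishing
  passes to sums and negatives.\<close>

lemma vchar_R:
  assumes "x \<in> R" and g: "g \<in> carrier H"
  shows "vchar x g = 0"
proof -
  let ?A = "{frag_of Y - frag_of X - frag_of Z | X Y Z.
      X \<in> proj_reps H \<alpha> \<and> Y \<in> proj_reps H \<alpha> \<and> Z \<in> proj_reps H \<alpha> \<and> short_exact H X Y Z}"
  have gen: "vchar h g = 0" if h: "h \<in> ?A" for h
  proof -
    from h obtain X Y Z where "h = frag_of Y - frag_of X - frag_of Z" "X \<in> proj_reps H \<alpha>" "Y \<in> proj_reps H \<alpha>"
      "Z \<in> proj_reps H \<alpha>" "short_exact H X Y Z" by blast
    then show ?thesis using short_exact_rchar[OF _ _ _ _ g, of X Y Z] by simp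
  qed
  from assms(1)[unfolded groth_relations_def] show ?thesis
  proof (induction x rule: generate.induct)
    case (inv h)
    from subsetD[OF generators_subset inv] have "Poly_Mapping.keys h \<subseteq> proj_reps H \<alpha>"
      by (simp only: carrier_free_Abelian_group_iff)
    then show ?case using gen[OF inv] by simp
  qed (simp_all add: gen del: mem_Collect_eq)
qed

text \<open>In dimension zero the sequence X, X, X with zero maps is exact, and its relation is the
  negative of the generator of \<open>X\<close>.\<close>

lemma R_zero_dim:
  assumes X: "X \<in> proj_reps H \<alpha>" and "fst X = 0"
  shows "frag_of X \<in> R"
proof -
  have "short_exact H X X X"
  proof (rule short_exact_if_mat_split)
    have one: "1\<^sub>m 0 = (0\<^sub>m 0 0 :: complex mat)" by (rule eq_matI) simp_all
    show "mat_split (fst X) (fst X) (fst X) (0\<^sub>m 0 0) (0\<^sub>m 0 0) (0\<^sub>m 0 0) (0\<^sub>m 0 0)"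
      unfolding assms(2) mat_split_def by (simp add: one)
    show "0\<^sub>m 0 0 \<in> intertwiners H X X"
    proof (rule intertwinersI)
      show "0\<^sub>m 0 0 * snd X g = snd X g * 0\<^sub>m 0 0" if "g \<in> carrier H" for g
        using rep_carrier[OF X that] unfolding assms(2) by simp
    qed (simp add: assms(2))
    then show "0\<^sub>m 0 0 \<in> intertwiners H X X" .
  qed
  then have "- (frag_of X - frag_of X - frag_of X) \<in> R" by (intro R_minus R_short_exact X)
  then show ?thesis by simp
qed

text \<open>An isomorphism is a short exact sequence whose third term is zero; the generator of that
  zero representation is itself a relation.\<close>

lemma R_isomorphic:
  assumes X: "X \<in> proj_reps H \<alpha>" and Y: "Y \<in> proj_reps H \<alpha>" and iso: "isomorphic X Y"
  shows "frag_of X - frag_of Y \<in> R"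
proof -
  let ?n = "fst X"
  obtain A B where n: "fst X = fst Y" and A: "A \<in> intertwiners H X Y" and B: "B \<in> carrier_mat ?n ?n"
    and AB: "A * B = 1\<^sub>m ?n" "B * A = 1\<^sub>m ?n" using isomorphicE[OF iso] .
  have Ac: "A \<in> carrier_mat ?n ?n" using intertwinersD(1)[OF A] n by simp
  \<comment> \<open>All matrices of size zero are equal, so this is a representation for any
    multiplier.\<close>
  define Z :: "'g mrep" where "Z = (0, \<lambda>_. 0\<^sub>m 0 0)"
  have Z: "Z \<in> proj_reps H \<alpha>" by (rule proj_repsI) (auto simp: Z_def intro!: eq_matI)
  have "short_exact H X Y Z"
  proof (rule short_exact_if_mat_split[OF _ A])
    show "mat_split (fst Y) (fst X) (fst Z) A B (0\<^sub>m 0 ?n) (0\<^sub>m ?n 0)"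
      using n Ac B AB by (auto simp: mat_split_def Z_def intro!: eq_matI)
    show "0\<^sub>m 0 ?n \<in> intertwiners H Y Z"
    proof (rule intertwinersI)
      fix g assume "g \<in> carrier H"
      from rep_carrier[OF Y this] show "0\<^sub>m 0 ?n * snd Y g = snd Z g * 0\<^sub>m 0 ?n"
        using n by (intro eq_matI) (auto simp: Z_def)
    qed (simp add: Z_def n)
  qed
  then have "frag_of Y - frag_of X - frag_of Z \<in> R" by (rule R_short_exact[OF X Y Z])
  moreover have "frag_of Z \<in> R" by (rule R_zero_dim[OF Z]) (simp add: Z_def)
  ultimately have "- ((frag_of Y - frag_of X - frag_of Z) + frag_of Z) \<in> R" by (intro R_minus R_add)
  then show ?thesis by simp
qed

text \<open>With \<open>A\<close> and \<open>P\<close> the coordinates of \<open>W\<close> and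
  \<open>B\<close> and \<open>C\<close> those of a complement, \<open>P * X(g) * A\<close> is the
  action on \<open>W\<close> and \<open>B * X(g) * C\<close> the action on the quotient. The
  complement need not be invariant; that \<open>W\<close> is invariant is what makes both families
  multiplicative.\<close>

lemma invariant_subspace_exact:
  assumes X: "X \<in> proj_reps H \<alpha>" and W: "VectorSpace.subspace class_ring W (module_vec TYPE(complex) (fst X))"
    and inv: "\<And>g w. g \<in> carrier H \<Longrightarrow> w \<in> W \<Longrightarrow> snd X g *\<^sub>v w \<in> W"
    and ne: "W \<noteq> {0\<^sub>v (fst X)}" "W \<noteq> carrier_vec (fst X)"
  obtains Y Z where "Y \<in> proj_reps H \<alpha>" "Z \<in> proj_reps H \<alpha>" "short_exact H Y X Z"
    "fst Y < fst X" "fst Z < fst X"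
proof -
  let ?n = "fst X"
  obtain d e A P B C where s: "mat_split ?n d e A P B C" and im: "(*\<^sub>v) A ` carrier_vec d = W"
    using subspace_split[OF W] .
  from s have c: "A \<in> carrier_mat ?n d" "P \<in> carrier_mat d ?n" "B \<in> carrier_mat e ?n" "C \<in> carrier_mat ?n e"
    and eqs: "P * A = 1\<^sub>m d" "B * C = 1\<^sub>m e" "B * A = 0\<^sub>m e d" "A * P + C * B = 1\<^sub>m ?n" by (auto simp: mat_split_def)
  note xc = rep_carrier[OF X]
  have dim: "d + e = ?n" by (rule mat_split_dim[OF s])
  have "d \<noteq> 0"
  proof
    assume "d = 0"
    then have zero: "A *\<^sub>v v = 0\<^sub>v ?n" if "v \<in> carrier_vec d" for v
      using that c by (auto intro!: eq_vecI simp: scalar_prod_def)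
    have "W = (\<lambda>_::complex vec. 0\<^sub>v ?n) ` carrier_vec d" unfolding im[symmetric] by (intro image_cong refl zero)
    also have "\<dots> = {0\<^sub>v ?n}" using zero_carrier_vec by (rule image_constant)
    finally show False using ne by blast
  qed
  have "e \<noteq> 0"
  proof
    assume e: "e = 0"
    have "v \<in> W" if v: "v \<in> carrier_vec ?n" for v
    proof -
      have "B *\<^sub>v v = 0\<^sub>v e" using c e by (auto intro!: eq_vecI)
      then have "A *\<^sub>v (P *\<^sub>v v) = v" by (rule mat_split_image[OF s v])
      then show ?thesis unfolding im[symmetric] using c v by (metis imageI mult_mat_vec_carrier)
    qed
    moreover have "W \<subseteq> carrier_vec ?n" using W by (simp add: subspace_iff_closed)
    ultimately show False using ne by blast
  qed
  \<comment> \<open>Invariance of \<open>W\<close> as a matrix identity: \<open>X(g) * A\<close> has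
    its values in \<open>W\<close>, where \<open>A * P\<close> is the identity.\<close>
  have APXA: "A * (P * (snd X g * A)) = snd X g * A" if g: "g \<in> carrier H" for g
  proof (rule mat_eq_if_mult_vec_eq)
    have XA: "snd X g * A \<in> carrier_mat ?n d" using xc[OF g] c by simp
    then have PXA: "P * (snd X g * A) \<in> carrier_mat d d" using c by simp
    show "A * (P * (snd X g * A)) \<in> carrier_mat ?n d" using c PXA by simp
    show "snd X g * A \<in> carrier_mat ?n d" by (rule XA)
    fix v :: "complex vec" assume v: "v \<in> carrier_vec d"
    have "snd X g *\<^sub>v (A *\<^sub>v v) \<in> W" using inv[OF g] im v by blast
    then obtain u where u: "u \<in> carrier_vec d" "snd X g *\<^sub>v (A *\<^sub>v v) = A *\<^sub>v u" using im by blast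
    then have XAv: "(snd X g * A) *\<^sub>v v = A *\<^sub>v u" using assoc_mult_mat_vec[OF xc[OF g] c(1) v] by simp
    have "A * (P * (snd X g * A)) *\<^sub>v v = A *\<^sub>v (P *\<^sub>v ((snd X g * A) *\<^sub>v v))"
      by (simp only: assoc_mult_mat_vec[OF c(1) PXA v] assoc_mult_mat_vec[OF c(2) XA v])
    also have "\<dots> = A *\<^sub>v (P * A *\<^sub>v u)" unfolding XAv using assoc_mult_mat_vec[OF c(2,1) u(1)] by simp
    also have "\<dots> = (snd X g * A) *\<^sub>v v" using u(1) eqs XAv by simp
    finally show "A * (P * (snd X g * A)) *\<^sub>v v = (snd X g * A) *\<^sub>v v" .
  qed
  \<comment> \<open>The action passes to the quotient: after inserting \<open>A * P + C * B\<close>,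
    the first term vanishes because \<open>B * X(g) * A\<close> factors through
    \<open>B * A = 0\<close>.\<close>
  have BXCB: "B * snd X g = (B * (snd X g * C)) * B" if g: "g \<in> carrier H" for g
  proof -
    note x = xc[OF g]
    have XA: "snd X g * A \<in> carrier_mat ?n d" and XC: "snd X g * C \<in> carrier_mat ?n e"
      and PXA: "P * (snd X g * A) \<in> carrier_mat d d" and AP: "A * P \<in> carrier_mat ?n ?n"
      and CB: "C * B \<in> carrier_mat ?n ?n" and BX: "B * snd X g \<in> carrier_mat e ?n" using x c by simp_all
    have BXA: "B * (snd X g * A) = 0\<^sub>m e d"
    proof -
      have "B * (snd X g * A) = B * (A * (P * (snd X g * A)))" unfolding APXA[OF g] ..
      also have "\<dots> = B * A * (P * (snd X g * A))" by (rule assoc_mult_mat[OF c(3,1) PXA, symmetric])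
      finally show ?thesis unfolding eqs(3) left_mult_zero_mat[OF PXA] .
    qed
    have "B * snd X g = B * snd X g * (A * P + C * B)" unfolding eqs(4) by (rule right_mult_one_mat[OF BX, symmetric])
    also have "\<dots> = B * snd X g * (A * P) + B * snd X g * (C * B)"
      by (rule mult_add_distrib_mat[OF BX AP CB])
    also have "B * snd X g * (A * P) = B * (snd X g * A) * P"
      by (simp only: assoc_mult_mat[OF BX c(1,2), symmetric] assoc_mult_mat[OF c(3) x c(1)])
    also have "\<dots> = 0\<^sub>m e ?n" unfolding BXA using c by simp
    also have "B * snd X g * (C * B) = (B * (snd X g * C)) * B"
      by (simp only: assoc_mult_mat[OF BX c(4,3), symmetric] assoc_mult_mat[OF c(3) x c(4)])
    also have "0\<^sub>m e ?n + B * (snd X g * C) * B = B * (snd X g * C) * B"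
      by (rule left_add_zero_mat[of _ e ?n]) (use c XC in simp)
    finally show ?thesis .
  qed
  define Y where "Y = (d, \<lambda>g. P * (snd X g * A))"
  define Z where "Z = (e, \<lambda>g. B * (snd X g * C))"
  have Y: "Y \<in> proj_reps H \<alpha>"
  proof (rule proj_repsI)
    fix g assume g: "g \<in> carrier H"
    note x = xc[OF g]
    show "snd Y g \<in> carrier_mat (fst Y) (fst Y)" using x c by (simp add: Y_def)
    fix h assume h: "h \<in> carrier H"
    note xh = xc[OF h]
    have gh: "g \<otimes> h \<in> carrier H" using g h by simp
    have XA: "snd X g * A \<in> carrier_mat ?n d" "snd X h * A \<in> carrier_mat ?n d"
      and PXA: "P * (snd X h * A) \<in> carrier_mat d d" using x xh c by simp_all
    have "P * (snd X g * A) * (P * (snd X h * A)) = P * (snd X g * (A * (P * (snd X h * A))))"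
      by (simp only: assoc_mult_mat[OF c(2) XA(1) PXA] assoc_mult_mat[OF x c(1) PXA])
    also have "\<dots> = P * (snd X g * snd X h * A)"
      unfolding APXA[OF h] by (simp only: assoc_mult_mat[OF x xh c(1)])
    also have "\<dots> = \<alpha> g h \<cdot>\<^sub>m (P * (snd X (g \<otimes> h) * A))"
      unfolding rep_mult[OF X g h] using xc[OF gh] c
      by (simp add: mult_smult_assoc_mat[of _ ?n ?n _ d] mult_smult_distrib[of P d ?n _ d])
    finally show "snd Y g * snd Y h = \<alpha> g h \<cdot>\<^sub>m snd Y (g \<otimes> h)" by (simp add: Y_def)
  next
    show "snd Y \<one> = \<alpha> \<one> \<one> \<cdot>\<^sub>m 1\<^sub>m (fst Y)"
      using c eqs by (simp add: Y_def rep_one[OF X] mult_smult_assoc_mat[of _ ?n ?n _ d] mult_smult_distrib[of P d ?n _ d])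
  qed
  have Z: "Z \<in> proj_reps H \<alpha>"
  proof (rule proj_repsI)
    fix g assume g: "g \<in> carrier H"
    note x = xc[OF g]
    show "snd Z g \<in> carrier_mat (fst Z) (fst Z)" using x c by (simp add: Z_def)
    fix h assume h: "h \<in> carrier H"
    note xh = xc[OF h]
    have gh: "g \<otimes> h \<in> carrier H" using g h by simp
    have XC: "snd X g * C \<in> carrier_mat ?n e" "snd X h * C \<in> carrier_mat ?n e"
      and BXC: "B * (snd X g * C) \<in> carrier_mat e e" and BX: "B * snd X g \<in> carrier_mat e ?n" using x xh c by simp_all
    have "B * (snd X g * C) * (B * (snd X h * C)) = B * (snd X g * C) * B * (snd X h * C)"
      by (rule assoc_mult_mat[OF BXC c(3) XC(2), symmetric])
    also have "\<dots> = B * (snd X g * snd X h * C)"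
      unfolding BXCB[OF g, symmetric]
      by (simp only: assoc_mult_mat[OF c(3) x XC(2)] assoc_mult_mat[OF x xh c(4)])
    also have "\<dots> = \<alpha> g h \<cdot>\<^sub>m (B * (snd X (g \<otimes> h) * C))"
      unfolding rep_mult[OF X g h] using xc[OF gh] c
      by (simp add: mult_smult_assoc_mat[of _ ?n ?n _ e] mult_smult_distrib[of B e ?n _ e])
    finally show "snd Z g * snd Z h = \<alpha> g h \<cdot>\<^sub>m snd Z (g \<otimes> h)" by (simp add: Z_def)
  next
    show "snd Z \<one> = \<alpha> \<one> \<one> \<cdot>\<^sub>m 1\<^sub>m (fst Z)"
      using c eqs by (simp add: Z_def rep_one[OF X] mult_smult_assoc_mat[of _ ?n ?n _ e] mult_smult_distrib[of B e ?n _ e])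
  qed
  have "short_exact H Y X Z"
  proof (rule short_exact_if_mat_split)
    show "mat_split (fst X) (fst Y) (fst Z) A P B C" using s by (simp add: Y_def Z_def)
    show "A \<in> intertwiners H Y X" using c APXA by (intro intertwinersI) (simp_all add: Y_def)
    show "B \<in> intertwiners H X Z" using c BXCB by (intro intertwinersI) (simp_all add: Z_def)
  qed
  moreover have "fst Y < ?n" "fst Z < ?n" using dim \<open>d \<noteq> 0\<close> \<open>e \<noteq> 0\<close> by (simp_all add: Y_def Z_def)
  ultimately show ?thesis using that Y Z by blast
qed

section \<open>Simple classes and reduction to them\<close>

abbreviation S where "S \<equiv> simple_classes H \<alpha>"

text \<open>Bases are indexed by isomorphism classes, whereas matrices and characters belong to
  representations; a fixed choice links the two.\<close>

definition rep :: "'g mrep set \<Rightarrow> 'g mrep" where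
  "rep k = (SOME X. simple_rep H \<alpha> X \<and> k = iso_class H \<alpha> X)"

lemma rep_of_class:
  assumes "k \<in> S"
  shows "simple_rep H \<alpha> (rep k)" "iso_class H \<alpha> (rep k) = k"
proof -
  have "\<exists>X. simple_rep H \<alpha> X \<and> k = iso_class H \<alpha> X" using assms by (auto simp: simple_classes_def)
  from someI_ex[OF this] show "simple_rep H \<alpha> (rep k)" "iso_class H \<alpha> (rep k) = k"
    by (auto simp: rep_def)
qed

lemma rep_in_proj_reps: "k \<in> S \<Longrightarrow> rep k \<in> proj_reps H \<alpha>"
  using rep_of_class simple_imp_rep by blast

lemma mem_iso_class: "Y \<in> iso_class H \<alpha> X \<longleftrightarrow> Y \<in> proj_reps H \<alpha> \<and> isomorphic X Y"
  by (auto simp: iso_class_def isomorphic_def)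

lemma iso_class_eq_iff:
  assumes X: "X \<in> proj_reps H \<alpha>" and Y: "Y \<in> proj_reps H \<alpha>"
  shows "iso_class H \<alpha> X = iso_class H \<alpha> Y \<longleftrightarrow> isomorphic X Y"
proof
  assume "iso_class H \<alpha> X = iso_class H \<alpha> Y"
  then show "isomorphic X Y" using mem_iso_class isomorphic_refl Y by metis
next
  assume "isomorphic X Y"
  then show "iso_class H \<alpha> X = iso_class H \<alpha> Y"
    using isomorphic_sym isomorphic_trans X Y unfolding set_eq_iff mem_iso_class by metis
qed

lemma cpair_rep:
  assumes k: "k \<in> S" and l: "l \<in> S"
  shows "cpair (rchar (rep k)) (rchar (rep l)) = (if k = l then 1 else 0)"
proof (cases "k = l")
  case True
  then show ?thesis using cpair_self rep_of_class k by simp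
next
  case False
  then have "\<not> isomorphic (rep l) (rep k)"
    using iso_class_eq_iff[OF rep_in_proj_reps[OF l] rep_in_proj_reps[OF k]] rep_of_class k l by auto
  with False show ?thesis using cpair_nonisomorphic rep_of_class k l by simp
qed

abbreviation simple_comb :: "('g mrep set \<Rightarrow>\<^sub>0 int) \<Rightarrow> ('g mrep \<Rightarrow>\<^sub>0 int)" where
  "simple_comb y \<equiv> frag_extend (\<lambda>k. frag_of (rep k)) y"

lemma keys_simple_comb: "Poly_Mapping.keys y \<subseteq> S \<Longrightarrow> Poly_Mapping.keys (simple_comb y) \<subseteq> proj_reps H \<alpha>"
  by (rule keys_frag_extend_subset) (auto intro: rep_in_proj_reps)

text \<open>Linearity in the first argument, for arbitrary functions given on the group only, so
  that it applies to virtual characters.\<close>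

lemma cpair_sum:
  assumes "\<And>g. g \<in> carrier H \<Longrightarrow> \<phi> g = (\<Sum>k\<in>K. c k * f k g)"
  shows "cpair \<phi> \<psi> = (\<Sum>k\<in>K. c k * cpair (f k) \<psi>)"
proof -
  have "(\<Sum>g\<in>carrier H. \<phi> g * \<psi> (inv g) / \<beta> g) = (\<Sum>g\<in>carrier H. \<Sum>k\<in>K. c k * (f k g * \<psi> (inv g) / \<beta> g))"
    using assms by (intro sum.cong refl) (simp add: sum_distrib_right sum_divide_distrib mult.assoc)
  also have "\<dots> = (\<Sum>k\<in>K. c k * (\<Sum>g\<in>carrier H. f k g * \<psi> (inv g) / \<beta> g))"
    by (subst sum.swap) (simp add: sum_distrib_left)
  finally have "cpair \<phi> \<psi> = (\<Sum>k\<in>K. c k * (\<Sum>g\<in>carrier H. f k g * \<psi> (inv g) / \<beta> g)) / of_nat (card (carrier H))"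
    by (simp add: cpair_def)
  also have "\<dots> = (\<Sum>k\<in>K. c k * cpair (f k) \<psi>)"
    by (subst sum_divide_distrib) (simp add: cpair_def)
  finally show ?thesis .
qed

text \<open>Orthonormality leaves only the term at \<open>l\<close>. The coefficients of a
  combination of simple classes can thus be recovered from its character.\<close>

lemma cpair_simple_comb:
  assumes y: "Poly_Mapping.keys y \<subseteq> S" and l: "l \<in> S"
  shows "cpair (vchar (simple_comb y)) (rchar (rep l)) = of_int (Poly_Mapping.lookup y l)"
proof -
  let ?K = "Poly_Mapping.keys y"
  have "cpair (vchar (simple_comb y)) (rchar (rep l)) =
      (\<Sum>k\<in>?K. of_int (Poly_Mapping.lookup y k) * cpair (rchar (rep k)) (rchar (rep l)))"
    by (rule cpair_sum) (simp add: vchar_frag_extend)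
  also have "\<dots> = (\<Sum>k\<in>?K. if k = l then of_int (Poly_Mapping.lookup y k) else 0)"
    by (intro sum.cong refl) (simp add: cpair_rep[OF subsetD[OF y] l])
  also have "\<dots> = of_int (Poly_Mapping.lookup y l)"
    by (simp add: in_keys_iff)
  finally show ?thesis .
qed

text \<open>Strong induction on the dimension: a representation that is neither zero nor simple is,
  modulo relations, the sum of two smaller ones. Coefficients are only ever added, which keeps them
  nonnegative; they play the part of composition multiplicities.\<close>

lemma rep_decomposition:
  assumes "X \<in> proj_reps H \<alpha>"
  shows "\<exists>y. Poly_Mapping.keys y \<subseteq> S \<and> (\<forall>k. Poly_Mapping.lookup y k \<ge> 0) \<and> frag_of X - simple_comb y \<in> R"
  using assms
proof (induction "fst X" arbitrary: X rule: less_induct)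
  case less
  note X = \<open>X \<in> proj_reps H \<alpha>\<close>
  consider "fst X = 0" | "simple_rep H \<alpha> X" | "fst X > 0" "\<not> simple_rep H \<alpha> X" by blast
  then show ?case
  proof cases
    case 1
    then show ?thesis using R_zero_dim[OF X] by (intro exI[of _ 0]) simp
  next
    case 2
    define k where "k = iso_class H \<alpha> X"
    have k: "k \<in> S" using 2 unfolding k_def simple_classes_def by blast
    have "isomorphic X (rep k)"
      using iso_class_eq_iff[OF X rep_in_proj_reps[OF k]] rep_of_class(2)[OF k] by (simp add: k_def)
    then have "frag_of X - frag_of (rep k) \<in> R" by (rule R_isomorphic[OF X rep_in_proj_reps[OF k]])
    then show ?thesis using k by (intro exI[of _ "frag_of k"]) simp
  next
    case 3
    then obtain W where W: "VectorSpace.subspace class_ring W (module_vec TYPE(complex) (fst X))"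
      "\<And>g w. g \<in> carrier H \<Longrightarrow> w \<in> W \<Longrightarrow> snd X g *\<^sub>v w \<in> W" "W \<noteq> {0\<^sub>v (fst X)}" "W \<noteq> carrier_vec (fst X)"
      using X unfolding simple_rep_def by blast
    obtain Y Z where Y: "Y \<in> proj_reps H \<alpha>" and Z: "Z \<in> proj_reps H \<alpha>" and ex: "short_exact H Y X Z"
      and lt: "fst Y < fst X" "fst Z < fst X" using invariant_subspace_exact[OF X W] .
    obtain y where y: "Poly_Mapping.keys y \<subseteq> S" "\<And>k. Poly_Mapping.lookup y k \<ge> 0" "frag_of Y - simple_comb y \<in> R"
      using less(1)[OF lt(1) Y] by blast
    obtain z where z: "Poly_Mapping.keys z \<subseteq> S" "\<And>k. Poly_Mapping.lookup z k \<ge> 0" "frag_of Z - simple_comb z \<in> R"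
      using less(1)[OF lt(2) Z] by blast
    have "(frag_of X - frag_of Y - frag_of Z) + ((frag_of Y - simple_comb y) + (frag_of Z - simple_comb z)) \<in> R"
      using R_short_exact[OF Y X Z ex] y(3) z(3) by (intro R_add)
    then have "frag_of X - simple_comb (y + z) \<in> R" by (simp add: frag_extend_add algebra_simps)
    moreover have "Poly_Mapping.keys (y + z) \<subseteq> S" using y(1) z(1) Poly_Mapping.keys_add[of y z] by blast
    ultimately show ?thesis using y(2) z(2) by (intro exI[of _ "y + z"]) (simp add: lookup_add)
  qed
qed

text \<open>Formal combinations involve differences, so the sign information available for a single
  representation is lost here.\<close>

lemma decomposition:
  assumes "Poly_Mapping.keys x \<subseteq> proj_reps H \<alpha>"
  shows "\<exists>y. Poly_Mapping.keys y \<subseteq> S \<and> x - simple_comb y \<in> R"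
  using assms
proof (induction x rule: frag_induction)
  case zero
  then show ?case using R_zero by (intro exI[of _ 0]) simp
next
  case (one X)
  then show ?case using rep_decomposition by blast
next
  case (diff a b)
  then obtain y z where "Poly_Mapping.keys y \<subseteq> S" "a - simple_comb y \<in> R" "Poly_Mapping.keys z \<subseteq> S" "b - simple_comb z \<in> R"
    by blast
  then have "(a - b) - simple_comb (y - z) \<in> R" "Poly_Mapping.keys (y - z) \<subseteq> S"
    using R_diff[of "a - simple_comb y" "b - simple_comb z"] keys_diff[of y z]
    by (auto simp: frag_extend_diff algebra_simps)
  then show ?case by blast
qed

text \<open>For the converse, reduce \<open>x\<close> modulo relations to a combination of simple
  classes. Its character still vanishes on the group, so pairing with each simple character makes
  all its coefficients zero.\<close>

lemma R_iff_vchar: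
  "x \<in> R \<longleftrightarrow> Poly_Mapping.keys x \<subseteq> proj_reps H \<alpha> \<and> (\<forall>g\<in>carrier H. vchar x g = 0)"
proof (intro iffI conjI ballI)
  assume x: "Poly_Mapping.keys x \<subseteq> proj_reps H \<alpha> \<and> (\<forall>g\<in>carrier H. vchar x g = 0)"
  then obtain y where y: "Poly_Mapping.keys y \<subseteq> S" "x - simple_comb y \<in> R" using decomposition by blast
  then have "vchar (simple_comb y) g = 0" if "g \<in> carrier H" for g
    using vchar_R[OF y(2) that] x that by simp
  then have "cpair (vchar (simple_comb y)) \<psi> = 0" for \<psi> by (simp add: cpair_def)
  then have "Poly_Mapping.lookup y l = 0" if "l \<in> S" for l using cpair_simple_comb[OF y(1) that] by simp
  with y(1) have "y = 0" by (metis in_keys_iff keys_eq_empty subsetD ex_in_conv)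
  with y(2) show "x \<in> R" by simp
qed (use R_keys vchar_R in auto)

section \<open>Cosets and the group operations in the Grothendieck group\<close>

lemma mem_groth_coset:
  assumes "Poly_Mapping.keys x \<subseteq> proj_reps H \<alpha>"
  shows "y \<in> groth_coset H \<alpha> x \<longleftrightarrow>
    Poly_Mapping.keys y \<subseteq> proj_reps H \<alpha> \<and> (\<forall>g\<in>carrier H. vchar y g = vchar x g)"
proof -
  have "y \<in> groth_coset H \<alpha> x \<longleftrightarrow> (\<exists>r\<in>R. y = r + x)" by (simp add: groth_coset_def r_coset_def)
  also have "\<dots> \<longleftrightarrow> y - x \<in> R" by (metis add_diff_cancel_right' diff_add_cancel)
  also have "\<dots> \<longleftrightarrow> Poly_Mapping.keys (y - x) \<subseteq> proj_reps H \<alpha> \<and> (\<forall>g\<in>carrier H. vchar y g = vchar x g)"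
    by (simp add: R_iff_vchar)
  also have "Poly_Mapping.keys (y - x) \<subseteq> proj_reps H \<alpha> \<longleftrightarrow> Poly_Mapping.keys y \<subseteq> proj_reps H \<alpha>"
    using keys_diff[of y x] Poly_Mapping.keys_add[of "y - x" x] assms by auto
  finally show ?thesis .
qed

lemma groth_coset_eq_iff:
  assumes "Poly_Mapping.keys x \<subseteq> proj_reps H \<alpha>" "Poly_Mapping.keys y \<subseteq> proj_reps H \<alpha>"
  shows "groth_coset H \<alpha> x = groth_coset H \<alpha> y \<longleftrightarrow> (\<forall>g\<in>carrier H. vchar x g = vchar y g)"
  using mem_groth_coset[OF assms(1)] mem_groth_coset[OF assms(2)] assms by (auto simp: set_eq_iff)

lemma carrier_groth_group: "carrier (groth_group H \<alpha>) = groth_coset H \<alpha> ` carrier F"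
  unfolding groth_group_def groth_coset_def by (rule carrier_FactGroup)

lemma comm_group_groth_group: "comm_group (groth_group H \<alpha>)"
  unfolding groth_group_def
  by (rule comm_group.abelian_FactGroup[OF abelian_free_Abelian_group subgroup_R])

lemma groth_coset_hom: "groth_coset H \<alpha> \<in> hom F (groth_group H \<alpha>)"
proof -
  have "normal R F" by (rule comm_group.subgroup_imp_normal[OF abelian_free_Abelian_group subgroup_R])
  from normal.r_coset_hom_Mod[OF this] show ?thesis by (simp add: groth_group_def groth_coset_def[abs_def])
qed

lemma groth_coset_closed [simp]:
  "Poly_Mapping.keys x \<subseteq> proj_reps H \<alpha> \<Longrightarrow> groth_coset H \<alpha> x \<in> carrier (groth_group H \<alpha>)"
  by (auto simp: carrier_groth_group)

lemma groth_coset_add: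
  "Poly_Mapping.keys x \<subseteq> proj_reps H \<alpha> \<Longrightarrow> Poly_Mapping.keys y \<subseteq> proj_reps H \<alpha> \<Longrightarrow>
    groth_coset H \<alpha> x \<otimes>\<^bsub>groth_group H \<alpha>\<^esub> groth_coset H \<alpha> y = groth_coset H \<alpha> (x + y)"
  using hom_mult[OF groth_coset_hom, of x y] by simp

lemma groth_coset_zero: "groth_coset H \<alpha> 0 = \<one>\<^bsub>groth_group H \<alpha>\<^esub>"
proof -
  interpret group_hom F "groth_group H \<alpha>" "groth_coset H \<alpha>"
    using groth_coset_hom comm_group_groth_group by (simp add: group_hom_def group_hom_axioms_def comm_group.axioms(2))
  show ?thesis using hom_one by simp
qed

lemma groth_coset_cmul:
  assumes x: "Poly_Mapping.keys x \<subseteq> proj_reps H \<alpha>"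
  shows "groth_coset H \<alpha> x [^]\<^bsub>groth_group H \<alpha>\<^esub> (c::int) = groth_coset H \<alpha> (frag_cmul c x)"
proof -
  interpret group_hom F "groth_group H \<alpha>" "groth_coset H \<alpha>"
    using groth_coset_hom comm_group_groth_group by (simp add: group_hom_def group_hom_axioms_def comm_group.axioms(2))
  show ?thesis using hom_int_pow[of x c] x by simp
qed

text \<open>Isomorphic representations have equal characters and hence equal cosets, so the set
  handed to \<open>the_elem\<close> is a singleton.\<close>

lemma groth_class_eq:
  assumes k: "k \<in> S"
  shows "groth_class H \<alpha> k = groth_coset H \<alpha> (frag_of (rep k))"
proof -
  have "groth_coset H \<alpha> (frag_of X) = groth_coset H \<alpha> (frag_of (rep k))" if "X \<in> k" for X
  proof -
    have X: "X \<in> proj_reps H \<alpha>" "isomorphic (rep k) X"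
      using that rep_of_class(2)[OF k] mem_iso_class by metis+
    then show ?thesis
      using isomorphic_rchar[OF rep_in_proj_reps[OF k] X] rep_in_proj_reps[OF k] by (simp add: groth_coset_eq_iff)
  qed
  moreover have "rep k \<in> k"
    using mem_iso_class isomorphic_refl rep_in_proj_reps[OF k] rep_of_class(2)[OF k] by metis
  ultimately have "(\<lambda>X. groth_coset H \<alpha> (frag_of X)) ` k = {groth_coset H \<alpha> (frag_of (rep k))}" by blast
  then show ?thesis by (simp add: groth_class_def)
qed

section \<open>Integral bases and coordinates\<close>

lemma int_lincomb_groth_class:
  fixes M :: "(('g mrep \<Rightarrow>\<^sub>0 int) set, 'x) ring_scheme"
  assumes M: "monoid.truncate (add_monoid M) = groth_group H \<alpha>" and y: "Poly_Mapping.keys y \<subseteq> S"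
  shows "int_lincomb M (groth_class H \<alpha>) (Poly_Mapping.lookup y) = groth_coset H \<alpha> (simple_comb y)"
proof -
  interpret comm_group "groth_group H \<alpha>" by (rule comm_group_groth_group)
  let ?f = "\<lambda>k. groth_class H \<alpha> k [^]\<^bsub>groth_group H \<alpha>\<^esub> Poly_Mapping.lookup y k"
  let ?x = "\<lambda>k. frag_cmul (Poly_Mapping.lookup y k) (frag_of (rep k))"
  have f: "?f k = groth_coset H \<alpha> (?x k)" and x: "Poly_Mapping.keys (?x k) \<subseteq> proj_reps H \<alpha>" if "k \<in> S" for k
    using that rep_in_proj_reps[OF that] keys_cmul[of _ "frag_of (rep k)"]
    by (auto simp: groth_class_eq groth_coset_cmul)
  \<comment> \<open>The support statement is carried through the induction because adding cosets
    requires both representatives to lie in the free group on the representations.\<close>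
  have "finprod (groth_group H \<alpha>) ?f K = groth_coset H \<alpha> (sum ?x K) \<and> Poly_Mapping.keys (sum ?x K) \<subseteq> proj_reps H \<alpha>"
    if "finite K" "K \<subseteq> S" for K
    using that
  proof (induction K rule: finite_induct)
    case empty
    then show ?case by (simp add: groth_coset_zero)
  next
    case (insert k K)
    then have k: "k \<in> S" and KS: "K \<subseteq> S" by auto
    have "?f \<in> K \<rightarrow> carrier (groth_group H \<alpha>)" using f x KS by auto
    moreover have "?f k \<in> carrier (groth_group H \<alpha>)" using f x k by auto
    ultimately have "finprod (groth_group H \<alpha>) ?f (insert k K) = ?f k \<otimes>\<^bsub>groth_group H \<alpha>\<^esub> finprod (groth_group H \<alpha>) ?f K"
      using insert by (intro finprod_insert) auto
    also have "\<dots> = groth_coset H \<alpha> (?x k) \<otimes>\<^bsub>groth_group H \<alpha>\<^esub> groth_coset H \<alpha> (sum ?x K)"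
      using insert KS f[OF k] by simp
    also have "\<dots> = groth_coset H \<alpha> (?x k + sum ?x K)" using insert KS x[OF k] by (intro groth_coset_add) auto
    finally show ?case
      using insert KS x[OF k] Poly_Mapping.keys_add[of "?x k" "sum ?x K"] by auto
  qed
  from this[of "Poly_Mapping.keys y"] y
  have "finprod (groth_group H \<alpha>) ?f (Poly_Mapping.keys y) = groth_coset H \<alpha> (simple_comb y)"
    by (simp add: frag_extend_def)
  moreover have "{i. Poly_Mapping.lookup y i \<noteq> 0} = Poly_Mapping.keys y" by (auto simp: in_keys_iff)
  ultimately show ?thesis
    unfolding int_lincomb_def finsum_def add_pow_def
    by (simp flip: finprod_truncate[of "add_monoid M"] int_pow_truncate[of "add_monoid M"] add: M)
qed

lemma int_coeffs_eq: "c \<in> int_coeffs I \<longleftrightarrow> (\<exists>y. Poly_Mapping.keys y \<subseteq> I \<and> c = Poly_Mapping.lookup y)"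
proof
  assume c: "c \<in> int_coeffs I"
  then have "Poly_Mapping.lookup (Abs_poly_mapping c) = c"
    by (simp add: int_coeffs_def Abs_poly_mapping_inverse)
  with c show "\<exists>y. Poly_Mapping.keys y \<subseteq> I \<and> c = Poly_Mapping.lookup y"
    by (intro exI[of _ "Abs_poly_mapping c"]) (auto simp: int_coeffs_def in_keys_iff)
next
  assume "\<exists>y. Poly_Mapping.keys y \<subseteq> I \<and> c = Poly_Mapping.lookup y"
  then obtain y where y: "Poly_Mapping.keys y \<subseteq> I" "c = Poly_Mapping.lookup y" by blast
  moreover have "{i. Poly_Mapping.lookup y i \<noteq> 0} = Poly_Mapping.keys y" by (auto simp: in_keys_iff)
  ultimately show "c \<in> int_coeffs I" by (simp add: int_coeffs_def)
qed

lemma coefficients_unique: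
  fixes M :: "(('g mrep \<Rightarrow>\<^sub>0 int) set, 'x) ring_scheme"
  assumes M: "monoid.truncate (add_monoid M) = groth_group H \<alpha>" and x: "Poly_Mapping.keys x \<subseteq> proj_reps H \<alpha>"
    and c: "c \<in> int_coeffs S" "groth_coset H \<alpha> x = int_lincomb M (groth_class H \<alpha>) c" and l: "l \<in> S"
  shows "of_int (c l) = cpair (vchar x) (rchar (rep l))"
proof -
  obtain y where y: "Poly_Mapping.keys y \<subseteq> S" "c = Poly_Mapping.lookup y" using iffD1[OF int_coeffs_eq c(1)] by blast
  with c(2) have "groth_coset H \<alpha> x = groth_coset H \<alpha> (simple_comb y)" by (simp add: int_lincomb_groth_class[OF M])
  then have "\<forall>g\<in>carrier H. vchar x g = vchar (simple_comb y) g"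
    using groth_coset_eq_iff[OF x keys_simple_comb[OF y(1)]] by blast
  then have "cpair (vchar x) (rchar (rep l)) = cpair (vchar (simple_comb y)) (rchar (rep l))"
    by (simp add: cpair_def)
  then show ?thesis using cpair_simple_comb[OF y(1) l] y(2) by simp
qed

text \<open>Existence is the reduction to simple classes. For uniqueness, the pairing determines the
  coefficients at simple classes, and membership in \<open>int_coeffs\<close> makes all others
  zero.\<close>

lemma coefficients_exist:
  fixes M :: "(('g mrep \<Rightarrow>\<^sub>0 int) set, 'x) ring_scheme"
  assumes M: "monoid.truncate (add_monoid M) = groth_group H \<alpha>" and x: "Poly_Mapping.keys x \<subseteq> proj_reps H \<alpha>"
  shows "\<exists>!c. c \<in> int_coeffs S \<and> groth_coset H \<alpha> x = int_lincomb M (groth_class H \<alpha>) c"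
proof (rule ex_ex1I)
  obtain y where y: "Poly_Mapping.keys y \<subseteq> S" "x - simple_comb y \<in> R" using decomposition x by blast
  then have "groth_coset H \<alpha> x = groth_coset H \<alpha> (simple_comb y)"
    using groth_coset_eq_iff[OF x keys_simple_comb[OF y(1)]] vchar_R[OF y(2)] by simp
  with y(1) have "groth_coset H \<alpha> x = int_lincomb M (groth_class H \<alpha>) (Poly_Mapping.lookup y)"
    by (simp add: int_lincomb_groth_class[OF M])
  with y(1) show "\<exists>c. c \<in> int_coeffs S \<and> groth_coset H \<alpha> x = int_lincomb M (groth_class H \<alpha>) c"
    unfolding int_coeffs_eq by blast
next
  fix c d
  assume c: "c \<in> int_coeffs S \<and> groth_coset H \<alpha> x = int_lincomb M (groth_class H \<alpha>) c"
    and d: "d \<in> int_coeffs S \<and> groth_coset H \<alpha> x = int_lincomb M (groth_class H \<alpha>) d"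
  show "c = d"
  proof
    fix l
    show "c l = d l"
    proof (cases "l \<in> S")
      case True
      then have "(of_int (c l) :: complex) = of_int (d l)"
        using coefficients_unique[OF M x] c d by metis
      then show ?thesis by simp
    next
      case False
      then have "c l = 0" "d l = 0" using c d by (auto simp: int_coeffs_def)
      then show ?thesis by simp
    qed
  qed
qed

text \<open>\<open>M\<close> is any structure with this additive group, so the same result serves
  the representation ring and the module.\<close>

lemma int_basis_groth:
  fixes M :: "(('g mrep \<Rightarrow>\<^sub>0 int) set, 'x) ring_scheme"
  assumes M: "monoid.truncate (add_monoid M) = groth_group H \<alpha>"
  shows "int_basis M S (groth_class H \<alpha>)"
proof -
  have cM: "carrier M = carrier (groth_group H \<alpha>)" using arg_cong[OF M, of carrier] by (simp add: monoid.truncate_def)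
  have "groth_class H \<alpha> k \<in> carrier M" if "k \<in> S" for k
    using rep_in_proj_reps[OF that] by (simp add: cM groth_class_eq[OF that])
  moreover have "\<exists>!c. c \<in> int_coeffs S \<and> A = int_lincomb M (groth_class H \<alpha>) c" if A: "A \<in> carrier M" for A
  proof -
    obtain x where "A = groth_coset H \<alpha> x" "Poly_Mapping.keys x \<subseteq> proj_reps H \<alpha>"
      using A unfolding cM carrier_groth_group by auto
    then show ?thesis using coefficients_exist[OF M] by simp
  qed
  ultimately show ?thesis unfolding int_basis_def by (intro conjI funcsetI ballI) assumption+
qed

lemma coord_groth:
  fixes M :: "(('g mrep \<Rightarrow>\<^sub>0 int) set, 'x) ring_scheme"
  assumes M: "monoid.truncate (add_monoid M) = groth_group H \<alpha>" and x: "Poly_Mapping.keys x \<subseteq> proj_reps H \<alpha>" and l: "l \<in> S"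
  shows "of_int (coord M S (groth_class H \<alpha>) (groth_coset H \<alpha> x) l) = cpair (vchar x) (rchar (rep l))"
  using theI'[OF coefficients_exist[OF M x]] unfolding coord_def
  by (intro coefficients_unique[OF M x _ _ l]) blast+

text \<open>The pairing has no visible sign; it is compared with its value on the nonnegative
  combination to which the representation reduces.\<close>

lemma coord_groth_nonneg:
  fixes M :: "(('g mrep \<Rightarrow>\<^sub>0 int) set, 'x) ring_scheme"
  assumes M: "monoid.truncate (add_monoid M) = groth_group H \<alpha>" and X: "X \<in> proj_reps H \<alpha>" and l: "l \<in> S"
  shows "coord M S (groth_class H \<alpha>) (groth_coset H \<alpha> (frag_of X)) l \<ge> 0"
proof -
  obtain y where y: "Poly_Mapping.keys y \<subseteq> S" "\<And>k. Poly_Mapping.lookup y k \<ge> 0" "frag_of X - simple_comb y \<in> R"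
    using rep_decomposition[OF X] by blast
  have "\<forall>g\<in>carrier H. vchar (frag_of X) g = vchar (simple_comb y) g" using vchar_R[OF y(3)] by simp
  then have "cpair (vchar (frag_of X)) (rchar (rep l)) = cpair (vchar (simple_comb y)) (rchar (rep l))"
    by (simp add: cpair_def)
  then have "(of_int (coord M S (groth_class H \<alpha>) (groth_coset H \<alpha> (frag_of X)) l) :: complex) = of_int (Poly_Mapping.lookup y l)"
    using coord_groth[OF M _ l, of "frag_of X"] cpair_simple_comb[OF y(1) l] X by simp
  then show ?thesis using y(2) by (simp only: of_int_eq_iff)
qed

end

section \<open>The representation ring and its modules\<close>

lemma rchar_tensor_rep:
  assumes "snd V g \<in> carrier_mat (fst V) (fst V)" "snd N g \<in> carrier_mat (fst N) (fst N)"
  shows "rchar (tensor_rep V N) g = rchar V g * rchar N g"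
  using mtrace_kronecker[OF assms] by (simp add: rchar_def tensor_rep_def)

lemma rchar_unit_rep: "rchar unit_rep g = 1"
  by (simp add: rchar_def unit_rep_def)

context finite_group_cocycle
begin

section \<open>Tensor products and products of cosets\<close>

lemma trivial_cocycle_locale: "finite_group_cocycle H trivial_cocycle"
  by unfold_locales (simp_all add: finite_carrier cocycle2_def)

text \<open>Multipliers multiply under Kronecker products, so tensoring with an ordinary
  representation leaves \<open>\<alpha>\<close> unchanged.\<close>

lemma tensor_rep_closed:
  assumes V: "V \<in> proj_reps H trivial_cocycle" and N: "N \<in> proj_reps H \<alpha>"
  shows "tensor_rep V N \<in> proj_reps H \<alpha>"
proof -
  interpret T: finite_group_cocycle H trivial_cocycle by (rule trivial_cocycle_locale)
  show ?thesis
  proof (rule proj_repsI)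
    fix g assume g: "g \<in> carrier H"
    note vg = T.rep_carrier[OF V g] and ng = rep_carrier[OF N g]
    show "snd (tensor_rep V N) g \<in> carrier_mat (fst (tensor_rep V N)) (fst (tensor_rep V N))"
      using kronecker_carrier[OF vg ng] by (simp add: tensor_rep_def)
    fix h assume h: "h \<in> carrier H"
    have "kronecker (snd V g) (snd N g) * kronecker (snd V h) (snd N h) =
        kronecker (1 \<cdot>\<^sub>m snd V (g \<otimes> h)) (\<alpha> g h \<cdot>\<^sub>m snd N (g \<otimes> h))"
      unfolding kronecker_mult[OF vg ng T.rep_carrier[OF V h] rep_carrier[OF N h]] T.rep_mult[OF V g h] rep_mult[OF N g h] ..
    then show "snd (tensor_rep V N) g * snd (tensor_rep V N) h = \<alpha> g h \<cdot>\<^sub>m snd (tensor_rep V N) (g \<otimes> h)"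
      unfolding kronecker_smult by (simp add: tensor_rep_def)
  next
    show "snd (tensor_rep V N) \<one> = \<alpha> \<one> \<one> \<cdot>\<^sub>m 1\<^sub>m (fst (tensor_rep V N))"
      unfolding tensor_rep_def snd_conv fst_conv rep_one[OF N] T.rep_one[OF V] kronecker_smult kronecker_one by simp
  qed
qed

text \<open>All representatives give products with the same character, so the union over them is a
  single coset. The sets \<open>A\<close> and \<open>P\<close> are left general because in the
  module action the first factor is a coset for the larger group, of which only character values on
  the subgroup matter.\<close>

lemma groth_coset_product:
  assumes x: "x \<in> A" and y: "y \<in> B"
    and A: "\<And>a. a \<in> A \<Longrightarrow> Poly_Mapping.keys a \<subseteq> P \<and> (\<forall>g\<in>carrier H. vchar a g = vchar x g)"
    and B: "\<And>b. b \<in> B \<Longrightarrow> Poly_Mapping.keys b \<subseteq> Q \<and> (\<forall>g\<in>carrier H. vchar b g = vchar y g)"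
    and t: "\<And>V N. V \<in> P \<Longrightarrow> N \<in> Q \<Longrightarrow> t V N \<in> proj_reps H \<alpha>"
    and tchar: "\<And>V N g. V \<in> P \<Longrightarrow> N \<in> Q \<Longrightarrow> g \<in> carrier H \<Longrightarrow> rchar (t V N) g = rchar V g * rchar N g"
  shows "(\<Union>a\<in>A. \<Union>b\<in>B. groth_coset H \<alpha> (bilinear_ext t a b)) = groth_coset H \<alpha> (bilinear_ext t x y)"
    and "Poly_Mapping.keys (bilinear_ext t x y) \<subseteq> proj_reps H \<alpha>"
    and "\<And>g. g \<in> carrier H \<Longrightarrow> vchar (bilinear_ext t x y) g = vchar x g * vchar y g"
proof -
  have keys: "Poly_Mapping.keys (bilinear_ext t a b) \<subseteq> proj_reps H \<alpha>" if "a \<in> A" "b \<in> B" for a b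
    using A[OF that(1)] B[OF that(2)] t by (intro keys_bilinear_ext_subset) blast
  have char: "vchar (bilinear_ext t a b) g = vchar a g * vchar b g" if "a \<in> A" "b \<in> B" "g \<in> carrier H" for a b g
    using A[OF that(1)] B[OF that(2)] tchar that(3) by (intro vchar_bilinear_ext) blast
  show "Poly_Mapping.keys (bilinear_ext t x y) \<subseteq> proj_reps H \<alpha>" by (rule keys[OF x y])
  show "vchar (bilinear_ext t x y) g = vchar x g * vchar y g" if "g \<in> carrier H" for g by (rule char[OF x y that])
  have "groth_coset H \<alpha> (bilinear_ext t a b) = groth_coset H \<alpha> (bilinear_ext t x y)" if "a \<in> A" "b \<in> B" for a b
    unfolding groth_coset_eq_iff[OF keys[OF that] keys[OF x y]]
    using char that x y A[OF that(1)] B[OF that(2)] by simp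
  then show "(\<Union>a\<in>A. \<Union>b\<in>B. groth_coset H \<alpha> (bilinear_ext t a b)) = groth_coset H \<alpha> (bilinear_ext t x y)"
    using x y by blast
qed

lemma abelian_group_groth:
  fixes M :: "(('g mrep \<Rightarrow>\<^sub>0 int) set, 'x) ring_scheme"
  assumes M: "monoid.truncate (add_monoid M) = groth_group H \<alpha>"
  shows "abelian_group M"
proof -
  interpret D: comm_group "groth_group H \<alpha>" by (rule comm_group_groth_group)
  have eqs: "carrier M = carrier (groth_group H \<alpha>)" "add M = monoid.mult (groth_group H \<alpha>)" "zero M = \<one>\<^bsub>groth_group H \<alpha>\<^esub>"
    using arg_cong[OF M, of carrier] arg_cong[OF M, of monoid.mult] arg_cong[OF M, of one]
    by (simp_all add: monoid.truncate_def)
  show ?thesis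
    by (rule abelian_groupI) (simp_all add: eqs D.m_ac D.l_inv_ex)
qed

end

section \<open>Dual representations\<close>

locale finite_group = finite_group_cocycle H trivial_cocycle for H :: "('g, 'b) monoid_scheme" (structure)
begin

text \<open>Inversion and transposition each reverse the order of products, so together they
  preserve it.\<close>

lemma dual_rep_closed:
  assumes X: "X \<in> proj_reps H trivial_cocycle"
  shows "dual_rep H X \<in> proj_reps H trivial_cocycle"
proof (rule proj_repsI)
  fix g assume g: "g \<in> carrier H"
  note xg = rep_carrier[OF X inv_closed[OF g]]
  show "snd (dual_rep H X) g \<in> carrier_mat (fst (dual_rep H X)) (fst (dual_rep H X))"
    using xg by (simp add: dual_rep_def)
  fix h assume h: "h \<in> carrier H"
  note xh = rep_carrier[OF X inv_closed[OF h]]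
  have "(snd X (inv g))\<^sup>T * (snd X (inv h))\<^sup>T = (snd X (inv h) * snd X (inv g))\<^sup>T"
    by (rule transpose_mult[OF xh xg, symmetric])
  also have "snd X (inv h) * snd X (inv g) = 1 \<cdot>\<^sub>m snd X (inv (g \<otimes> h))"
    using rep_mult[OF X inv_closed[OF h] inv_closed[OF g]] g h by (simp add: inv_mult_group)
  also have "(1 \<cdot>\<^sub>m snd X (inv (g \<otimes> h)))\<^sup>T = 1 \<cdot>\<^sub>m (snd X (inv (g \<otimes> h)))\<^sup>T" by (intro eq_matI) simp_all
  finally show "snd (dual_rep H X) g * snd (dual_rep H X) h = 1 \<cdot>\<^sub>m snd (dual_rep H X) (g \<otimes> h)"
    by (simp add: dual_rep_def)
next
  have "(snd X \<one>)\<^sup>T = 1 \<cdot>\<^sub>m 1\<^sub>m (fst X)" unfolding rep_one[OF X] by (intro eq_matI) auto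
  then show "snd (dual_rep H X) \<one> = 1 \<cdot>\<^sub>m 1\<^sub>m (fst (dual_rep H X))" by (simp add: dual_rep_def)
qed

lemma rchar_dual_rep: "X \<in> proj_reps H trivial_cocycle \<Longrightarrow> g \<in> carrier H \<Longrightarrow> rchar (dual_rep H X) g = rchar X (inv g)"
  using mtrace_transpose[OF rep_carrier, of X "inv g"] by (simp add: rchar_def dual_rep_def)

lemma transpose_intertwiner:
  assumes X: "X \<in> proj_reps H trivial_cocycle" and Y: "Y \<in> proj_reps H trivial_cocycle"
    and A: "A \<in> intertwiners H X Y"
  shows "A\<^sup>T \<in> intertwiners H (dual_rep H Y) (dual_rep H X)"
proof (rule intertwinersI)
  note Ac = intertwinersD(1)[OF A]
  show "A\<^sup>T \<in> carrier_mat (fst (dual_rep H X)) (fst (dual_rep H Y))" using Ac by (simp add: dual_rep_def)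
  fix g assume "g \<in> carrier H"
  then have g: "inv g \<in> carrier H" by simp
  have "A\<^sup>T * (snd Y (inv g))\<^sup>T = (snd Y (inv g) * A)\<^sup>T" by (rule transpose_mult[OF rep_carrier[OF Y g] Ac, symmetric])
  also have "\<dots> = (A * snd X (inv g))\<^sup>T" using intertwinersD(2)[OF A g] by simp
  also have "\<dots> = (snd X (inv g))\<^sup>T * A\<^sup>T" by (rule transpose_mult[OF Ac rep_carrier[OF X g]])
  finally show "A\<^sup>T * snd (dual_rep H Y) g = snd (dual_rep H X) g * A\<^sup>T" by (simp add: dual_rep_def)
qed

lemma isomorphic_dual:
  assumes X: "X \<in> proj_reps H trivial_cocycle" and Y: "Y \<in> proj_reps H trivial_cocycle" and iso: "isomorphic X Y"
  shows "isomorphic (dual_rep H Y) (dual_rep H X)"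
proof -
  let ?n = "fst X"
  obtain A B where n: "fst X = fst Y" and A: "A \<in> intertwiners H X Y" and B: "B \<in> carrier_mat ?n ?n"
    and AB: "A * B = 1\<^sub>m ?n" "B * A = 1\<^sub>m ?n" using isomorphicE[OF iso] .
  have Ac: "A \<in> carrier_mat ?n ?n" using intertwinersD(1)[OF A] n by simp
  have "A\<^sup>T * B\<^sup>T = 1\<^sub>m ?n" using transpose_mult[OF B Ac] AB by simp
  then have "invertible_mat (A\<^sup>T)" using Ac B by (intro invertible_matI[of _ ?n "B\<^sup>T"]) auto
  with transpose_intertwiner[OF X Y A] show ?thesis by (auto simp: isomorphic_def)
qed

text \<open>On the group the double dual has the same matrices, so the identity intertwines. Off the
  group the two functions may differ, hence isomorphism and not equality.\<close>

lemma isomorphic_dual_dual: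
  assumes X: "X \<in> proj_reps H trivial_cocycle"
  shows "isomorphic (dual_rep H (dual_rep H X)) X"
proof -
  have "1\<^sub>m (fst X) \<in> intertwiners H (dual_rep H (dual_rep H X)) X"
  proof (rule intertwinersI)
    show "1\<^sub>m (fst X) * snd (dual_rep H (dual_rep H X)) g = snd X g * 1\<^sub>m (fst X)" if "g \<in> carrier H" for g
      using left_mult_one_mat[OF rep_carrier[OF X that]] right_mult_one_mat[OF rep_carrier[OF X that]] that
      by (simp add: dual_rep_def)
  qed (simp add: dual_rep_def)
  then show ?thesis using invertible_matI[of "1\<^sub>m (fst X)" "fst X" "1\<^sub>m (fst X)"] by (auto simp: isomorphic_def)
qed

text \<open>A proper nonzero invariant subspace of the dual gives an exact sequence through it with
  maps \<open>A\<close> and \<open>B\<close>. The transpose of \<open>A\<close> is an intertwiner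
  out of the simple \<open>X\<close>, hence injective or zero, and both cases contradict the
  splitting.\<close>

lemma simple_dual_rep:
  assumes simple: "simple_rep H trivial_cocycle X"
  shows "simple_rep H trivial_cocycle (dual_rep H X)"
proof -
  let ?D = "dual_rep H X" and ?n = "fst X"
  note X = simple_imp_rep[OF simple]
  note D = dual_rep_closed[OF X]
  have n: "?n > 0" using simple by (simp add: simple_rep_def)
  have D_n: "fst ?D = ?n" by (simp add: dual_rep_def)
  have irred: "W = {0\<^sub>v (fst ?D)} \<or> W = carrier_vec (fst ?D)"
    if W: "VectorSpace.subspace class_ring W (module_vec TYPE(complex) (fst ?D))"
      and inv: "\<forall>g\<in>carrier H. \<forall>w\<in>W. snd ?D g *\<^sub>v w \<in> W" for W
  proof (rule ccontr)
    assume "\<not> ?thesis"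
    then obtain Y Z where Y: "Y \<in> proj_reps H trivial_cocycle" and Z: "Z \<in> proj_reps H trivial_cocycle"
      and ex: "short_exact H Y ?D Z" and lt: "fst Y < ?n" "fst Z < ?n"
      using invariant_subspace_exact[OF D W] inv D_n by metis
    obtain A B where A: "A \<in> intertwiners H Y ?D" and B: "B \<in> intertwiners H ?D Z"
      and exact: "inj_on ((*\<^sub>v) A) (carrier_vec (fst Y))" "(*\<^sub>v) A ` carrier_vec (fst Y) = mat_kernel B"
        "(*\<^sub>v) B ` carrier_vec (fst ?D) = carrier_vec (fst Z)"
      using ex unfolding short_exact_def by blast
    obtain P C where s: "mat_split (fst ?D) (fst Y) (fst Z) A P B C"
      using mat_split_if_exact[OF intertwinersD(1)[OF A] intertwinersD(1)[OF B] exact] .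
    then have c: "A \<in> carrier_mat ?n (fst Y)" "P \<in> carrier_mat (fst Y) ?n" "B \<in> carrier_mat (fst Z) ?n" "C \<in> carrier_mat ?n (fst Z)"
      and eqs: "P * A = 1\<^sub>m (fst Y)" "B * C = 1\<^sub>m (fst Z)" "B * A = 0\<^sub>m (fst Z) (fst Y)"
      by (auto simp: mat_split_def D_n)
    \<comment> \<open>The two dimensions add up to \<open>?n\<close> and each is smaller than
      \<open>?n\<close>.\<close>
    have dims: "fst Y > 0" "fst Z > 0" using mat_split_dim[OF s] lt D_n by auto
    let ?DY = "dual_rep H Y"
    have DY_n: "fst ?DY = fst Y" by (simp add: dual_rep_def)
    \<comment> \<open>Transposition gives a map out of the double dual, whose matrices on the group
      are those of \<open>X\<close>.\<close>
    have "A\<^sup>T \<in> intertwiners H X ?DY"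
    proof (rule intertwinersI)
      show "A\<^sup>T \<in> carrier_mat (fst ?DY) (fst X)" using c by (simp add: DY_n)
      fix g assume g: "g \<in> carrier H"
      from intertwinersD(2)[OF transpose_intertwiner[OF Y D A] g] g
      show "A\<^sup>T * snd X g = snd ?DY g * A\<^sup>T" by (simp add: dual_rep_def)
    qed
    from intertwiner_kernel_simple[OF X dual_rep_closed[OF Y] this simple]
    show False
    proof
      \<comment> \<open>The transpose of \<open>B\<close> has its values in this trivial kernel
        because \<open>B * A = 0\<close>. So \<open>B\<close> is zero, which is incompatible with
        \<open>B * C = 1\<close> in positive dimension.\<close>
      assume ker: "\<forall>v\<in>carrier_vec ?n. A\<^sup>T *\<^sub>v v = 0\<^sub>v (fst ?DY) \<longrightarrow> v = 0\<^sub>v ?n"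
      have AB: "A\<^sup>T * B\<^sup>T = 0\<^sub>m (fst Y) (fst Z)" using transpose_mult[OF c(3,1)] eqs by simp
      have "B\<^sup>T = 0\<^sub>m ?n (fst Z)"
      proof (rule mat_eq_if_mult_vec_eq)
        fix v :: "complex vec" assume v: "v \<in> carrier_vec (fst Z)"
        have "A\<^sup>T *\<^sub>v (B\<^sup>T *\<^sub>v v) = A\<^sup>T * B\<^sup>T *\<^sub>v v"
          using c v by (intro assoc_mult_mat_vec[of _ "fst Y" ?n _ "fst Z", symmetric]) auto
        then have "B\<^sup>T *\<^sub>v v = 0\<^sub>v ?n" using ker v c AB DY_n by simp
        then show "B\<^sup>T *\<^sub>v v = 0\<^sub>m ?n (fst Z) *\<^sub>v v" using v by simp
      qed (use c in auto)
      then have "(B\<^sup>T)\<^sup>T = (0\<^sub>m ?n (fst Z))\<^sup>T" by (rule arg_cong)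
      then have "B = 0\<^sub>m (fst Z) ?n" by simp
      then have "1\<^sub>m (fst Z) = 0\<^sub>m (fst Z) (fst Z) * (1\<^sub>m (fst Z) :: complex mat)" using eqs c by simp
      then have "(1\<^sub>m (fst Z) :: complex mat) $$ (0, 0) = 0\<^sub>m (fst Z) (fst Z) $$ (0, 0)" by simp
      with dims show False by simp
    next
      \<comment> \<open>Here \<open>A\<close> itself is zero, incompatible with
        \<open>P * A = 1\<close> in positive dimension.\<close>
      assume "A\<^sup>T = 0\<^sub>m (fst ?DY) ?n"
      then have "(A\<^sup>T)\<^sup>T = (0\<^sub>m (fst Y) ?n)\<^sup>T" unfolding DY_n by (rule arg_cong)
      then have "A = 0\<^sub>m ?n (fst Y)" by simp
      then have "1\<^sub>m (fst Y) = 0\<^sub>m (fst Y) (fst Y) * (1\<^sub>m (fst Y) :: complex mat)" using eqs c by simp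
      then have "(1\<^sub>m (fst Y) :: complex mat) $$ (0, 0) = 0\<^sub>m (fst Y) (fst Y) $$ (0, 0)" by simp
      with dims show False by simp
    qed
  qed
  show ?thesis unfolding simple_rep_def
  proof (intro conjI allI impI)
    show "?D \<in> proj_reps H trivial_cocycle" by (rule D)
    show "fst ?D > 0" using n D_n by simp
  qed (use irred in blast)
qed

text \<open>Isomorphic representations have isomorphic duals, so every member of the union in
  \<open>dual_class\<close> is the same class.\<close>

lemma dual_class_iso_class:
  assumes X: "X \<in> proj_reps H trivial_cocycle"
  shows "dual_class H (iso_class H trivial_cocycle X) = iso_class H trivial_cocycle (dual_rep H X)"
proof -
  have "iso_class H trivial_cocycle (dual_rep H Y) = iso_class H trivial_cocycle (dual_rep H X)"
    if "Y \<in> iso_class H trivial_cocycle X" for Y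
  proof -
    have Y: "Y \<in> proj_reps H trivial_cocycle" "isomorphic X Y" using that mem_iso_class by blast+
    show ?thesis
      unfolding iso_class_eq_iff[OF dual_rep_closed[OF Y(1)] dual_rep_closed[OF X]]
      by (rule isomorphic_dual[OF X Y])
  qed
  moreover have "X \<in> iso_class H trivial_cocycle X" using X isomorphic_refl mem_iso_class by blast
  ultimately show ?thesis unfolding dual_class_def by blast
qed

lemma dual_class_eq:
  assumes "i \<in> S"
  shows "dual_class H i = iso_class H trivial_cocycle (dual_rep H (rep i))"
  using dual_class_iso_class[OF rep_in_proj_reps[OF assms]] rep_of_class(2)[OF assms] by simp

lemma dual_class_closed:
  assumes "i \<in> S"
  shows "dual_class H i \<in> S"
  using simple_dual_rep[OF rep_of_class(1)[OF assms]] unfolding dual_class_eq[OF assms] simple_classes_def by blast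

lemma dual_class_involutive:
  assumes i: "i \<in> S"
  shows "dual_class H (dual_class H i) = i"
proof -
  note X = rep_in_proj_reps[OF i]
  have "dual_class H (dual_class H i) = iso_class H trivial_cocycle (dual_rep H (dual_rep H (rep i)))"
    unfolding dual_class_eq[OF i] by (rule dual_class_iso_class[OF dual_rep_closed[OF X]])
  also have "\<dots> = iso_class H trivial_cocycle (rep i)"
    using iso_class_eq_iff[OF dual_rep_closed[OF dual_rep_closed[OF X]] X] isomorphic_dual_dual[OF X] by simp
  also have "\<dots> = i" by (rule rep_of_class(2)[OF i])
  finally show ?thesis .
qed

lemma rchar_dual_class:
  assumes i: "i \<in> S" and g: "g \<in> carrier H"
  shows "rchar (rep (dual_class H i)) g = rchar (rep i) (inv g)"
proof -
  note j = dual_class_closed[OF i]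
  have "isomorphic (rep (dual_class H i)) (dual_rep H (rep i))"
    using iso_class_eq_iff[OF rep_in_proj_reps[OF j] dual_rep_closed[OF rep_in_proj_reps[OF i]]]
      rep_of_class(2)[OF j] dual_class_eq[OF i] by simp
  then have "rchar (rep (dual_class H i)) g = rchar (dual_rep H (rep i)) g"
    by (rule isomorphic_rchar[OF rep_in_proj_reps[OF j] dual_rep_closed[OF rep_in_proj_reps[OF i]] _ g])
  then show ?thesis using rchar_dual_rep[OF rep_in_proj_reps[OF i] g] by simp
qed

section \<open>The representation ring\<close>

lemma truncate_rep_ring: "monoid.truncate (add_monoid (rep_ring H)) = groth_group H trivial_cocycle"
  by (simp add: monoid.truncate_def rep_ring_def)

lemma carrier_rep_ringE:
  assumes "A \<in> carrier (rep_ring H)"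
  obtains x where "Poly_Mapping.keys x \<subseteq> proj_reps H trivial_cocycle" "A = groth_coset H trivial_cocycle x"
  using assms by (auto simp: rep_ring_def carrier_groth_group)

lemma rep_ring_add:
  "Poly_Mapping.keys x \<subseteq> proj_reps H trivial_cocycle \<Longrightarrow> Poly_Mapping.keys y \<subseteq> proj_reps H trivial_cocycle \<Longrightarrow>
    groth_coset H trivial_cocycle x \<oplus>\<^bsub>rep_ring H\<^esub> groth_coset H trivial_cocycle y = groth_coset H trivial_cocycle (x + y)"
  by (simp add: rep_ring_def groth_coset_add)

text \<open>The three facts are used together: the first exposes a representative of the product,
  the second permits comparison of cosets by characters, and the third evaluates the
  character.\<close>

lemma rep_ring_mult:
  assumes x: "Poly_Mapping.keys x \<subseteq> proj_reps H trivial_cocycle" and y: "Poly_Mapping.keys y \<subseteq> proj_reps H trivial_cocycle"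
  shows "groth_coset H trivial_cocycle x \<otimes>\<^bsub>rep_ring H\<^esub> groth_coset H trivial_cocycle y =
      groth_coset H trivial_cocycle (bilinear_ext tensor_rep x y)" (is ?mult)
    and "Poly_Mapping.keys (bilinear_ext tensor_rep x y) \<subseteq> proj_reps H trivial_cocycle" (is ?keys)
    and "\<And>g. g \<in> carrier H \<Longrightarrow> vchar (bilinear_ext tensor_rep x y) g = vchar x g * vchar y g"
proof -
  let ?P = "proj_reps H trivial_cocycle"
  have m: "z \<in> groth_coset H trivial_cocycle z" if "Poly_Mapping.keys z \<subseteq> ?P" for z
    using that by (simp add: mem_groth_coset)
  have t: "tensor_rep V N \<in> ?P" "g \<in> carrier H \<Longrightarrow> rchar (tensor_rep V N) g = rchar V g * rchar N g"
    if "V \<in> ?P" "N \<in> ?P" for V N g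
    using that by (simp_all add: tensor_rep_closed rchar_tensor_rep rep_carrier)
  note prod = groth_coset_product[OF m[OF x] m[OF y] iffD1[OF mem_groth_coset[OF x]] iffD1[OF mem_groth_coset[OF y]] t]
  show ?mult using prod(1) by (simp add: rep_ring_def)
  show ?keys by (rule prod(2))
  show "\<And>g. g \<in> carrier H \<Longrightarrow> vchar (bilinear_ext tensor_rep x y) g = vchar x g * vchar y g" by (rule prod(3))
qed

lemma unit_rep_closed: "unit_rep \<in> proj_reps H trivial_cocycle"
  by (rule proj_repsI) (auto simp: unit_rep_def)

lemma cring_rep_ring: "cring (rep_ring H)"
proof (rule cringI)
  let ?P = "proj_reps H trivial_cocycle" and ?c = "groth_coset H trivial_cocycle"
  have one: "\<one>\<^bsub>rep_ring H\<^esub> = ?c (frag_of unit_rep)" by (simp add: rep_ring_def)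
  have u: "Poly_Mapping.keys (frag_of unit_rep) \<subseteq> ?P" using unit_rep_closed by simp
  have cl: "?c x \<in> carrier (rep_ring H)" if "Poly_Mapping.keys x \<subseteq> ?P" for x using that by (simp add: rep_ring_def)
  show "abelian_group (rep_ring H)" by (rule abelian_group_groth[OF truncate_rep_ring])
  show "comm_monoid (rep_ring H)"
  proof (rule comm_monoidI)
    fix A B assume "A \<in> carrier (rep_ring H)" "B \<in> carrier (rep_ring H)"
    then obtain x y where x: "Poly_Mapping.keys x \<subseteq> ?P" "A = ?c x" and y: "Poly_Mapping.keys y \<subseteq> ?P" "B = ?c y"
      by (elim carrier_rep_ringE)
    note xy = rep_ring_mult[OF x(1) y(1)] and yx = rep_ring_mult[OF y(1) x(1)]
    show "A \<otimes>\<^bsub>rep_ring H\<^esub> B \<in> carrier (rep_ring H)" using cl[OF xy(2)] xy(1) x y by simp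
    show "A \<otimes>\<^bsub>rep_ring H\<^esub> B = B \<otimes>\<^bsub>rep_ring H\<^esub> A"
      unfolding x(2) y(2) xy(1) yx(1) groth_coset_eq_iff[OF xy(2) yx(2)] by (simp add: xy(3) yx(3))
    fix C assume "C \<in> carrier (rep_ring H)"
    then obtain z where z: "Poly_Mapping.keys z \<subseteq> ?P" "C = ?c z" by (elim carrier_rep_ringE)
    note yz = rep_ring_mult[OF y(1) z(1)]
    note xy_z = rep_ring_mult[OF xy(2) z(1)] and x_yz = rep_ring_mult[OF x(1) yz(2)]
    show "A \<otimes>\<^bsub>rep_ring H\<^esub> B \<otimes>\<^bsub>rep_ring H\<^esub> C = A \<otimes>\<^bsub>rep_ring H\<^esub> (B \<otimes>\<^bsub>rep_ring H\<^esub> C)"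
      unfolding x(2) y(2) z(2) xy(1) yz(1) xy_z(1) x_yz(1) groth_coset_eq_iff[OF xy_z(2) x_yz(2)]
      by (simp add: xy(3) yz(3) xy_z(3) x_yz(3))
  next
    show "\<one>\<^bsub>rep_ring H\<^esub> \<in> carrier (rep_ring H)" unfolding one by (rule cl[OF u])
    fix A assume "A \<in> carrier (rep_ring H)"
    then obtain x where x: "Poly_Mapping.keys x \<subseteq> ?P" "A = ?c x" by (elim carrier_rep_ringE)
    note ux = rep_ring_mult[OF u x(1)]
    show "\<one>\<^bsub>rep_ring H\<^esub> \<otimes>\<^bsub>rep_ring H\<^esub> A = A"
      unfolding one x(2) ux(1) groth_coset_eq_iff[OF ux(2) x(1)] by (simp add: ux(3) rchar_unit_rep)
  qed
  fix A B C assume "A \<in> carrier (rep_ring H)" "B \<in> carrier (rep_ring H)" "C \<in> carrier (rep_ring H)"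
  then obtain x y z where x: "Poly_Mapping.keys x \<subseteq> ?P" "A = ?c x" and y: "Poly_Mapping.keys y \<subseteq> ?P" "B = ?c y"
    and z: "Poly_Mapping.keys z \<subseteq> ?P" "C = ?c z" by (elim carrier_rep_ringE)
  have xy: "Poly_Mapping.keys (x + y) \<subseteq> ?P" using x(1) y(1) Poly_Mapping.keys_add[of x y] by blast
  note l = rep_ring_mult[OF xy z(1)] and xz = rep_ring_mult[OF x(1) z(1)] and yz = rep_ring_mult[OF y(1) z(1)]
  have r: "Poly_Mapping.keys (bilinear_ext tensor_rep x z + bilinear_ext tensor_rep y z) \<subseteq> ?P"
    using xz(2) yz(2) Poly_Mapping.keys_add[of "bilinear_ext tensor_rep x z" "bilinear_ext tensor_rep y z"] by blast
  show "(A \<oplus>\<^bsub>rep_ring H\<^esub> B) \<otimes>\<^bsub>rep_ring H\<^esub> C = A \<otimes>\<^bsub>rep_ring H\<^esub> C \<oplus>\<^bsub>rep_ring H\<^esub> B \<otimes>\<^bsub>rep_ring H\<^esub> C"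
    unfolding x(2) y(2) z(2) rep_ring_add[OF x(1) y(1)] l(1) xz(1) yz(1) rep_ring_add[OF xz(2) yz(2)]
      groth_coset_eq_iff[OF l(2) r]
    by (simp add: l(3) xz(3) yz(3) algebra_simps)
qed

end

section \<open>Restriction to the subgroup and the module structure\<close>

locale subgroup_cocycle = G: finite_group G + K: finite_group_cocycle "G\<lparr>carrier := H\<rparr>" \<alpha>
  for G :: "('g, 'b) monoid_scheme" (structure) and H \<alpha> +
  assumes subgroup: "subgroup H G"
begin

abbreviation K where "K \<equiv> G\<lparr>carrier := H\<rparr>"
abbreviation M where "M \<equiv> twisted_rep_module G H \<alpha>"
abbreviation tens where "tens \<equiv> \<lambda>V N. tensor_rep (res_rep H V) N"
abbreviation PG where "PG \<equiv> proj_reps G trivial_cocycle"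
abbreviation PK where "PK \<equiv> proj_reps K \<alpha>"

text \<open>Inverses in \<open>K\<close> are defined relative to the carrier \<open>H\<close>. Their
  agreement with those of \<open>G\<close> is what relates dual characters of \<open>G\<close> to
  the pairing over the subgroup.\<close>

lemma inv_K: "h \<in> H \<Longrightarrow> inv\<^bsub>K\<^esub> h = inv h"
  using G.m_inv_consistent[OF subgroup] by simp

lemma H_subset: "h \<in> H \<Longrightarrow> h \<in> carrier G"
  using subgroup.mem_carrier[OF subgroup] .

lemma res_rep_closed: "V \<in> PG \<Longrightarrow> res_rep H V \<in> proj_reps K trivial_cocycle"
  using H_subset subgroup.m_closed[OF subgroup] by (auto simp: proj_reps_def res_rep_def)

lemma tens_closed: "V \<in> PG \<Longrightarrow> N \<in> PK \<Longrightarrow> tens V N \<in> PK"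
  by (intro K.tensor_rep_closed res_rep_closed)

lemma rchar_tens:
  assumes V: "V \<in> PG" and N: "N \<in> PK" and g: "g \<in> H"
  shows "rchar (tens V N) g = rchar V g * rchar N g"
proof -
  have "rchar (tens V N) g = rchar (res_rep H V) g * rchar N g"
    using G.rep_carrier[OF V H_subset[OF g]] K.rep_carrier[OF N] g
    by (intro rchar_tensor_rep) (simp_all add: res_rep_def)
  then show ?thesis using g by (simp add: rchar_def res_rep_def)
qed

lemma truncate_module: "monoid.truncate (add_monoid M) = groth_group K \<alpha>"
  by (simp add: monoid.truncate_def twisted_rep_module_def Let_def)

lemma carrier_moduleE:
  assumes "A \<in> carrier M"
  obtains x where "Poly_Mapping.keys x \<subseteq> PK" "A = groth_coset K \<alpha> x"
  using assms by (auto simp: twisted_rep_module_def Let_def K.carrier_groth_group)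

lemma module_add:
  "Poly_Mapping.keys x \<subseteq> PK \<Longrightarrow> Poly_Mapping.keys y \<subseteq> PK \<Longrightarrow>
    groth_coset K \<alpha> x \<oplus>\<^bsub>M\<^esub> groth_coset K \<alpha> y = groth_coset K \<alpha> (x + y)"
  by (simp add: twisted_rep_module_def Let_def K.groth_coset_add)

lemma module_smult:
  assumes x: "Poly_Mapping.keys x \<subseteq> PG" and y: "Poly_Mapping.keys y \<subseteq> PK"
  shows "groth_coset G trivial_cocycle x \<odot>\<^bsub>M\<^esub> groth_coset K \<alpha> y = groth_coset K \<alpha> (bilinear_ext tens x y)" (is ?mult)
    and "Poly_Mapping.keys (bilinear_ext tens x y) \<subseteq> PK" (is ?keys)
    and "\<And>g. g \<in> H \<Longrightarrow> vchar (bilinear_ext tens x y) g = vchar x g * vchar y g"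
proof -
  have mx: "x \<in> groth_coset G trivial_cocycle x" using x by (simp add: G.mem_groth_coset)
  have my: "y \<in> groth_coset K \<alpha> y" using y by (simp add: K.mem_groth_coset)
  \<comment> \<open>Representatives of a coset for \<open>G\<close> have equal characters on all of
    \<open>G\<close>, in particular on the subgroup; this makes the action well defined.\<close>
  have A: "Poly_Mapping.keys a \<subseteq> PG \<and> (\<forall>g\<in>carrier K. vchar a g = vchar x g)"
    if "a \<in> groth_coset G trivial_cocycle x" for a
    using that H_subset by (simp add: G.mem_groth_coset[OF x])
  have t: "rchar (tens V N) g = rchar V g * rchar N g" if "V \<in> PG" "N \<in> PK" "g \<in> carrier K" for V N g
    using rchar_tens that by simp
  note prod = K.groth_coset_product[OF mx my A iffD1[OF K.mem_groth_coset[OF y]] tens_closed t]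
  show ?mult using prod(1) by (simp add: twisted_rep_module_def Let_def)
  show ?keys by (rule prod(2))
  show "\<And>g. g \<in> H \<Longrightarrow> vchar (bilinear_ext tens x y) g = vchar x g * vchar y g" using prod(3) by simp
qed

lemma module_eq_iff:
  "Poly_Mapping.keys x \<subseteq> PK \<Longrightarrow> Poly_Mapping.keys y \<subseteq> PK \<Longrightarrow>
    groth_coset K \<alpha> x = groth_coset K \<alpha> y \<longleftrightarrow> (\<forall>g\<in>H. vchar x g = vchar y g)"
  using K.groth_coset_eq_iff by simp

lemma module_M: "Module.module (rep_ring G) M"
proof (rule moduleI)
  let ?cG = "groth_coset G trivial_cocycle" and ?cK = "groth_coset K \<alpha>"
  show "cring (rep_ring G)" by (rule G.cring_rep_ring)
  show "abelian_group M" by (rule K.abelian_group_groth[OF truncate_module])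
  have add_keys: "Poly_Mapping.keys (u + v) \<subseteq> Q" if "Poly_Mapping.keys u \<subseteq> Q" "Poly_Mapping.keys v \<subseteq> Q"
    for u v :: "'g mrep \<Rightarrow>\<^sub>0 int" and Q using that Poly_Mapping.keys_add[of u v] by blast
  fix X assume "X \<in> carrier M"
  then obtain x where x: "Poly_Mapping.keys x \<subseteq> PK" "X = ?cK x" by (elim carrier_moduleE)
  have u: "Poly_Mapping.keys (frag_of unit_rep) \<subseteq> PG" using G.unit_rep_closed by simp
  have one: "\<one>\<^bsub>rep_ring G\<^esub> = ?cG (frag_of unit_rep)" by (simp add: rep_ring_def)
  note ux = module_smult[OF u x(1)]
  show "\<one>\<^bsub>rep_ring G\<^esub> \<odot>\<^bsub>M\<^esub> X = X"
    unfolding one x(2) ux(1) module_eq_iff[OF ux(2) x(1)] by (simp add: ux(3) rchar_unit_rep)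
  fix A assume "A \<in> carrier (rep_ring G)"
  then obtain a where a: "Poly_Mapping.keys a \<subseteq> PG" "A = ?cG a" by (elim G.carrier_rep_ringE)
  note ax = module_smult[OF a(1) x(1)]
  show "A \<odot>\<^bsub>M\<^esub> X \<in> carrier M"
    unfolding a(2) x(2) ax(1) using ax(2) by (simp add: twisted_rep_module_def Let_def)
  {
    fix Y assume "Y \<in> carrier M"
    then obtain y where y: "Poly_Mapping.keys y \<subseteq> PK" "Y = ?cK y" by (elim carrier_moduleE)
    note ay = module_smult[OF a(1) y(1)] and axy = module_smult[OF a(1) add_keys[OF x(1) y(1)]]
    show "A \<odot>\<^bsub>M\<^esub> (X \<oplus>\<^bsub>M\<^esub> Y) = A \<odot>\<^bsub>M\<^esub> X \<oplus>\<^bsub>M\<^esub> A \<odot>\<^bsub>M\<^esub> Y"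
      unfolding a(2) x(2) y(2) module_add[OF x(1) y(1)] axy(1) ax(1) ay(1) module_add[OF ax(2) ay(2)]
        module_eq_iff[OF axy(2) add_keys[OF ax(2) ay(2)]]
      by (simp add: axy(3) ax(3) ay(3) algebra_simps)
  }
  fix B assume "B \<in> carrier (rep_ring G)"
  then obtain b where b: "Poly_Mapping.keys b \<subseteq> PG" "B = ?cG b" by (elim G.carrier_rep_ringE)
  note bx = module_smult[OF b(1) x(1)] and ab = G.rep_ring_mult[OF a(1) b(1)]
  note apbx = module_smult[OF add_keys[OF a(1) b(1)] x(1)]
  show "(A \<oplus>\<^bsub>rep_ring G\<^esub> B) \<odot>\<^bsub>M\<^esub> X = A \<odot>\<^bsub>M\<^esub> X \<oplus>\<^bsub>M\<^esub> B \<odot>\<^bsub>M\<^esub> X"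
    unfolding a(2) b(2) x(2) G.rep_ring_add[OF a(1) b(1)] apbx(1) ax(1) bx(1) module_add[OF ax(2) bx(2)]
      module_eq_iff[OF apbx(2) add_keys[OF ax(2) bx(2)]]
    by (simp add: apbx(3) ax(3) bx(3) algebra_simps)
  note abx = module_smult[OF ab(2) x(1)] and a_bx = module_smult[OF a(1) bx(2)]
  show "(A \<otimes>\<^bsub>rep_ring G\<^esub> B) \<odot>\<^bsub>M\<^esub> X = A \<odot>\<^bsub>M\<^esub> (B \<odot>\<^bsub>M\<^esub> X)"
    unfolding a(2) b(2) x(2) ab(1) bx(1) abx(1) a_bx(1) module_eq_iff[OF abx(2) a_bx(2)]
    by (simp add: abx(3) a_bx(3) ab(3) bx(3) H_subset)
qed

section \<open>Structure constants\<close>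

lemma smult_basis:
  assumes i: "i \<in> G.S" and k: "k \<in> K.S"
  shows "groth_class G trivial_cocycle i \<odot>\<^bsub>M\<^esub> groth_class K \<alpha> k =
    groth_coset K \<alpha> (frag_of (tens (G.rep i) (K.rep k)))"
  using module_smult(1)[of "frag_of (G.rep i)" "frag_of (K.rep k)"] G.rep_in_proj_reps[OF i] K.rep_in_proj_reps[OF k]
  by (simp add: G.groth_class_eq[OF i] K.groth_class_eq[OF k] bilinear_ext_def)

lemma tens_rep_closed: "i \<in> G.S \<Longrightarrow> k \<in> K.S \<Longrightarrow> tens (G.rep i) (K.rep k) \<in> PK"
  by (intro tens_closed G.rep_in_proj_reps K.rep_in_proj_reps)

text \<open>A basis element of the ring times one of the module is the class of an actual tensor
  product representation, so its coordinates are nonnegative.\<close>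

lemma struct_const_nonneg:
  assumes i: "i \<in> G.S" and k: "k \<in> K.S" and l: "l \<in> K.S"
  shows "struct_const (groth_class G trivial_cocycle) M K.S (groth_class K \<alpha>) i k l \<ge> 0"
  unfolding struct_const_def smult_basis[OF i k]
  by (rule K.coord_groth_nonneg[OF truncate_module tens_rep_closed[OF i k] l])

lemma struct_const_eq:
  assumes i: "i \<in> G.S" and k: "k \<in> K.S" and l: "l \<in> K.S"
  shows "of_int (struct_const (groth_class G trivial_cocycle) M K.S (groth_class K \<alpha>) i k l) =
    K.cpair (\<lambda>g. rchar (G.rep i) g * rchar (K.rep k) g) (rchar (K.rep l))"
proof -
  have "of_int (struct_const (groth_class G trivial_cocycle) M K.S (groth_class K \<alpha>) i k l) =
      K.cpair (vchar (frag_of (tens (G.rep i) (K.rep k)))) (rchar (K.rep l))"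
    unfolding struct_const_def smult_basis[OF i k] using tens_rep_closed[OF i k]
    by (intro K.coord_groth[OF truncate_module _ l]) simp
  also have "\<dots> = K.cpair (\<lambda>g. rchar (G.rep i) g * rchar (K.rep k) g) (rchar (K.rep l))"
    unfolding K.cpair_def
    by (simp add: rchar_tens[OF G.rep_in_proj_reps[OF i] K.rep_in_proj_reps[OF k]])
  finally show ?thesis .
qed

lemma struct_const_dual:
  assumes i: "i \<in> G.S" and k: "k \<in> K.S" and l: "l \<in> K.S"
  shows "struct_const (groth_class G trivial_cocycle) M K.S (groth_class K \<alpha>) i k l =
    struct_const (groth_class G trivial_cocycle) M K.S (groth_class K \<alpha>) (dual_class G i) l k"
proof -
  let ?a = "rchar (G.rep i)" and ?b = "rchar (K.rep k)" and ?c = "rchar (K.rep l)"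
  have "(\<Sum>g\<in>carrier K. ?a g * ?b g * ?c (inv\<^bsub>K\<^esub> g) / K.\<beta> g) =
      (\<Sum>g\<in>carrier K. ?a (inv\<^bsub>K\<^esub> g) * ?b (inv\<^bsub>K\<^esub> g) * ?c (inv\<^bsub>K\<^esub> (inv\<^bsub>K\<^esub> g)) / K.\<beta> (inv\<^bsub>K\<^esub> g))"
    by (rule K.sum_carrier_inv[symmetric])
  also have "\<dots> = (\<Sum>g\<in>carrier K. rchar (G.rep (dual_class G i)) g * ?c g * ?b (inv\<^bsub>K\<^esub> g) / K.\<beta> g)"
  proof (rule sum.cong[OF refl])
    fix g assume g: "g \<in> carrier K"
    then have "inv\<^bsub>K\<^esub> g = inv g" "g \<in> carrier G" using inv_K H_subset by simp_all
    then have "rchar (G.rep (dual_class G i)) g = ?a (inv\<^bsub>K\<^esub> g)" using G.rchar_dual_class[OF i] by simp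
    then show "?a (inv\<^bsub>K\<^esub> g) * ?b (inv\<^bsub>K\<^esub> g) * ?c (inv\<^bsub>K\<^esub> (inv\<^bsub>K\<^esub> g)) / K.\<beta> (inv\<^bsub>K\<^esub> g) =
        rchar (G.rep (dual_class G i)) g * ?c g * ?b (inv\<^bsub>K\<^esub> g) / K.\<beta> g"
      using K.inv_inv[OF g] K.beta_inv[OF g] by simp
  qed
  \<comment> \<open>The character formulas agree as complex numbers; the integers themselves are
    recovered by injectivity of \<open>of_int\<close>.\<close>
  finally have "(of_int (struct_const (groth_class G trivial_cocycle) M K.S (groth_class K \<alpha>) i k l) :: complex) =
      of_int (struct_const (groth_class G trivial_cocycle) M K.S (groth_class K \<alpha>) (dual_class G i) l k)"
    unfolding struct_const_eq[OF i k l] struct_const_eq[OF G.dual_class_closed[OF i] l k] K.cpair_def by simp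
  then show ?thesis by (simp only: of_int_eq_iff)
qed

lemma based_module_M:
  "based_module (rep_ring G) G.S (groth_class G trivial_cocycle) (dual_class G) M K.S (groth_class K \<alpha>)"
  unfolding based_module_def Zplus_module_def
  using module_M G.int_basis_groth[OF G.truncate_rep_ring] K.int_basis_groth[OF truncate_module]
    struct_const_nonneg struct_const_dual G.dual_class_closed G.dual_class_involutive
  by blast

end

theorem theorem4p3:
  fixes G :: "('g, 'b) monoid_scheme"
    and H :: "'g set"
    and \<alpha> :: "'g \<Rightarrow> 'g \<Rightarrow> complex"
  assumes "group G"
    and "finite (carrier G)"
    and "subgroup H G"
    and "cocycle2 (G\<lparr>carrier := H\<rparr>) \<alpha>"
  shows "based_module
           (rep_ring G)
           (simple_classes G trivial_cocycle)
           (groth_class G trivial_cocycle)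
           (dual_class G)
           (twisted_rep_module G H \<alpha>)
           (simple_classes (G\<lparr>carrier := H\<rparr>) \<alpha>)
           (groth_class (G\<lparr>carrier := H\<rparr>) \<alpha>)"
proof -
  interpret G: group G by (rule assms(1))
  interpret K: group "G\<lparr>carrier := H\<rparr>" by (rule subgroup.subgroup_is_group[OF assms(3,1)])
  interpret subgroup H G by (rule assms(3))
  have "finite H" using assms(2,3) subgroup.subset finite_subset by blast
  interpret subgroup_cocycle G H \<alpha>
    by unfold_locales (use assms \<open>finite H\<close> in \<open>simp_all add: cocycle2_def\<close>)
  show ?thesis by (rule based_module_M)
qed

end
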